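(* Let $\Gamma$ be a finite simplicial graph with right-angled Artin group $A_\Gamma$, and let $F=\langle u,v\rangle$ be the free group on two generators $u,v$. If $\phi:F\to A_\Gamma$ is a homomorphism such that $\phi(u)$ and $\phi(v)$ do not commute, then $\phi$ is a quasi-isometric embedding (with respect to word metrics on $F$ and $A_\Gamma$ coming from finite generating sets).
   Context: The right-angled Artin group $A_\Gamma$ is the group with generating set the vertices $V$ of $\Gamma$ and relations $v_iv_j=v_jv_i$ for each edge $(v_i,v_j)$ of $\Gamma$. For a finite generating set $S$ of a group $G$, the word metric is $d(g_1,g_2)=$ the length of a shortest word in $S^{\pm1}$ representing $g_1^{-1}g_2$. A map $f:Y\to Z$ of metric spaces is a quasi-isometric embedding if there are constants $\lambda\ge 1$, $\epsilon\ge 0$ with $\frac1\lambda d_Y(p,q)-\epsilon\le d_Z(f(p),f(q))\le\lambda d_Y(p,q)+\epsilon$ for all $p,q\in Y$ (for word metrics, this does not depend on the choice of finite generating sets). *)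

theory Defs
  imports
    "HOL-Algebra.Generated_Groups"
    Complex_Main
    "Graph_Theory.Pair_Digraph"
begin

section \<open>Groups given by generators and relations\<close>

text \<open>A word over the alphabet \<open>V\<close> and its formal inverses: the letter \<open>(x, True)\<close> stands for
  \<open>x\<close> and \<open>(x, False)\<close> for the inverse of \<open>x\<close>.\<close>

type_synonym 'a word = "('a \<times> bool) list"

definition words :: "'a set \<Rightarrow> 'a word set" where
  "words V = lists (V \<times> UNIV)"

text \<open>The least congruence on words that cancels adjacent inverse letters and identifies the two
  sides of each relation. A relation \<open>l = r\<close> is a pair \<open>(l, r)\<close>; pairs that are not words over
  \<open>V\<close> are ignored.\<close>

inductive_set word_cong :: "'a set \<Rightarrow> ('a word \<times> 'a word) set \<Rightarrow> 'a word rel"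
  for V :: "'a set" and R :: "('a word \<times> 'a word) set" where
  refl: "w \<in> words V \<Longrightarrow> (w, w) \<in> word_cong V R"
| sym: "(v, w) \<in> word_cong V R \<Longrightarrow> (w, v) \<in> word_cong V R"
| trans: "(u, v) \<in> word_cong V R \<Longrightarrow> (v, w) \<in> word_cong V R \<Longrightarrow> (u, w) \<in> word_cong V R"
| app: "(u, v) \<in> word_cong V R \<Longrightarrow> (u', v') \<in> word_cong V R \<Longrightarrow> (u @ u', v @ v') \<in> word_cong V R"
| cancel: "x \<in> V \<Longrightarrow> ([(x, b), (x, \<not> b)], []) \<in> word_cong V R"
| rel: "(l, r) \<in> R \<Longrightarrow> l \<in> words V \<Longrightarrow> r \<in> words V \<Longrightarrow> (l, r) \<in> word_cong V R"

definition word_class :: "'a set \<Rightarrow> ('a word \<times> 'a word) set \<Rightarrow> 'a word \<Rightarrow> 'a word set" where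
  "word_class V R w = word_cong V R `` {w}"

definition presented_group :: "'a set \<Rightarrow> ('a word \<times> 'a word) set \<Rightarrow> 'a word set monoid" where
  "presented_group V R =
     \<lparr> carrier = words V // word_cong V R,
       monoid.mult = (\<lambda>A B. \<Union>a\<in>A. \<Union>b\<in>B. word_class V R (a @ b)),
       monoid.one = word_class V R [] \<rparr>"

definition free_group :: "'a set \<Rightarrow> 'a word set monoid" where
  "free_group V = presented_group V {}"

definition free_gen :: "'a set \<Rightarrow> 'a \<Rightarrow> 'a word set" where
  "free_gen V x = word_class V {} [(x, True)]"

text \<open>A finite simplicial graph is a \<^const>\<open>pair_graph\<close>: finitely many vertices, no loops, and an
  undirected edge given by its two orientations in \<^const>\<open>parcs\<close>.\<close>

definition raag :: "'a pair_pre_digraph \<Rightarrow> 'a word set monoid" where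
  "raag \<Gamma> = presented_group (pverts \<Gamma>)
     {([(x, True), (y, True)], [(y, True), (x, True)]) | x y. (x, y) \<in> parcs \<Gamma>}"

section \<open>Word metrics and quasi-isometric embeddings\<close>

definition word_length :: "('g, 'm) monoid_scheme \<Rightarrow> 'g set \<Rightarrow> 'g \<Rightarrow> nat" where
  "word_length G S g =
     (LEAST n. \<exists>ss. length ss = n \<and> set ss \<subseteq> S \<union> (\<lambda>s. inv\<^bsub>G\<^esub> s) ` S \<and>
                    foldr (\<lambda>x y. x \<otimes>\<^bsub>G\<^esub> y) ss \<one>\<^bsub>G\<^esub> = g)"

definition word_metric :: "('g, 'm) monoid_scheme \<Rightarrow> 'g set \<Rightarrow> 'g \<Rightarrow> 'g \<Rightarrow> real" where
  "word_metric G S g h = real (word_length G S (inv\<^bsub>G\<^esub> g \<otimes>\<^bsub>G\<^esub> h))"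

definition finite_generating_set :: "('g, 'm) monoid_scheme \<Rightarrow> 'g set \<Rightarrow> bool" where
  "finite_generating_set G S \<longleftrightarrow> finite S \<and> S \<subseteq> carrier G \<and> generate G S = carrier G"

definition quasi_isometric_embedding ::
  "'y set \<Rightarrow> ('y \<Rightarrow> 'y \<Rightarrow> real) \<Rightarrow> 'z set \<Rightarrow> ('z \<Rightarrow> 'z \<Rightarrow> real) \<Rightarrow> ('y \<Rightarrow> 'z) \<Rightarrow> bool" where
  "quasi_isometric_embedding Y dY Z dZ f \<longleftrightarrow>
     f \<in> Y \<rightarrow> Z \<and>
     (\<exists>L \<epsilon>. L \<ge> 1 \<and> \<epsilon> \<ge> 0 \<and>
        (\<forall>p\<in>Y. \<forall>q\<in>Y. (1 / L) * dY p q - \<epsilon> \<le> dZ (f p) (f q) \<and>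
                      dZ (f p) (f q) \<le> L * dY p q + \<epsilon>))"

section \<open>Well-definedness\<close>

lemma word_cong_words: "(v, w) \<in> word_cong V R \<Longrightarrow> v \<in> words V \<and> w \<in> words V"
  by (induction rule: word_cong.induct) (auto simp: words_def)

lemma equiv_word_cong: "equiv (words V) (word_cong V R)"
proof (rule equivI)
  show "word_cong V R \<subseteq> words V \<times> words V" using word_cong_words by auto
  show "refl_on (words V) (word_cong V R)" by (simp add: refl_on_def word_cong.refl)
  show "Relation.sym (word_cong V R)" by (rule symI) (rule word_cong.sym)
  show "Relation.trans (word_cong V R)" by (rule transI) (rule word_cong.trans)
qed

lemma word_class_eq_iff:
  assumes "v \<in> words V" "w \<in> words V"
  shows "word_class V R v = word_class V R w \<longleftrightarrow> (v, w) \<in> word_cong V R"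
  unfolding word_class_def using eq_equiv_class_iff[OF equiv_word_cong assms] .

lemma carrier_presented_group: "carrier (presented_group V R) = word_class V R ` words V"
  by (auto simp: presented_group_def quotient_def word_class_def)

lemma mult_presented_group:
  assumes "v \<in> words V" "w \<in> words V"
  shows "word_class V R v \<otimes>\<^bsub>presented_group V R\<^esub> word_class V R w = word_class V R (v @ w)"
proof -
  have "word_class V R (a @ b) = word_class V R (v @ w)"
    if "a \<in> word_class V R v" "b \<in> word_class V R w" for a b
  proof -
    have "(v @ w, a @ b) \<in> word_cong V R"
      using that by (auto simp: word_class_def intro: word_cong.app)
    from equiv_class_eq[OF equiv_word_cong this] show ?thesis
      by (simp add: word_class_def)
  qed
  moreover have "v \<in> word_class V R v" "w \<in> word_class V R w"
    using assms by (auto simp: word_class_def intro: word_cong.refl)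
  ultimately have "(\<Union>a\<in>word_class V R v. \<Union>b\<in>word_class V R w. word_class V R (a @ b)) =
      word_class V R (v @ w)" by blast
  then show ?thesis by (simp add: presented_group_def)
qed

lemma one_presented_group: "\<one>\<^bsub>presented_group V R\<^esub> = word_class V R []"
  by (simp add: presented_group_def)

definition word_inv :: "'a word \<Rightarrow> 'a word" where
  "word_inv w = rev (map (\<lambda>(x, b). (x, \<not> b)) w)"

lemma word_inv_words: "w \<in> words V \<Longrightarrow> word_inv w \<in> words V"
  by (auto simp: words_def word_inv_def)

lemma word_inv_cancel: "w \<in> words V \<Longrightarrow> (word_inv w @ w, []) \<in> word_cong V R"
proof (induction w)
  case Nil
  then show ?case by (auto simp: word_inv_def words_def intro: word_cong.refl)
next
  case (Cons p w)
  obtain x b where p: "p = (x, b)" by (cases p)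
  have x: "x \<in> V" and w: "w \<in> words V" using Cons.prems by (auto simp: words_def p)
  have "([(x, \<not> b), (x, b)], []) \<in> word_cong V R"
    using word_cong.cancel[OF x, of "\<not> b" R] by simp
  from word_cong.app[OF word_cong.refl[OF word_inv_words[OF w]]
      word_cong.app[OF this word_cong.refl[OF w]]]
  have "(word_inv (p # w) @ p # w, word_inv w @ w) \<in> word_cong V R"
    by (simp add: word_inv_def p)
  with Cons.IH[OF w] show ?case by (blast intro: word_cong.trans)
qed

lemma group_presented_group: "group (presented_group V R)"
proof (rule groupI)
  fix A B C
  assume "A \<in> carrier (presented_group V R)" "B \<in> carrier (presented_group V R)"
    "C \<in> carrier (presented_group V R)"
  then obtain a b c where abc: "A = word_class V R a" "B = word_class V R b" "C = word_class V R c"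
    "a \<in> words V" "b \<in> words V" "c \<in> words V"
    by (auto simp: carrier_presented_group)
  moreover have "a @ b \<in> words V" "b @ c \<in> words V"
    using abc by (auto simp: words_def)
  ultimately show "A \<otimes>\<^bsub>presented_group V R\<^esub> B \<otimes>\<^bsub>presented_group V R\<^esub> C =
      A \<otimes>\<^bsub>presented_group V R\<^esub> (B \<otimes>\<^bsub>presented_group V R\<^esub> C)"
    by (simp add: mult_presented_group)
next
  fix A B
  assume "A \<in> carrier (presented_group V R)" "B \<in> carrier (presented_group V R)"
  then obtain a b where ab: "A = word_class V R a" "B = word_class V R b"
    "a \<in> words V" "b \<in> words V"
    by (auto simp: carrier_presented_group)
  moreover have "a @ b \<in> words V" using ab by (auto simp: words_def)
  ultimately show "A \<otimes>\<^bsub>presented_group V R\<^esub> B \<in> carrier (presented_group V R)"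
    by (simp add: mult_presented_group carrier_presented_group)
next
  show "\<one>\<^bsub>presented_group V R\<^esub> \<in> carrier (presented_group V R)"
    by (auto simp: one_presented_group carrier_presented_group words_def)
next
  fix A assume "A \<in> carrier (presented_group V R)"
  then obtain a where a: "A = word_class V R a" "a \<in> words V"
    by (auto simp: carrier_presented_group)
  have nil: "[] \<in> words V" by (simp add: words_def)
  show "\<one>\<^bsub>presented_group V R\<^esub> \<otimes>\<^bsub>presented_group V R\<^esub> A = A"
    using a nil by (simp add: mult_presented_group one_presented_group)
  have ia: "word_inv a \<in> words V" and "word_inv a @ a \<in> words V"
    using word_inv_words[OF a(2)] a(2) by (auto simp: words_def)
  then have "word_class V R (word_inv a) \<otimes>\<^bsub>presented_group V R\<^esub> A = \<one>\<^bsub>presented_group V R\<^esub>"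
    using a word_inv_cancel[OF a(2), of R] nil
    by (simp add: mult_presented_group one_presented_group word_class_eq_iff)
  moreover have "word_class V R (word_inv a) \<in> carrier (presented_group V R)"
    using ia by (simp add: carrier_presented_group)
  ultimately show "\<exists>B\<in>carrier (presented_group V R).
      B \<otimes>\<^bsub>presented_group V R\<^esub> A = \<one>\<^bsub>presented_group V R\<^esub>"
    by blast
qed

lemma group_free_group: "group (free_group V)"
  and group_raag: "group (raag \<Gamma>)"
  by (simp_all add: free_group_def raag_def group_presented_group)

context group
begin

definition sym_words :: "'a set \<Rightarrow> 'a list set" where
  "sym_words S = {ss. set ss \<subseteq> S \<union> (\<lambda>s. inv s) ` S}"

abbreviation list_prod :: "'a list \<Rightarrow> 'a" where
  "list_prod ss \<equiv> foldr (\<lambda>x y. x \<otimes> y) ss \<one>"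

lemma sym_words_carrier: "S \<subseteq> carrier G \<Longrightarrow> ss \<in> sym_words S \<Longrightarrow> set ss \<subseteq> carrier G"
  by (auto simp: sym_words_def)

lemma list_prod_closed: "set ss \<subseteq> carrier G \<Longrightarrow> list_prod ss \<in> carrier G"
  by (induction ss) auto

lemma list_prod_append:
  "set ss \<subseteq> carrier G \<Longrightarrow> set ts \<subseteq> carrier G \<Longrightarrow>
    list_prod (ss @ ts) = list_prod ss \<otimes> list_prod ts"
  by (induction ss) (auto simp: m_assoc list_prod_closed)

lemma list_prod_rev_inv:
  "set ss \<subseteq> carrier G \<Longrightarrow> list_prod (rev (map (\<lambda>s. inv s) ss)) = inv (list_prod ss)"
proof (induction ss)
  case (Cons s ss)
  have "(\<lambda>s. inv s) ` set ss \<subseteq> carrier G" using Cons.prems by auto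
  then show ?case
    using Cons by (simp add: list_prod_append list_prod_closed inv_mult_group del: foldr_append)
qed simp

lemma ex_sym_word:
  assumes S: "S \<subseteq> carrier G" and g: "g \<in> generate G S"
  shows "\<exists>ss\<in>sym_words S. list_prod ss = g"
  using g
proof (induction rule: generate.induct)
  case one
  show ?case by (rule bexI[of _ "[]"]) (simp_all add: sym_words_def)
next
  case (incl h)
  then show ?case using S by (intro bexI[of _ "[h]"]) (auto simp: sym_words_def)
next
  case (inv h)
  then show ?case using S by (intro bexI[of _ "[inv h]"]) (auto simp: sym_words_def)
next
  case (eng h1 h2)
  then obtain s1 s2 where "s1 \<in> sym_words S" "list_prod s1 = h1"
    "s2 \<in> sym_words S" "list_prod s2 = h2" by blast
  moreover from this have "s1 @ s2 \<in> sym_words S" by (simp add: sym_words_def)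
  ultimately show ?case
    using S by (intro bexI[of _ "s1 @ s2"]) (simp_all add: list_prod_append sym_words_carrier[of S] del: foldr_append)
qed

lemma word_length_le: "ss \<in> sym_words S \<Longrightarrow> word_length G S (list_prod ss) \<le> length ss"
  unfolding word_length_def sym_words_def by (rule Least_le) blast

lemma word_length_attained:
  assumes "finite_generating_set G S" "g \<in> carrier G"
  obtains ss where "ss \<in> sym_words S" "list_prod ss = g" "length ss = word_length G S g"
proof -
  have "\<exists>n ss. length ss = n \<and> set ss \<subseteq> S \<union> (\<lambda>s. inv s) ` S \<and> list_prod ss = g"
    using ex_sym_word[of S g] assms by (auto simp: finite_generating_set_def sym_words_def)
  from LeastI_ex[OF this] that show thesis
    by (auto simp: word_length_def sym_words_def)
qed

lemma word_length_inv_le: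
  assumes S: "finite_generating_set G S" and g: "g \<in> carrier G"
  shows "word_length G S (inv g) \<le> word_length G S g"
proof -
  obtain ss where ss: "ss \<in> sym_words S" "list_prod ss = g" "length ss = word_length G S g"
    using word_length_attained[OF S g] .
  have SG: "S \<subseteq> carrier G" using S by (simp add: finite_generating_set_def)
  have "rev (map (\<lambda>s. inv s) ss) \<in> sym_words S"
    using ss(1) SG by (fastforce simp: sym_words_def)
  from word_length_le[OF this] show ?thesis
    using ss list_prod_rev_inv[OF sym_words_carrier[OF SG ss(1)]] by simp
qed

lemma word_length_mult_le:
  assumes S: "finite_generating_set G S" and g: "g \<in> carrier G" and h: "h \<in> carrier G"
  shows "word_length G S (g \<otimes> h) \<le> word_length G S g + word_length G S h"
proof -
  obtain ss where ss: "ss \<in> sym_words S" "list_prod ss = g" "length ss = word_length G S g"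
    using word_length_attained[OF S g] .
  obtain ts where ts: "ts \<in> sym_words S" "list_prod ts = h" "length ts = word_length G S h"
    using word_length_attained[OF S h] .
  have SG: "S \<subseteq> carrier G" using S by (simp add: finite_generating_set_def)
  have "ss @ ts \<in> sym_words S" using ss(1) ts(1) by (auto simp: sym_words_def)
  from word_length_le[OF this] show ?thesis
    using ss ts SG by (simp add: list_prod_append sym_words_carrier[of S] del: foldr_append)
qed

lemma word_metric_sym:
  assumes S: "finite_generating_set G S" and "g \<in> carrier G" "h \<in> carrier G"
  shows "word_metric G S g h = word_metric G S h g"
proof -
  have le: "word_length G S (inv b \<otimes> a) \<le> word_length G S (inv a \<otimes> b)"
    if "a \<in> carrier G" "b \<in> carrier G" for a b
    using word_length_inv_le[OF S, of "inv a \<otimes> b"] that by (simp add: inv_mult_group)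
  have "word_length G S (inv g \<otimes> h) = word_length G S (inv h \<otimes> g)"
    using le assms(2,3) by (intro antisym) blast+
  then show ?thesis by (simp add: word_metric_def)
qed

lemma word_metric_eq_0_iff:
  assumes S: "finite_generating_set G S" and g: "g \<in> carrier G" and h: "h \<in> carrier G"
  shows "word_metric G S g h = 0 \<longleftrightarrow> g = h"
proof
  assume "g = h"
  moreover have "word_length G S \<one> = 0"
    using word_length_le[of "[]" S] by (simp add: sym_words_def)
  ultimately show "word_metric G S g h = 0" using h by (simp add: word_metric_def)
next
  assume 0: "word_metric G S g h = 0"
  have gh: "inv g \<otimes> h \<in> carrier G" using g h by simp
  obtain ss where "list_prod ss = inv g \<otimes> h" "length ss = word_length G S (inv g \<otimes> h)"
    using word_length_attained[OF S gh] by blast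
  with 0 have "inv g \<otimes> h = \<one>" by (simp add: word_metric_def)
  then have "inv g = inv h" using g h inv_equality[of "inv g" h] by simp
  then show "g = h" using g h by (metis inv_inv)
qed

lemma word_metric_triangle:
  assumes S: "finite_generating_set G S"
    and "g \<in> carrier G" "h \<in> carrier G" "k \<in> carrier G"
  shows "word_metric G S g k \<le> word_metric G S g h + word_metric G S h k"
proof -
  have "h \<otimes> (inv h \<otimes> k) = k"
    using assms(3,4) by (simp flip: m_assoc)
  then have "inv g \<otimes> k = (inv g \<otimes> h) \<otimes> (inv h \<otimes> k)"
    using assms by (simp add: m_assoc)
  then show ?thesis
    using word_length_mult_le[OF S, of "inv g \<otimes> h" "inv h \<otimes> k"] assms
    by (simp add: word_metric_def)
qed

end

end

theory Submission
  imports Defs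
begin

text \<open>
  For each vertex \<open>v\<close> the group splits as an HNN extension with stable letter \<open>v\<close> and so acts on a tree;
  an element that is elliptic in all these trees is trivial, since it is conjugate to its image under
  the retraction that kills all vertices. After replacing \<open>\<phi>\<close> by its composition with a retraction onto the
  subgroup of a minimal set of vertices for which the images still do not commute, killing one more
  vertex \<open>v\<close> makes the image abelian; then two elements \<open>x\<close>, \<open>y\<close> of the image commute as soon as \<open>x y\<close> and
  \<open>y x\<close> agree at one point of the tree of \<open>v\<close>.

  In one such tree, choose a generating pair \<open>c\<close>, \<open>e\<close> of the free group that is Nielsen minimal, or has as many
  elliptic members as possible. Ping-pong bounds the number of syllables of a word in \<open>c\<close>, \<open>e\<close> by its
  displacement. In particular, distinct conjugates of \<open>c\<close> and \<open>e\<close> that occur along a reduced word do not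
  commute, so in every tree their axes overlap in bounded segments. A word therefore traces
  a polygonal line whose sides pairwise overlap boundedly, and such a line loses to backtracking only an
  amount linear in its number of sides. Since \<open>c\<close> and \<open>e\<close> are each hyperbolic in some tree, the exponents in the
  word are bounded by the displacements as well.
\<close>

section \<open>Trees as metric spaces\<close>

text \<open>Point stabilizers in these trees can be infinite, so one tree cannot bound the length of
  a word: if \<open>c\<close> fixes the base point, all its powers cost nothing there. A single tree
  therefore controls only the number of syllables. The exponents are visible in a tree where
  \<open>c\<close> or \<open>e\<close> is hyperbolic, but in that tree the other generator may be
  elliptic and the pair need not be minimal. What carries over from one tree to another is
  commutation: a long overlap of axes in any tree forces two group elements to commute, and the
  syllable count in the first tree forbids it. The resulting error is linear in the number of
  syllables, which is already bounded.

  The abelian image after killing \<open>v\<close> is needed because the action on the tree of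
  \<open>v\<close> determines an element only up to its image under that retraction.

  Passing to another generating pair of the free group changes word lengths by a bounded factor, so
  the pair may be chosen to suit one tree. The total displacement over all trees is subadditive,
  hence at most a multiple of the word length in the Artin group, and this closes the lower
  estimate.\<close>

locale tree =
  fixes d :: "'p \<Rightarrow> 'p \<Rightarrow> int"
  assumes d_eq_0_iff [simp]: "d x y = 0 \<longleftrightarrow> x = y"
    and d_commute: "d x y = d y x"
    and four_point: "d x y + d z w \<le> max (d x z + d y w) (d x w + d y z)"
    and geodesic: "0 \<le> i \<Longrightarrow> i \<le> d x y \<Longrightarrow> \<exists>z. d x z = i \<and> d z y = d x y - i"
    and parity: "even (d x y + d y z + d z x)"
begin

lemma d_self [simp]: "d x x = 0"
  by simp

lemma triangle: "d x z \<le> d x y + d y z"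
  using four_point[of x z y y] by (simp add: d_commute)

lemma d_nonneg [simp]: "0 \<le> d x y"
  using triangle[of x x y] d_commute[of x y] by simp

text \<open>Twice the Gromov product of \<open>x\<close> and \<open>y\<close> at \<open>p\<close>.\<close>
definition ov :: "'p \<Rightarrow> 'p \<Rightarrow> 'p \<Rightarrow> int" where
  "ov p x y = d p x + d p y - d x y"

definition seg :: "'p \<Rightarrow> 'p \<Rightarrow> 'p set" where
  "seg x y = {z. d x z + d z y = d x y}"

lemma ov_commute: "ov p x y = ov p y x"
  by (simp add: ov_def d_commute)

lemma ov_nonneg: "0 \<le> ov p x y"
  using triangle[of x y p] d_commute[of x p] by (simp add: ov_def)

lemma ov_self [simp]: "ov p x x = 2 * d p x"
  by (simp add: ov_def)

lemma ov_le: "ov p x y \<le> 2 * d p x" "ov p x y \<le> 2 * d p y"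
  using triangle[of p y x] triangle[of p x y] d_commute[of x y] by (simp_all add: ov_def)

text \<open>The parity axiom serves this purpose: Gromov products are integers, so the branch point
  in \<open>median\<close> is a vertex.\<close>

lemma even_ov: "even (ov p x y)"
  using parity[of p x y] d_commute[of y p] by (simp add: ov_def) argo

lemma ov_min: "min (ov p x y) (ov p y z) \<le> ov p x z"
  using four_point[of x z y p] d_commute
  by (simp add: ov_def min_def max_def split: if_splits)

lemma ov_eq_of_less: "ov p x y < ov p y z \<Longrightarrow> ov p x z = ov p x y"
  using ov_min[of p x y z] ov_min[of p x z y] ov_commute[of p z y] by auto

lemma seg_commute: "seg x y = seg y x"
  by (auto simp: seg_def d_commute)

lemma seg_ends [simp]: "x \<in> seg x y" "y \<in> seg x y"
  by (simp_all add: seg_def)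

text \<open>Two geodesics from \<open>p\<close> agree up to the Gromov product:
  \<open>ov p z x\<close> has its maximal value \<open>2 * d p z\<close>, and the ultrametric
  inequality \<open>ov_min\<close> passes this on to \<open>y\<close>.\<close>

lemma seg_ov:
  assumes "z \<in> seg p x" "2 * d p z \<le> ov p x y"
  shows "z \<in> seg p y"
proof -
  have "ov p z x = 2 * d p z" using assms(1) by (simp add: ov_def seg_def)
  then have "2 * d p z \<le> ov p z y" using ov_min[of p z x y] assms(2) by auto
  with triangle[of p y z] show ?thesis by (simp add: seg_def ov_def)
qed

lemma ov_of_seg: "z \<in> seg p x \<Longrightarrow> z \<in> seg p y \<Longrightarrow> 2 * d p z \<le> ov p x y"
  using triangle[of x y z] d_commute[of x z] by (simp add: ov_def seg_def)

lemma seg_dist: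
  assumes "p \<in> seg x y" "q \<in> seg x y"
  shows "d p q = \<bar>d x p - d x q\<bar>"
proof -
  have "d p q + d x y \<le> max (d p x + d q y) (d p y + d q x)" by (rule four_point)
  then have "d p q \<le> \<bar>d x p - d x q\<bar>"
    using assms d_commute[of p x] d_commute[of q x] by (auto simp: seg_def)
  moreover have "\<bar>d x p - d x q\<bar> \<le> d p q"
    using triangle[of x p q] triangle[of x q p] d_commute[of q p] by auto
  ultimately show ?thesis by simp
qed

lemma seg_unique: "p \<in> seg x y \<Longrightarrow> q \<in> seg x y \<Longrightarrow> d x p = d x q \<Longrightarrow> p = q"
  using seg_dist[of p x y q] by simp

lemma seg_point:
  assumes "0 \<le> i" "i \<le> d x y"
  obtains z where "z \<in> seg x y" "d x z = i"
proof -
  obtain z where "d x z = i" "d z y = d x y - i" using geodesic[OF assms] by blast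
  then show thesis by (intro that[of z]) (simp_all add: seg_def)
qed

lemma median:
  obtains m where "m \<in> seg p x" "m \<in> seg p y" "m \<in> seg x y" "2 * d p m = ov p x y"
proof -
  obtain k where k: "ov p x y = 2 * k" using even_ov[of p x y] by blast
  obtain m where m: "m \<in> seg p x" "d p m = k"
    using seg_point[of k p x] ov_le(1)[of p x y] ov_nonneg[of p x y] k by auto
  then have "m \<in> seg p y" using seg_ov[of m p x y] k by simp
  moreover from this m k have "m \<in> seg x y"
    using d_commute[of m x] by (simp add: seg_def ov_def)
  ultimately show thesis using that m k by simp
qed

lemma seg_trans:
  assumes "z \<in> seg x y" "w \<in> seg x z"
  shows "w \<in> seg x y" "z \<in> seg w y"
  using assms triangle[of w y z] triangle[of x y w] by (simp_all add: seg_def)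

lemma seg_sub:
  assumes "p \<in> seg x y" "q \<in> seg x y"
  shows "seg p q \<subseteq> seg x y"
proof -
  have *: "seg p q \<subseteq> seg x y" if "p \<in> seg x y" "q \<in> seg x y" "d x p \<le> d x q" for p q
  proof
    fix z assume z: "z \<in> seg p q"
    have pq: "d p q = d x q - d x p" using seg_dist[OF that(1,2)] that(3) by simp
    show "z \<in> seg x y"
      using z that pq triangle[of x z p] triangle[of z y q] triangle[of x y z]
      by (simp add: seg_def)
  qed
  show ?thesis
    using *[OF assms] *[OF assms(2,1)] seg_commute[of p q] linear[of "d x p" "d x q"] by metis
qed

text \<open>Geodesics that share a piece of positive length glue together; positivity excludes one
  alternative of the four-point condition.\<close>

lemma seg_concat:
  assumes "m \<noteq> u" "m \<in> seg p u" "u \<in> seg m l"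
  shows "u \<in> seg p l"
proof -
  have "d p u + d m l \<le> max (d p m + d u l) (d p l + d u m)" by (rule four_point)
  moreover have "0 < d m u" using assms(1) by (simp add: order_less_le)
  ultimately show ?thesis
    using assms triangle[of p l u] d_commute[of u m] by (auto simp: seg_def)
qed

text \<open>The middle of a long geodesic survives when its ends move by at most \<open>D\<close>;
  the four-point condition is applied to one end at a time. The last two conditions cover the
  boundary case in which \<open>z\<close> has distance exactly \<open>D\<close> from an end.\<close>

lemma quadrilateral:
  assumes D: "d x x' \<le> D" "d y y' \<le> D" "2 * D < d x y" and z: "z \<in> seg x y" "D \<le> d x z" "D \<le> d z y" "d z x' \<noteq> 0" "d z y' \<noteq> 0"
  shows "z \<in> seg x' y'"
proof -
  have 1: "d x y + d z x' \<le> max (d x z + d y x') (d x x' + d y z)" by (rule four_point)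
  have 0: "0 < d z x'" "0 < d z y'" using z(4,5) d_nonneg[of z x'] d_nonneg[of z y'] by linarith+
  have 2: "z \<in> seg x' y"
    using 1 0 D z triangle[of x' y z] d_commute[of y z] d_commute[of y x'] d_commute[of z x'] by (auto simp: seg_def)
  have 3: "d x' y + d z y' \<le> max (d x' z + d y y') (d x' y' + d y z)" by (rule four_point)
  show ?thesis
    using 3 2 0 D z triangle[of x' y' z] d_commute[of y z] d_commute[of y' z] by (auto simp: seg_def)
qed

end

section \<open>Isometric actions on trees\<close>

text \<open>\<open>no_inversion\<close> is phrased through points instead of edges: if
  \<open>x\<close> swaps \<open>p\<close> and \<open>act x p\<close>, their midpoint is a
  vertex.\<close>

locale tree_action = group G + tree d
  for G (structure) and d :: "'p \<Rightarrow> 'p \<Rightarrow> int" +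
  fixes act :: "'a \<Rightarrow> 'p \<Rightarrow> 'p"
  assumes act_mult: "x \<in> carrier G \<Longrightarrow> y \<in> carrier G \<Longrightarrow> act (x \<otimes> y) p = act x (act y p)"
    and act_one [simp]: "act \<one> p = p"
    and act_d [simp]: "x \<in> carrier G \<Longrightarrow> d (act x p) (act x q) = d p q"
    and no_inversion: "x \<in> carrier G \<Longrightarrow> act x (act x p) = p \<Longrightarrow> even (d p (act x p))"
begin

section \<open>Fixed points and displacement\<close>

definition elliptic :: "'a \<Rightarrow> bool" where
  "elliptic x \<longleftrightarrow> (\<exists>p. act x p = p)"

lemma act_inv_cancel [simp]:
  "x \<in> carrier G \<Longrightarrow> act (inv x) (act x p) = p"
  "x \<in> carrier G \<Longrightarrow> act x (act (inv x) p) = p"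
  by (simp_all flip: act_mult)

lemma act_eq_iff [simp]: "x \<in> carrier G \<Longrightarrow> act x p = act x q \<longleftrightarrow> p = q"
  by (metis act_inv_cancel(1))

lemma d_act_left: "x \<in> carrier G \<Longrightarrow> d (act x p) q = d p (act (inv x) q)"
  by (metis act_d act_inv_cancel(2))

lemma act_seg: "x \<in> carrier G \<Longrightarrow> act x z \<in> seg (act x p) (act x q) \<longleftrightarrow> z \<in> seg p q"
  by (simp add: seg_def)

lemma act_seg_image: "x \<in> carrier G \<Longrightarrow> seg (act x p) (act x q) = act x ` seg p q"
  by (auto simp: act_seg image_iff) (metis act_seg act_inv_cancel(2))

lemma act_ov: "x \<in> carrier G \<Longrightarrow> ov (act x p) (act x q) (act x r) = ov p q r"
  by (simp add: ov_def)

text \<open>Otherwise the path from \<open>p\<close> over \<open>act x p\<close> to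
  \<open>act x (act x p)\<close> would backtrack at least to the middle of its first half, and
  \<open>x\<close> would fix the midpoint of that half or flip its middle edge.\<close>

lemma not_elliptic_square:
  assumes x: "x \<in> carrier G" and "\<not> elliptic x"
  shows "d p (act x p) < d p (act x (act x p))"
proof (rule ccontr)
  assume neg: "\<not> ?thesis"
  define a where "a = d p (act x p)"
  have le: "d p (act x (act x p)) \<le> a" using neg by (simp add: a_def)
  have a1: "d (act x p) (act x (act x p)) = a" using x by (simp add: a_def)
  have a0: "0 \<le> a" by (simp add: a_def)
  have ev2: "even (d p (act x (act x p)))"
    using parity[of p "act x p" "act x (act x p)"] a1 a_def d_commute[of "act x (act x p)" p] by simp
  define k where "k = a div 2"
  have k: "0 \<le> k" "k \<le> a" using a0 by (auto simp: k_def)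
  obtain z where z: "z \<in> seg p (act x p)" "d p z = k"
    using seg_point[of k p "act x p"] k a_def by auto
  have z2: "d z (act x p) = a - k" using z by (simp add: seg_def a_def)
  let ?z = "act x z" and ?y = "act x p" and ?w = "act x (act x p)"
  have yz: "d ?y ?z = k" "d ?z ?w = a - k" using x z z2 by simp_all
  have f1: "d ?z p + d ?y ?w \<le> max (d ?z ?y + d p ?w) (d ?z ?w + d p ?y)" by (rule four_point)
  have f2: "d z ?z + d ?y p \<le> max (d z ?y + d ?z p) (d z p + d ?z ?y)" by (rule four_point)
  note dc = d_commute[of ?z p] d_commute[of ?z ?y] d_commute[of ?y p] d_commute[of z p]
  show False
  proof (cases "even a")
    case True
    then have "a = 2 * k" by (simp add: k_def)
    then have "d z ?z \<le> 0" using f1 f2 dc yz z z2 le a1 a_def by (auto simp: max_def split: if_splits)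
    then have "act x z = z" using d_nonneg[of z ?z] d_eq_0_iff[of z ?z] by simp
    then show False using assms(2) by (auto simp: elliptic_def)
  next
    case False
    then have ak: "a = 2 * k + 1" by (simp add: k_def)
    \<comment> \<open>Parity gains the unit that makes \<open>z\<close> and \<open>act x z\<close>
      the two ends of an edge which \<open>x\<close> flips.\<close>
    have le': "d p ?w \<le> a - 1" using le ev2 False by (cases "d p ?w = a") auto
    have "d ?z p \<le> k + 1" using f1 dc yz z z2 le' a1 a_def ak by (auto simp: max_def split: if_splits)
    then have z1: "d z ?z \<le> 1" using f2 dc yz z z2 ak a_def by (auto simp: max_def split: if_splits)
    have "d z ?z \<noteq> 0" using assms(2) by (metis elliptic_def d_eq_0_iff)
    then have z1: "d z ?z = 1" using z1 d_nonneg[of z ?z] by linarith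
    have f3: "d z ?w + d p ?y \<le> max (d z p + d ?w ?y) (d z ?y + d ?w p)" by (rule four_point)
    have zw: "d z ?w \<le> k"
      using f3 dc z z2 le' a1 a_def ak d_commute[of ?w ?y] d_commute[of ?w p] by (auto simp: max_def split: if_splits)
    let ?v = "act x ?z"
    have f4: "d z ?v + d ?z ?w \<le> max (d z ?z + d ?v ?w) (d z ?w + d ?v ?z)" by (rule four_point)
    have "d ?w ?v = k" "d ?z ?v = 1" using x yz z1 by simp_all
    then have "d z ?v \<le> 0"
      using f4 z1 zw yz ak d_commute[of ?w ?v] d_commute[of ?z ?v] by (auto simp: max_def split: if_splits)
    then have "?v = z" using d_nonneg[of z ?v] d_eq_0_iff[of z ?v] by simp
    from no_inversion[OF x this] z1 show False by simp
  qed
qed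

text \<open>In the product of \<open>x\<close> with itself, less than half of each factor
  cancels.\<close>

lemma not_elliptic_ov:
  assumes "x \<in> carrier G" "\<not> elliptic x"
  shows "ov p (act x p) (act (inv x) p) < d p (act x p)"
proof -
  have "d (act x p) (act (inv x) p) = d p (act x (act x p))"
    using assms(1) by (metis act_d act_inv_cancel(2) d_commute)
  moreover have "d p (act (inv x) p) = d p (act x p)"
    using assms(1) by (metis act_d act_inv_cancel(2) d_commute)
  ultimately show ?thesis
    using not_elliptic_square[OF assms, of p] by (simp add: ov_def)
qed

text \<open>Fixed points count as axis points with translation length zero, so every element has an
  axis point and later arguments need not distinguish elliptic from hyperbolic elements.\<close>

definition axis_point :: "'a \<Rightarrow> 'p \<Rightarrow> bool" where
  "axis_point x a \<longleftrightarrow> d a (act x (act x a)) = 2 * d a (act x a)"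

text \<open>A point of least displacement works: if the path over \<open>act x a\<close> to
  \<open>act x (act x a)\<close> backtracked, one step from \<open>a\<close> towards
  \<open>act x a\<close> would lower the displacement.\<close>

lemma axis_point_exists:
  assumes x: "x \<in> carrier G" and "\<not> elliptic x"
  obtains a where "axis_point x a"
proof -
  obtain a where a: "\<And>b. nat (d a (act x a)) \<le> nat (d b (act x b))"
    using exists_least_iff[of "\<lambda>n. \<exists>b. n = nat (d b (act x b))"]
    by (metis linorder_not_le)
  then have min: "d a (act x a) \<le> d b (act x b)" for b
    by (metis d_nonneg nat_le_eq_zle order_trans linorder_not_less nat_mono_iff zless_nat_eq_int_zless nonneg_int_cases of_nat_le_iff nat_int)
  let ?y = "act x a" and ?w = "act x (act x a)"
  define t where "t = d a ?y"
  have yw: "d ?y ?w = t" using x by (simp add: t_def)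
  have lt: "t < d a ?w" using not_elliptic_square[OF assms] by (simp add: t_def)
  have "d a ?w = 2 * t"
  proof (rule ccontr)
    assume ne: "d a ?w \<noteq> 2 * t"
    have "even (d a ?w)"
      using parity[of a ?y ?w] yw t_def d_commute[of ?w a] by simp
    then have le: "d a ?w \<le> 2 * t - 2"
      using ne triangle[of a ?w ?y] yw t_def by (auto elim!: evenE)
    obtain z where z: "z \<in> seg a ?y" "d a z = 1"
      using seg_point[of 1 a ?y] le lt t_def by auto
    then have z2: "d z ?y = t - 1" by (simp add: seg_def t_def)
    let ?z = "act x z"
    have z3: "d ?y ?z = 1" "d ?z ?w = t - 1" using x z z2 by simp_all
    have f1: "d ?z a + d ?y ?w \<le> max (d ?z ?y + d a ?w) (d ?z ?w + d a ?y)" by (rule four_point)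
    have f2: "d z ?z + d a ?y \<le> max (d z a + d ?z ?y) (d z ?y + d ?z a)" by (rule four_point)
    have "d z ?z < t"
      using f1 f2 z z2 z3 yw le lt t_def d_commute[of ?z ?y] d_commute[of z a]
      by (auto simp: max_def split: if_splits)
    then show False using min[of z] t_def by simp
  qed
  then show thesis using that[of a] by (simp add: axis_point_def t_def)
qed

section \<open>Translation along an axis\<close>

lemma act_pow_add:
  fixes m n :: int
  assumes "x \<in> carrier G"
  shows "act (x [^] m) (act (x [^] n) p) = act (x [^] (m + n)) p"
  using assms by (simp add: int_pow_mult act_mult)

text \<open>Consecutive steps do not backtrack, so the four-point condition adds one step at a time.
  It involves three successive orbit points, whence the induction on two distances at once.\<close>

lemma axis_nat:
  assumes x: "x \<in> carrier G" and a: "axis_point x a"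
  shows "d a (act (x [^] int n) a) = int n * d a (act x a)"
proof (cases "d a (act x a) = 0")
  case True
  then have *: "act x a = a" by simp
  have "act (x [^] int n) a = a"
  proof (induction n)
    case (Suc n)
    then show ?case using act_pow_add[OF x, of 1 "int n" a] x * by (simp add: int_pow_1 add.commute)
  qed simp
  then show ?thesis using True by simp
next
  case False
  define t where "t = d a (act x a)"
  have t: "0 < t" using False d_nonneg[of a "act x a"] by (simp add: t_def order_less_le)
  have "d a (act (x [^] int n) a) = int n * t \<and> d a (act (x [^] int (Suc n)) a) = int (Suc n) * t"
  proof (induction n)
    case 0
    then show ?case using x by (simp add: t_def int_pow_1)
  next
    case (Suc n)
    let ?p = "\<lambda>k. act (x [^] int k) a"
    have st: "?p (Suc k) = act (x [^] int k) (act x a)" for k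
      using act_pow_add[OF x, of "int k" 1 a] x by (simp add: int_pow_1 add.commute)
    have st2: "?p (Suc (Suc k)) = act (x [^] int k) (act x (act x a))" for k
      using act_pow_add[OF x, of "int k" 2 a] x act_pow_add[OF x, of 1 1 a] by (simp add: int_pow_1 add.commute)
    have d1: "d (?p k) (?p (Suc k)) = t" for k unfolding st using x by (simp add: t_def)
    have d2: "d (?p k) (?p (Suc (Suc k))) = 2 * t" for k
      unfolding st2 using x a by (simp add: t_def axis_point_def)
    have "d a (?p (Suc n)) + d (?p n) (?p (Suc (Suc n))) \<le>
      max (d a (?p n) + d (?p (Suc n)) (?p (Suc (Suc n)))) (d a (?p (Suc (Suc n))) + d (?p (Suc n)) (?p n))"
      by (rule four_point)
    then have "int (Suc (Suc n)) * t \<le> d a (?p (Suc (Suc n)))"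
      using Suc d1[of n] d1[of "Suc n"] d2[of n] t d_commute[of "?p (Suc n)" "?p n"]
      by (auto simp: max_def algebra_simps split: if_splits)
    moreover have "d a (?p (Suc (Suc n))) \<le> int (Suc (Suc n)) * t"
      using triangle[of a "?p (Suc (Suc n))" "?p (Suc n)"] Suc d1[of "Suc n"] by (simp add: algebra_simps)
    ultimately show ?case using Suc by simp
  qed
  then show ?thesis by (simp add: t_def)
qed

lemma axis_int:
  fixes m n :: int
  assumes x: "x \<in> carrier G" and a: "axis_point x a"
  shows "d (act (x [^] m) a) (act (x [^] n) a) = \<bar>n - m\<bar> * d a (act x a)"
proof -
  have *: "d (act (x [^] m) a) (act (x [^] n) a) = (n - m) * d a (act x a)" if "m \<le> n" for m n :: int
  proof -
    have "act (x [^] n) a = act (x [^] m) (act (x [^] int (nat (n - m))) a)"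
      using that act_pow_add[OF x] by simp
    then show ?thesis using axis_nat[OF x a, of "nat (n - m)"] x that by simp
  qed
  show ?thesis
    using *[of m n] *[of n m] d_commute by (cases "m \<le> n") (auto simp: abs_if)
qed

lemma axis_conj:
  assumes "x \<in> carrier G" "y \<in> carrier G" "axis_point x a"
  shows "axis_point (y \<otimes> x \<otimes> inv y) (act y a)" "d (act y a) (act (y \<otimes> x \<otimes> inv y) (act y a)) = d a (act x a)"
  using assms by (simp_all add: axis_point_def act_mult)

text \<open>Either \<open>x\<close> or its inverse translates towards \<open>q\<close>. The choice
  is made before \<open>z\<close>, so that the shift can be combined with a shift along another
  axis.\<close>

lemma axis_shift:
  assumes x: "x \<in> carrier G" and a: "axis_point x a"
    and p: "p \<in> seg (act (x [^] (i::int)) a) (act (x [^] (j::int)) a)"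
    and q: "q \<in> seg (act (x [^] i) a) (act (x [^] j) a)"
  obtains y where "y = x \<or> y = inv x"
    "\<And>z. z \<in> seg p q \<Longrightarrow> d a (act x a) \<le> d z q \<Longrightarrow> d (act y z) q = d z q - d a (act x a) \<and> act y z \<in> seg p q"
proof -
  have main: "\<exists>y. (y = x \<or> y = inv x) \<and>
    (\<forall>z. z \<in> seg p q \<longrightarrow> d a (act x a) \<le> d z q \<longrightarrow> d (act y z) q = d z q - d a (act x a) \<and> act y z \<in> seg p q)"
    if p: "p \<in> seg (act (x [^] (i::int)) a) (act (x [^] (j::int)) a)"
    and q: "q \<in> seg (act (x [^] i) a) (act (x [^] j) a)" and ij: "i \<le> j" for i j :: int
  proof -
    define t where "t = d a (act x a)"
    have t: "0 \<le> t" by (simp add: t_def)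
    let ?p = "\<lambda>k. act (x [^] (k::int)) a"
    \<comment> \<open>One more period at each end keeps the translates of the segment on the
      geodesic from \<open>u\<close> to \<open>v\<close>, where a point is determined by its
      distance from \<open>u\<close>.\<close>
    define u where "u = ?p (i - 1)"
    define v where "v = ?p (j + 1)"
    have shift: "act x (?p k) = ?p (k + 1)" "act (inv x) (?p k) = ?p (k - 1)" for k
    proof -
      show 1: "act x (?p k) = ?p (k + 1)" for k
        using act_pow_add[OF x, of 1 k a] x by (simp add: int_pow_1 add.commute)
      show "act (inv x) (?p k) = ?p (k - 1)" using 1[of "k - 1"] x by (metis act_inv_cancel(1) diff_add_cancel)
    qed
    have pin: "?p k \<in> seg (?p m) (?p n)" if "m \<le> k" "k \<le> n" for k m n
      using that by (simp add: seg_def axis_int[OF x a] algebra_simps flip: distrib_right)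
    have du: "d u (?p k) = (k - i + 1) * t" if "i - 1 \<le> k" for k
      using that by (simp add: u_def axis_int[OF x a] t_def)
    have sub: "seg (?p i) (?p j) \<subseteq> seg u v"
      unfolding u_def v_def using ij by (intro seg_sub pin) auto
    have *: "act x z \<in> seg u v \<and> d u (act x z) = d u z + t \<and> act (inv x) z \<in> seg u v \<and> d u (act (inv x) z) = d u z - t"
      if z: "z \<in> seg (?p i) (?p j)" for z
    proof -
      have zi: "d u z = t + d (?p i) z"
      proof -
        have "z \<in> seg (?p i) v" using z pin[of i j "j+1"] ij unfolding v_def by (meson in_mono pin seg_sub ij order_refl add_increasing2 zero_le_one seg_ends(1))
        then have "?p i \<in> seg u z" using seg_trans[of "z" u v "?p i"]
          seg_trans(2)[of "z" v u "?p i"] pin[of "i-1" i "j+1"] ij u_def v_def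
          by (smt (verit) d_commute seg_commute seg_def mem_Collect_eq triangle)
        then show ?thesis using du[of i] by (simp add: seg_def)
      qed
      have x1: "act x z \<in> seg (?p (i+1)) (?p (j+1))" using z act_seg[OF x, of z "?p i" "?p j"] shift by simp
      have x2: "act (inv x) z \<in> seg (?p (i-1)) (?p (j-1))"
        using z act_seg[of "inv x" z "?p i" "?p j"] shift x by simp
      have y1: "act x z \<in> seg u v" using x1 seg_sub[of "?p (i+1)" u v "?p (j+1)"] pin ij unfolding u_def v_def by auto
      have y2: "act (inv x) z \<in> seg u v" using x2 seg_sub[of "?p (i-1)" u v "?p (j-1)"] pin ij unfolding u_def v_def by auto
      have "d u (act (inv x) z) = d (?p i) z"
        using x shift(2)[of i] act_d[of "inv x" "?p i" z] unfolding u_def by simp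
      then have e2: "d u (act (inv x) z) = d u z - t" using zi by simp
      have "d (?p (i+1)) (act x z) = d (?p i) z"
        using x shift(1)[of i] act_d[of "x" "?p i" z] by simp
      moreover have "d u (act x z) = d u (?p (i+1)) + d (?p (i+1)) (act x z)"
      proof -
        have "?p (i+1) \<in> seg u (?p (j+1))" using pin[of "i-1" "i+1" "j+1"] ij unfolding u_def by auto
        then show ?thesis using x1 triangle[of u "act x z" "?p (i+1)"] triangle[of u "?p (j+1)" "act x z"]
          by (simp add: seg_def)
      qed
      ultimately have "d u (act x z) = d u z + t" using zi du[of "i+1"] by simp
      then show ?thesis using y1 y2 e2 by blast
    qed
    have pq: "seg p q \<subseteq> seg (?p i) (?p j)" using p q by (rule seg_sub)
    have puv: "p \<in> seg u v" "q \<in> seg u v" using p q sub by auto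
    have dist: "d y z = \<bar>d u y - d u z\<bar>" if "y \<in> seg u v" "z \<in> seg u v" for y z
      using seg_dist[OF that] .
    show ?thesis
    proof (cases "d u p \<le> d u q")
      case True
      show ?thesis
      proof (intro exI[of _ x] conjI allI impI disjI1)
        fix z assume z: "z \<in> seg p q" "d a (act x a) \<le> d z q"
        have zz: "z \<in> seg (?p i) (?p j)" "z \<in> seg u v" using z pq sub by auto
        have "d u p \<le> d u z" "d u z \<le> d u q"
          using z(1) True dist[OF puv] dist[OF puv(1) zz(2)] dist[OF zz(2) puv(2)] by (auto simp: seg_def)
        then show "d (act x z) q = d z q - d a (act x a)" "act x z \<in> seg p q"
          using *[OF zz(1)] dist[of "act x z" q] dist[of p "act x z"] dist[OF zz(2) puv(2)] dist[OF puv] z(2) t puv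
          unfolding t_def[symmetric] by (auto simp: seg_def)
      qed simp
    next
      case False
      show ?thesis
      proof (intro exI[of _ "inv x"] conjI allI impI disjI2)
        fix z assume z: "z \<in> seg p q" "d a (act x a) \<le> d z q"
        have zz: "z \<in> seg (?p i) (?p j)" "z \<in> seg u v" using z pq sub by auto
        have "d u q \<le> d u z" "d u z \<le> d u p"
          using z(1) False dist[OF puv] dist[OF puv(1) zz(2)] dist[OF zz(2) puv(2)] by (auto simp: seg_def)
        then show "d (act (inv x) z) q = d z q - d a (act x a)" "act (inv x) z \<in> seg p q"
          using *[OF zz(1)] dist[of "act (inv x) z" q] dist[of p "act (inv x) z"] dist[OF zz(2) puv(2)] dist[OF puv] z(2) t puv
          unfolding t_def[symmetric] by (auto simp: seg_def)
      qed simp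
    qed
  qed
  show thesis
  proof (cases "i \<le> j")
    case True
    from main[OF p q this] that show thesis by blast
  next
    case False
    then have "p \<in> seg (act (x [^] j) a) (act (x [^] i) a)" "q \<in> seg (act (x [^] j) a) (act (x [^] i) a)"
      using p q seg_commute by auto
    from main[OF this] False that show thesis by fastforce
  qed
qed

end

section \<open>Ping-pong and Nielsen reduction\<close>

context group
begin

lemma commute_inv_left:
  assumes "x \<in> carrier G" "y \<in> carrier G" "x \<otimes> y = y \<otimes> x"
  shows "inv x \<otimes> y = y \<otimes> inv x"
proof -
  have "x \<otimes> (inv x \<otimes> y) = x \<otimes> (y \<otimes> inv x)"
    using assms by (simp flip: m_assoc) (simp add: m_assoc)
  then show ?thesis using assms by simp
qed

lemma commute_inv_iff:
  assumes "x \<in> carrier G" "y \<in> carrier G"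
  shows "inv x \<otimes> y = y \<otimes> inv x \<longleftrightarrow> x \<otimes> y = y \<otimes> x"
  using commute_inv_left[of x y] commute_inv_left[of "inv x" y] assms by auto

definition letter :: "'a \<Rightarrow> 'a \<Rightarrow> bool \<times> bool \<Rightarrow> 'a" where
  "letter g h l = (if snd l then (if fst l then g else h) else inv (if fst l then g else h))"

text \<open>Stands for the images of all generating pairs of the free group. The listed moves yield
  the others in use, such as the passage from \<open>(g, h)\<close> to
  \<open>(g, g [^] n \<otimes> h)\<close>.\<close>

definition nielsen_closed :: "('a \<times> 'a) set \<Rightarrow> bool" where
  "nielsen_closed PP \<longleftrightarrow> (\<forall>g h. (g, h) \<in> PP \<longrightarrow> g \<in> carrier G \<and> h \<in> carrier G \<and>
     (h, g) \<in> PP \<and> (inv g, h) \<in> PP \<and> (g, g \<otimes> h) \<in> PP)"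

lemma nielsen_closedD:
  assumes "nielsen_closed PP" "(g, h) \<in> PP"
  shows "g \<in> carrier G" "h \<in> carrier G" "(h, g) \<in> PP" "(inv g, h) \<in> PP" "(g, inv h) \<in> PP"
    "(g, g \<otimes> h) \<in> PP"
  using assms unfolding nielsen_closed_def by blast+

end

context tree_action
begin

section \<open>Ping-pong from bounded cancellation\<close>

lemma act_int_pow_fixed:
  fixes n :: int
  assumes x: "x \<in> carrier G" and "act x p = p"
  shows "act (x [^] n) p = p"
proof -
  have *: "act (x [^] int k) p = p" for k
  proof (induction k)
    case (Suc k)
    then show ?case using act_pow_add[OF x, of 1 "int k" p] assms by (simp add: int_pow_1 add.commute)
  qed simp
  show ?thesis
  proof (cases "0 \<le> n")
    case True
    then show ?thesis using *[of "nat n"] by simp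
  next
    case False
    then have "act (x [^] n) (act (x [^] int (nat (- n))) p) = p"
      using act_pow_add[OF x, of n "int (nat (- n))" p] by simp
    then show ?thesis using *[of "nat (- n)"] by metis
  qed
qed

text \<open>Both \<open>z\<close> and \<open>act x z\<close> lie on the geodesic from
  \<open>q\<close> to \<open>act x r\<close>, at the same distance from \<open>q\<close>.\<close>

lemma fixed_of_overlap:
  assumes "x \<in> carrier G" "act x q = q" "z \<in> seg q r" "2 * d q z \<le> ov q r (act x r)"
  shows "act x z = z"
proof -
  have "z \<in> seg q (act x r)" using seg_ov assms(3,4) .
  moreover have "act x z \<in> seg q (act x r)" using act_seg[of x z q r] assms by simp
  moreover have "d q (act x z) = d q z" using act_d[of x q z] assms by simp
  ultimately show ?thesis using seg_unique by metis
qed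

text \<open>For adjacent letters \<open>ov\<close> is twice the cancellation between them. By
  \<open>N2\<close> the cancellations at the two ends of a letter leave part of it, so every letter
  adds at least one to twice the distance, and the cancellation before \<open>y\<close> is not
  influenced by what follows \<open>y\<close>. The letter \<open>x\<close> lies outside the word and
  only records what the word is attached to.\<close>

lemma ping_pong_aux:
  fixes e :: "'l \<Rightarrow> 'a" and al :: "'l \<Rightarrow> 'l \<Rightarrow> bool" and p :: 'p
  defines "W \<equiv> \<lambda>w. foldr (\<lambda>y. act (e y)) w p"
  assumes e: "\<And>y. e y \<in> carrier G"
    and N1: "\<And>x y. al x y \<Longrightarrow> ov p (act (inv (e x)) p) (act (e y) p) < 2 * d p (act (e y) p)"
    and N2: "\<And>x y z. al x y \<Longrightarrow> al y z \<Longrightarrow> ov p (act (inv (e x)) p) (act (e y) p) +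
       ov p (act (inv (e y)) p) (act (e z) p) < 2 * d p (act (e y) p)"
    and "successively al (y # w)" "al x y"
  shows "int (length (y # w)) + ov p (act (inv (e x)) p) (act (e y) p) \<le> 2 * d p (W (y # w)) \<and>
    ov p (act (inv (e x)) p) (W (y # w)) = ov p (act (inv (e x)) p) (act (e y) p)"
  using assms(5,6)
proof (induction w arbitrary: x y)
  case Nil
  then show ?case using N1[of x y] by (simp add: W_def)
next
  case (Cons z w)
  then have al: "al x y" "al y z" by auto
  have IH: "int (length (z # w)) + ov p (act (inv (e y)) p) (act (e z) p) \<le> 2 * d p (W (z # w))"
    "ov p (act (inv (e y)) p) (W (z # w)) = ov p (act (inv (e y)) p) (act (e z) p)"
    using Cons by auto
  have W: "W (y # z # w) = act (e y) (W (z # w))" by (simp add: W_def)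
  have inv: "d p (act (inv (e y)) q) = d (act (e y) p) q" for q
    using d_act_left[of "e y" p q] e by simp
  have "d p (act (e y) p) = d p (act (inv (e y)) p)"
    using inv[of p] d_commute by simp
  then have dW: "d p (W (y # z # w)) = d p (act (e y) p) + d p (W (z # w)) - ov p (act (inv (e y)) p) (act (e z) p)"
    using IH(2) d_act_left[of "inv (e y)" p "W (z # w)"] e unfolding W by (simp add: ov_def)
  have ovW: "ov p (act (e y) p) (W (y # z # w)) = 2 * d p (act (e y) p) - ov p (act (inv (e y)) p) (act (e z) p)"
    unfolding ov_def[of p "act (e y) p" "W (y # z # w)"] dW unfolding W using e by simp
  have "ov p (act (inv (e x)) p) (act (e y) p) < ov p (act (e y) p) (W (y # z # w))"
    using N2[OF al] ovW by simp
  then have "ov p (act (inv (e x)) p) (W (y # z # w)) = ov p (act (inv (e x)) p) (act (e y) p)"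
    by (rule ov_eq_of_less)
  moreover have "int (length (y # z # w)) + ov p (act (inv (e x)) p) (act (e y) p) \<le> 2 * d p (W (y # z # w))"
    using IH(1) N2[OF al] dW by simp
  ultimately show ?case by simp
qed

text \<open>Nothing precedes the first letter, so it may cancel completely; hence the
  \<open>+ 1\<close>.\<close>

lemma ping_pong:
  fixes e :: "'l \<Rightarrow> 'a" and al :: "'l \<Rightarrow> 'l \<Rightarrow> bool" and p :: 'p
  assumes e: "\<And>y. e y \<in> carrier G"
    and N1: "\<And>x y. al x y \<Longrightarrow> ov p (act (inv (e x)) p) (act (e y) p) < 2 * d p (act (e y) p)"
    and N2: "\<And>x y z. al x y \<Longrightarrow> al y z \<Longrightarrow> ov p (act (inv (e x)) p) (act (e y) p) +
       ov p (act (inv (e y)) p) (act (e z) p) < 2 * d p (act (e y) p)"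
    and "successively al w"
  shows "int (length w) \<le> 2 * d p (foldr (\<lambda>y. act (e y)) w p) + 1"
proof (cases w)
  case (Cons y v)
  show ?thesis
  proof (cases v)
    case (Cons z u)
    let ?W = "\<lambda>w. foldr (\<lambda>y. act (e y)) w p"
    have "al y z" "successively al (z # u)" using assms(4) \<open>w = y # v\<close> Cons by auto
    from ping_pong_aux[where e = e and al = al, OF e N1 N2 this(2,1)]
    have *: "int (length (z # u)) + ov p (act (inv (e y)) p) (act (e z) p) \<le> 2 * d p (?W (z # u))"
      "ov p (act (inv (e y)) p) (?W (z # u)) = ov p (act (inv (e y)) p) (act (e z) p)"
      by auto
    have "d p (?W w) = d (act (inv (e y)) p) (?W (z # u))"
      using d_act_left[of "inv (e y)" p "?W (z # u)"] e by (simp add: \<open>w = y # v\<close> Cons)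
    also have "\<dots> = d p (act (inv (e y)) p) + d p (?W (z # u)) - ov p (act (inv (e y)) p) (?W (z # u))"
      by (simp add: ov_def)
    finally show ?thesis
      using * ov_le(1)[of p "act (inv (e y)) p" "act (e z) p"] by (simp add: \<open>w = y # v\<close> Cons)
  qed (simp add: Cons)
qed simp

text \<open>Breaks ties in the Nielsen reduction. If exactly half of \<open>g\<close> cancels
  against \<open>h\<close> at both ends, replacing \<open>h\<close> by
  \<open>g \<otimes> inv h\<close> leaves the total displacement at \<open>p\<close> unchanged; it
  becomes smaller at the point \<open>z\<close> one step along the common beginning.\<close>

lemma nielsen_step:
  assumes g: "g \<in> carrier G" and h: "h \<in> carrier G"
    and ab: "0 < d p (act g p)" "d p (act g p) \<le> d p (act h p)"
    and ov1: "ov p (act g p) (act h p) = d p (act g p)"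
    and ov2: "ov p (act (inv g) p) (act (inv h) p) = d p (act g p)"
  shows "\<exists>z. d z (act g z) + d z (act (g \<otimes> inv h) z) < d p (act g p) + d p (act h p)"
proof -
  define a b where "a = d p (act g p)" and "b = d p (act h p)"
  have inv: "d p (act (inv g) q) = d (act g p) q" "d p (act (inv h) q) = d (act h p) q" for q
    using d_act_left[of g p q] d_act_left[of h p q] g h by simp_all
  have "even a" using even_ov[of p "act g p" "act h p"] ov1 a_def by simp
  then have a2: "2 \<le> a" using ab a_def by (auto elim!: evenE)
  obtain z where z: "z \<in> seg p (act g p)" "d p z = 1"
    using seg_point[of 1 p "act g p"] a2 a_def by auto
  then have z': "z \<in> seg p (act h p)" using seg_ov[of z p "act g p" "act h p"] ov1 a2 a_def by simp
  have dz: "d z (act g p) = a - 1" "d z (act h p) = b - 1"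
    using z z' by (simp_all add: seg_def a_def b_def)
  obtain m where m: "m \<in> seg p (act (inv g) p)" "m \<in> seg p (act (inv h) p)" "2 * d p m = a"
    using median[of p "act (inv g) p" "act (inv h) p"] ov2 a_def by metis
  have dg: "d p (act (inv g) p) = a" "d p (act (inv h) p) = b"
    using inv d_commute a_def b_def by simp_all
  have zg: "act (inv g) z \<in> seg p (act (inv g) p)" "d p (act (inv g) z) = a - 1"
    using z dz g d_commute[of "act g p" z] inv[of z] dg d_commute[of z p] by (simp_all add: seg_def)
  have zh: "act (inv h) z \<in> seg p (act (inv h) p)" "d p (act (inv h) z) = b - 1"
    using z dz h d_commute[of "act h p" z] inv[of z] dg d_commute[of z p] by (simp_all add: seg_def)
  have "d m (act (inv g) z) = a - 1 - d p m" "d m (act (inv h) z) = b - 1 - d p m"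
    using seg_dist[OF m(1) zg(1)] seg_dist[OF m(2) zh(1)] zg zh m(3) a2 ab a_def b_def by auto
  then have "d (act (inv g) z) (act (inv h) z) \<le> b - 2"
    using triangle[of "act (inv g) z" "act (inv h) z" m] m(3) d_commute[of m "act (inv g) z"] by simp
  then have "d z (act (g \<otimes> inv h) z) \<le> b - 2"
    using d_act_left[of "inv g" z "act (inv h) z"] g h by (simp add: act_mult)
  moreover have "d z (act g z) \<le> a"
    using triangle[of z "act g z" "act g p"] dz z g d_commute[of z p] by simp
  ultimately show ?thesis unfolding a_def b_def by (intro exI[of _ z]) simp
qed

text \<open>The base point is minimized together with the pair. Minimality bounds the overlap of
  different generators by the shorter displacement (\<open>A\<close>), hyperbolicity bounds the
  overlap of a letter with its inverse (\<open>B\<close>), and equality in \<open>A\<close> cannot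
  hold at both ends of a letter (\<open>D\<close>).\<close>

lemma nielsen_minimal:
  assumes PP: "nielsen_closed PP" "PP \<noteq> {}"
    and hyp: "\<And>g h. (g, h) \<in> PP \<Longrightarrow> \<not> elliptic g"
  obtains g h p where "(g, h) \<in> PP"
    "\<And>x y. x \<noteq> (fst y, \<not> snd y) \<Longrightarrow>
      ov p (act (inv (letter g h x)) p) (act (letter g h y) p) < 2 * d p (act (letter g h y) p)"
    "\<And>x y z. x \<noteq> (fst y, \<not> snd y) \<Longrightarrow> y \<noteq> (fst z, \<not> snd z) \<Longrightarrow>
      ov p (act (inv (letter g h x)) p) (act (letter g h y) p) +
      ov p (act (inv (letter g h y)) p) (act (letter g h z) p) < 2 * d p (act (letter g h y) p)"
proof -
  let ?m = "\<lambda>(g, h, p). nat (d p (act g p) + d p (act h p))"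
  obtain t where t: "(fst t, fst (snd t)) \<in> PP"
    "\<And>s. (fst s, fst (snd s)) \<in> PP \<Longrightarrow> ?m t \<le> ?m s"
    using ex_has_least_nat[of "\<lambda>t. (fst t, fst (snd t)) \<in> PP" _ ?m] PP(2)
    by (metis (no_types, lifting) equals0I fst_conv snd_conv surj_pair)
  obtain g0 h0 p where t0: "t = (g0, h0, p)" by (cases t)
  have min0: "d p (act g0 p) + d p (act h0 p) \<le> d z (act x z) + d z (act y z)" if "(x, y) \<in> PP" for x y z
    using t(2)[of "(x, y, z)"] that t0 by (simp add: nat_le_iff)
  obtain g h where gh: "(g, h) \<in> PP" and ab: "d p (act g p) \<le> d p (act h p)"
    and min: "\<And>x y z. (x, y) \<in> PP \<Longrightarrow> d p (act g p) + d p (act h p) \<le> d z (act x z) + d z (act y z)"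
  proof (cases "d p (act g0 p) \<le> d p (act h0 p)")
    case True
    then show thesis using that[of g0 h0] min0 t(1) t0 by simp
  next
    case False
    then show thesis using that[of h0 g0] min0 t(1) t0 nielsen_closedD(3)[OF PP(1)] by (simp add: add.commute)
  qed
  note G = nielsen_closedD[OF PP(1) gh]
  let ?e = "letter g h"
  define l where "l y = d p (act (?e y) p)" for y
  define O' where "O' x y = ov p (act (?e x) p) (act (?e y) p)" for x y
  let ?b = "\<lambda>y. (fst y, \<not> snd y)"
  have ec: "?e y \<in> carrier G" for y using G by (simp add: letter_def)
  have einv: "inv (?e y) = ?e (?b y)" for y using G by (simp add: letter_def)
  have linv: "l (?b y) = l y" for y
    using d_act_left[of "?e y" p p] ec d_commute unfolding l_def einv[symmetric] by simp
  define a b where "a = d p (act g p)" and "b = d p (act h p)"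
  have lT: "l y = a" if "fst y" for y
    using that linv[of "(True, True)"] by (cases y) (auto simp: l_def a_def letter_def)
  have lF: "l y = b" if "\<not> fst y" for y
    using that linv[of "(False, True)"] by (cases y) (auto simp: l_def b_def letter_def)
  have la: "a \<le> l y" for y using lT lF ab by (cases "fst y") (auto simp: a_def b_def)
  have PPe: "(?e x, ?e y) \<in> PP" if "fst x \<noteq> fst y" for x y
    using that gh nielsen_closedD[OF PP(1)] unfolding letter_def
    by (smt (verit, best))
  have hyp': "\<not> elliptic (?e y)" for y using PPe[of y "(\<not> fst y, True)"] hyp by auto
  have a0: "0 < a"
    using hyp[OF gh] d_nonneg[of p "act g p"] unfolding a_def elliptic_def
    by (metis d_eq_0_iff order_less_le)
  have sym: "O' x y = O' y x" for x y by (simp add: O'_def ov_commute)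
  have A: "O' x y \<le> a" if "fst x \<noteq> fst y" for x y
  proof -
    have 1: "b \<le> d (act (?e x) p) (act (?e y) p)" if "fst x" "\<not> fst y" for x y
    proof -
      have "(?e x, inv (?e x) \<otimes> ?e y) \<in> PP"
      proof -
        have "(inv (?e x), ?e y) \<in> PP" using PPe[of "?b x" y] that by (simp add: einv)
        from nielsen_closedD(6)[OF PP(1) this] nielsen_closedD(4)[OF PP(1)]
        have "(inv (inv (?e x)), inv (?e x) \<otimes> ?e y) \<in> PP" by blast
        then show ?thesis using ec by simp
      qed
      from min[OF this, of p] show ?thesis
        using lT[OF that(1)] d_act_left[of "?e x" p "act (?e y) p"] ec
        by (simp add: act_mult l_def a_def b_def)
    qed
    show ?thesis
    proof (cases "fst x")
      case True
      then show ?thesis using 1[of x y] that lT[of x] lF[of y] by (simp add: O'_def ov_def l_def)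
    next
      case False
      then show ?thesis using 1[of y x] that lT[of y] lF[of x]
        d_commute[of "act (?e x) p" "act (?e y) p"] by (simp add: O'_def ov_def l_def)
    qed
  qed
  have B: "O' y (?b y) < l y" for y
    using not_elliptic_ov[OF ec hyp'] unfolding O'_def l_def einv[symmetric] .
  have D: "\<not> (O' x y = a \<and> O' (?b y) z = a)" if "l y = a" "fst x \<noteq> fst y" "fst z \<noteq> fst y" for x y z
  proof
    assume as: "O' x y = a \<and> O' (?b y) z = a"
    show False
    \<comment> \<open>If \<open>x = z\<close>, the ultrametric inequality contradicts
      \<open>B\<close>. Otherwise \<open>z\<close> is the inverse letter of \<open>x\<close>, and
      \<open>nielsen_step\<close> gives a smaller pair at another base point.\<close>
    proof (cases "x = z")
      case True
      have "min (O' y x) (O' x (?b y)) \<le> O' y (?b y)" unfolding O'_def by (rule ov_min)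
      then show False using as True sym[of y x] sym[of "?b y" x] B[of y] that(1) by simp
    next
      case False
      then have z: "z = ?b x" using that by (cases x; cases z) auto
      have "\<exists>w. d w (act (?e y) w) + d w (act (?e y \<otimes> inv (?e x)) w) < d p (act (?e y) p) + d p (act (?e x) p)"
      proof (rule nielsen_step[OF ec ec])
        show "0 < d p (act (?e y) p)" "d p (act (?e y) p) \<le> d p (act (?e x) p)"
          using a0 la[of x] that(1) by (simp_all add: l_def)
        show "ov p (act (?e y) p) (act (?e x) p) = d p (act (?e y) p)"
          using as sym[of x y] that(1) by (simp add: O'_def l_def)
        show "ov p (act (inv (?e y)) p) (act (inv (?e x)) p) = d p (act (?e y) p)"
          using as that(1) unfolding einv by (simp add: O'_def l_def z)
      qed
      then obtain w where w: "d w (act (?e y) w) + d w (act (?e y \<otimes> inv (?e x)) w) < l y + l x"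
        by (auto simp: l_def)
      have "(?e y, inv (?e x)) \<in> PP" using PPe[of y "?b x"] that by (simp add: einv)
      from nielsen_closedD(6)[OF PP(1) this] min[of "?e y" _ w]
      have "a + b \<le> d w (act (?e y) w) + d w (act (?e y \<otimes> inv (?e x)) w)" by (simp add: a_def b_def)
      moreover have "l y + l x = a + b"
        using that(2) lT[of x] lT[of y] lF[of x] lF[of y] by (cases "fst x") auto
      ultimately show False using w by simp
    qed
  qed
  show thesis
  proof (rule that[OF gh, of p])
    fix x y :: "bool \<times> bool" assume xy: "x \<noteq> ?b y"
    have "O' (?b x) y < 2 * l y"
    proof (cases "fst x = fst y")
      case True
      then have "x = y" using xy by (cases x; cases y) auto
      then show ?thesis using B[of y] sym[of y "?b y"] la[of y] a0 by simp
    next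
      case False
      then show ?thesis using A[of "?b x" y] la[of y] a0 by simp
    qed
    then show "ov p (act (inv (?e x)) p) (act (?e y) p) < 2 * d p (act (?e y) p)"
      by (simp add: einv O'_def l_def)
  next
    fix x y z :: "bool \<times> bool" assume xy: "x \<noteq> ?b y" and yz: "y \<noteq> ?b z"
    have 1: "O' (?b x) y \<le> l y" "fst x = fst y \<Longrightarrow> O' (?b x) y < l y"
    proof -
      show *: "O' (?b x) y < l y" if "fst x = fst y"
      proof -
        have "x = y" using xy that by (cases x; cases y) auto
        then show ?thesis using B[of y] sym[of y "?b y"] by simp
      qed
      show "O' (?b x) y \<le> l y"
        using * A[of "?b x" y] la[of y] by fastforce
    qed
    have 2: "O' (?b y) z \<le> l y" "fst z = fst y \<Longrightarrow> O' (?b y) z < l y"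
    proof -
      show *: "O' (?b y) z < l y" if "fst z = fst y"
      proof -
        have "y = z" using yz that by (cases z; cases y) auto
        then show ?thesis using B[of y] sym[of y "?b y"] by simp
      qed
      show "O' (?b y) z \<le> l y"
        using * A[of "?b y" z] la[of y] by fastforce
    qed
    have "O' (?b x) y + O' (?b y) z < 2 * l y"
    proof (cases "fst x = fst y \<or> fst z = fst y")
      case True
      then show ?thesis using 1 2 by auto
    next
      case False
      then have "O' (?b x) y \<le> a" "O' (?b y) z \<le> a" using A[of "?b x" y] A[of "?b y" z] by auto
      moreover have "\<not> (O' (?b x) y = a \<and> O' (?b y) z = a)" if "l y = a"
        using D[OF that, of "?b x" z] False by simp
      ultimately show ?thesis using la[of y] by fastforce
    qed
    then show "ov p (act (inv (?e x)) p) (act (?e y) p) + ov p (act (inv (?e y)) p) (act (?e z) p)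
       < 2 * d p (act (?e y) p)"
      by (simp add: einv O'_def l_def)
  qed
qed

end

section \<open>Elliptic generators\<close>

text \<open>The substitute for a free action: elements with a common fixed point commute, so point
  stabilizers are abelian.\<close>

locale comm_tree_action = tree_action +
  assumes fixed_commute: "x \<in> carrier G \<Longrightarrow> y \<in> carrier G \<Longrightarrow>
    act (x \<otimes> y) p = act (y \<otimes> x) p \<Longrightarrow> x \<otimes> y = y \<otimes> x"
begin

text \<open>After inverting where necessary, both elements translate towards \<open>q\<close>. The
  overlap has room for both translations of \<open>p\<close>, and the order in which they are made
  does not change the end point.\<close>

lemma axes_overlap_commute:
  fixes i j k l :: int
  assumes x: "x \<in> carrier G" and y: "y \<in> carrier G"
    and a: "axis_point x a" and b: "axis_point y b"
    and p: "p \<in> seg (act (x [^] i) a) (act (x [^] j) a)" "p \<in> seg (act (y [^] k) b) (act (y [^] l) b)"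
    and q: "q \<in> seg (act (x [^] i) a) (act (x [^] j) a)" "q \<in> seg (act (y [^] k) b) (act (y [^] l) b)"
    and le: "d a (act x a) + d b (act y b) \<le> d p q"
  shows "x \<otimes> y = y \<otimes> x"
proof -
  define t u where "t = d a (act x a)" and "u = d b (act y b)"
  have tu: "0 \<le> t" "0 \<le> u" "t + u \<le> d p q" using le by (simp_all add: t_def u_def)
  obtain x' where x': "x' = x \<or> x' = inv x"
    "\<And>z. z \<in> seg p q \<Longrightarrow> t \<le> d z q \<Longrightarrow> d (act x' z) q = d z q - t \<and> act x' z \<in> seg p q"
    using axis_shift[OF x a p(1) q(1)] unfolding t_def by metis
  obtain y' where y': "y' = y \<or> y' = inv y"
    "\<And>z. z \<in> seg p q \<Longrightarrow> u \<le> d z q \<Longrightarrow> d (act y' z) q = d z q - u \<and> act y' z \<in> seg p q"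
    using axis_shift[OF y b p(2) q(2)] unfolding u_def by metis
  have c: "x' \<in> carrier G" "y' \<in> carrier G" using x' y' x y by auto
  have 1: "d (act x' p) q = d p q - t" "act x' p \<in> seg p q"
    "d (act y' p) q = d p q - u" "act y' p \<in> seg p q"
    using x'(2)[of p] y'(2)[of p] tu by auto
  have 2: "d (act x' (act y' p)) q = d p q - u - t" "act x' (act y' p) \<in> seg p q"
    "d (act y' (act x' p)) q = d p q - t - u" "act y' (act x' p) \<in> seg p q"
    using x'(2)[of "act y' p"] y'(2)[of "act x' p"] tu 1 by auto
  have "act x' (act y' p) = act y' (act x' p)"
    by (rule seg_unique[of _ q p]) (use 2 in \<open>simp_all add: seg_commute d_commute\<close>)
  then have "x' \<otimes> y' = y' \<otimes> x'"
    using fixed_commute[of x' y' p] c by (simp add: act_mult)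
  then show ?thesis
    using x'(1) y'(1) x y commute_inv_iff by (metis inv_closed)
qed

text \<open>The power of \<open>c\<close> stands in front, so that when \<open>c\<close> fixes the
  base point the inverse of a letter moves it by a power of \<open>e\<close> alone.\<close>

definition pw :: "'a \<Rightarrow> 'a \<Rightarrow> int \<times> int \<Rightarrow> 'a" where
  "pw c e y = c [^] fst y \<otimes> e [^] snd y"

lemma pw_closed [simp]: "c \<in> carrier G \<Longrightarrow> e \<in> carrier G \<Longrightarrow> pw c e y \<in> carrier G"
  by (simp add: pw_def)

lemma pw_inv_fixed:
  assumes "c \<in> carrier G" "e \<in> carrier G" "act c q = q"
  shows "act (inv (pw c e y)) q = act (e [^] (- snd y)) q"
proof -
  have "act (inv (c [^] fst y)) q = q"
    using act_int_pow_fixed[of c q "- fst y"] assms by (simp add: int_pow_neg)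
  then show ?thesis using assms by (simp add: pw_def inv_mult_group act_mult int_pow_neg)
qed

text \<open>On the geodesic from \<open>q\<close> to \<open>r\<close>, a power of \<open>c\<close>
  fixes a piece that starts at \<open>q\<close> and a power of \<open>e\<close> a piece that ends at
  \<open>r\<close>. If the pieces met, the powers would have a common fixed point and commute. Hence
  \<open>mu n < la m\<close>, and \<open>mu n\<close> is all that cancels in front of
  \<open>c [^] n\<close>.\<close>

lemma elliptic_pair_ping_pong:
  assumes c: "c \<in> carrier G" and e: "e \<in> carrier G"
    and q: "act c q = q" and r: "act e r = r"
    and nc: "\<And>(i::int) (j::int). i \<noteq> 0 \<Longrightarrow> j \<noteq> 0 \<Longrightarrow> c [^] i \<otimes> e [^] j \<noteq> e [^] j \<otimes> c [^] i"
    and suc: "successively (\<lambda>x y. snd x \<noteq> 0 \<and> fst y \<noteq> 0 \<and> snd y \<noteq> 0) w"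
  shows "int (length w) \<le> 2 * d q (foldr (\<lambda>y. act (pw c e y)) w q) + 1"
proof -
  define L where "L = d q r"
  define mu where "mu n = ov q r (act (c [^] n) r)" for n :: int
  define la where "la m = d q (act (e [^] m) q)" for m :: int
  have fq: "act (c [^] n) q = q" and fr: "act (e [^] n) r = r" for n :: int
    using act_int_pow_fixed c e q r by auto
  have ovr: "ov r q (act (e [^] m) q) = 2 * L - la m" for m
  proof -
    have "d r (act (e [^] m) q) = d r q"
      using act_d[of "e [^] m" r q] fr e by simp
    then show ?thesis by (simp add: ov_def L_def la_def d_commute[of r q])
  qed
  have ovq: "ov q r (act (e [^] m) q) = la m" for m
  proof -
    have "d r (act (e [^] m) q) = d r q"
      using act_d[of "e [^] m" r q] fr e by simp
    then show ?thesis by (simp add: ov_def la_def d_commute[of r q])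
  qed
  have lt: "mu n < la m" if "n \<noteq> 0" "m \<noteq> 0" for n m
  proof (rule ccontr)
    assume "\<not> mu n < la m"
    obtain z where z: "z \<in> seg r q" "z \<in> seg r (act (e [^] m) q)" "2 * d r z = ov r q (act (e [^] m) q)"
      using median by metis
    have ze: "act (e [^] m) z = z"
      using fixed_of_overlap[of "e [^] m" r z q] e fr z by simp
    have "2 * d q z \<le> mu n"
      using z(1,3) ovr[of m] \<open>\<not> mu n < la m\<close> d_commute[of z q] d_commute[of r q] by (simp add: seg_def L_def)
    then have zc: "act (c [^] n) z = z"
      using fixed_of_overlap[of "c [^] n" q z r] c fq z seg_commute[of r q] by (simp add: mu_def)
    have "c [^] n \<otimes> e [^] m = e [^] m \<otimes> c [^] n"
      using fixed_commute[of "c [^] n" "e [^] m" z] c e zc ze by (simp add: act_mult)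
    then show False using nc[OF that] by simp
  qed
  have ovc: "ov q (act (e [^] k) q) (act (c [^] n) (act (e [^] m) q)) = mu n"
    if "n \<noteq> 0" "m \<noteq> 0" "k \<noteq> 0" for n m k :: int
  proof -
    have 1: "ov q (act (e [^] k) q) (act (c [^] n) r) = mu n"
    proof -
      have "ov q (act (c [^] n) r) r < ov q r (act (e [^] k) q)"
        using lt[of n k] that ovq[of k] by (simp add: mu_def ov_commute)
      from ov_eq_of_less[OF this] show ?thesis by (simp add: mu_def ov_commute)
    qed
    have "ov q (act (c [^] n) r) (act (c [^] n) (act (e [^] m) q)) = la m"
      using act_ov[of "c [^] n" q r "act (e [^] m) q"] c fq ovq[of m] by simp
    then have "ov q (act (e [^] k) q) (act (c [^] n) r) < ov q (act (c [^] n) r) (act (c [^] n) (act (e [^] m) q))"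
      using 1 lt[of n m] that by simp
    from ov_eq_of_less[OF this] 1 show ?thesis by simp
  qed
  have len: "d q (act (pw c e y) q) = la (snd y)" for y
    using act_d[of "c [^] fst y" q "act (e [^] snd y) q"] c e fq by (simp add: pw_def act_mult la_def)
  show ?thesis
  proof (rule ping_pong[OF _ _ _ suc])
    show "pw c e y \<in> carrier G" for y using c e by simp
    have *: "ov q (act (inv (pw c e x)) q) (act (pw c e y) q) = mu (fst y)"
      if "snd x \<noteq> 0 \<and> fst y \<noteq> 0 \<and> snd y \<noteq> 0" for x y
      unfolding pw_inv_fixed[OF c e q]
      using ovc[of "fst y" "snd y" "- snd x"] that c e by (simp add: pw_def act_mult)
    fix x y z :: "int \<times> int"
    assume al: "snd x \<noteq> 0 \<and> fst y \<noteq> 0 \<and> snd y \<noteq> 0"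
    have pos: "0 \<le> la (snd y)" by (simp add: la_def)
    show "ov q (act (inv (pw c e x)) q) (act (pw c e y) q) < 2 * d q (act (pw c e y) q)"
      using lt[of "fst y" "snd y"] al pos by (simp add: *[OF al] len)
    assume al2: "snd y \<noteq> 0 \<and> fst z \<noteq> 0 \<and> snd z \<noteq> 0"
    show "ov q (act (inv (pw c e x)) q) (act (pw c e y) q) + ov q (act (inv (pw c e y)) q) (act (pw c e z) q)
      < 2 * d q (act (pw c e y) q)"
      using lt[of "fst y" "snd y"] lt[of "fst z" "snd y"] al al2 by (simp add: *[OF al] *[OF al2] len)
  qed
qed

text \<open>If the bound failed, a power of \<open>c\<close> and its conjugate by \<open>e\<close> would fix a common point, and so
  this power would commute with \<open>e\<close>.\<close>
lemma elliptic_gap: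
  assumes c: "c \<in> carrier G" and e: "e \<in> carrier G" and q: "act c q = q"
    and nc: "\<And>i :: int. i \<noteq> 0 \<Longrightarrow> c [^] i \<otimes> e \<noteq> e \<otimes> c [^] i"
    and nk: "n \<noteq> 0" "k \<noteq> 0"
  shows "ov q (act e q) (act (c [^] (n::int)) (act e q)) +
    ov q (act (inv e) q) (act (c [^] (k::int)) (act (inv e) q)) < 2 * d q (act e q)"
proof (rule ccontr)
  assume neg: "\<not> ?thesis"
  have fq: "act (c [^] n) q = q" for n :: int
    using act_int_pow_fixed c q by auto
  have b: "d q (act (inv e) q) = d q (act e q)"
    using d_act_left[of e q q] e d_commute by simp
  obtain z where z: "z \<in> seg q (act (inv e) q)"
    "2 * d q z = ov q (act (inv e) q) (act (c [^] k) (act (inv e) q))"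
    using median by metis
  have zc: "act (c [^] k) z = z" using fixed_of_overlap[of "c [^] k" q z] c fq z by simp
  have ez: "act e z \<in> seg (act e q) q" "d (act e q) (act e z) = d q z"
    using act_seg[of e z q "act (inv e) q"] z e by simp_all
  then have "2 * d q (act e z) = 2 * d q (act e q) - 2 * d q z"
    using d_commute[of "act e q" q] d_commute[of q "act e z"] by (simp add: seg_def)
  then have "act (c [^] n) (act e z) = act e z"
    using fixed_of_overlap[of "c [^] n" q "act e z" "act e q"] c fq z neg ez(1) seg_commute[of q] by simp
  then have 1: "act (c [^] (n * k)) (act e z) = act e z" "act (c [^] (n * k)) z = z"
    using act_int_pow_fixed[of "c [^] n" "act e z" k] act_int_pow_fixed[of "c [^] k" z n] zc c
    by (simp_all add: int_pow_pow mult.commute)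
  have "c [^] (n * k) \<otimes> e = e \<otimes> c [^] (n * k)"
    by (rule fixed_commute[where p = z]) (use 1 c e in \<open>simp_all add: act_mult\<close>)
  then show False using nc[of "n * k"] nk by simp
qed

text \<open>Reduces to \<open>elliptic_gap\<close>. If the bound failed, \<open>c [^] k\<close>
  would fix the branch point \<open>z\<close>, hence also its translate \<open>w\<close> by
  \<open>c [^] (- j)\<close>, as powers of \<open>c\<close> commute. Since \<open>w\<close> lies
  towards \<open>act e q\<close>, the first summand is at most the one in
  \<open>elliptic_gap\<close>.\<close>

lemma elliptic_gap':
  assumes c: "c \<in> carrier G" and e: "e \<in> carrier G" and q: "act c q = q"
    and nc: "\<And>i :: int. i \<noteq> 0 \<Longrightarrow> c [^] i \<otimes> e \<noteq> e \<otimes> c [^] i"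
    and hyp: "ov q (act (inv e) q) (act (c [^] (j::int)) (act e q)) < d q (act e q)"
    and k: "k \<noteq> 0"
  shows "ov q (act (inv e) q) (act (c [^] j) (act e q)) +
    ov q (act (inv e) q) (act (c [^] (k::int)) (act (inv e) q)) < 2 * d q (act e q)"
proof (rule ccontr)
  assume neg: "\<not> ?thesis"
  have fq: "act (c [^] n) q = q" for n :: int
    using act_int_pow_fixed c q by auto
  obtain z where z: "z \<in> seg q (act (inv e) q)" "z \<in> seg q (act (c [^] j) (act e q))"
    "2 * d q z = ov q (act (inv e) q) (act (c [^] j) (act e q))"
    using median by metis
  have zc: "act (c [^] k) z = z" using fixed_of_overlap[of "c [^] k" q z] c fq z neg hyp by simp
  define w where "w = act (c [^] (- j)) z"
  have zw: "act (c [^] j) w = z" using act_pow_add[OF c, of j "- j" z] by (simp add: w_def)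
  have "act (c [^] k) w = w"
    using act_pow_add[OF c, of k "- j" z] act_pow_add[OF c, of "- j" k z] zc by (simp add: w_def add.commute)
  moreover have "w \<in> seg q (act e q)"
    using act_seg[of "c [^] j" w q "act e q"] z(2) zw fq c by simp
  ultimately have "2 * d q w \<le> ov q (act e q) (act (c [^] k) (act e q))"
    using ov_of_seg[of w q "act e q"] act_seg[of "c [^] k" w q "act e q"] fq c by simp
  moreover have "d q w = d q z" using act_d[of "c [^] j" q w] fq c zw by simp
  ultimately show False using elliptic_gap[OF c e q nc k k] neg z(3) by simp
qed

text \<open>Each letter now contains a single \<open>e\<close> or its inverse. Between equal signs
  less than half of a letter cancels, because \<open>c [^] i \<otimes> e\<close> is hyperbolic
  (\<open>t1\<close>, \<open>t2\<close>). At a change of sign more than half may cancel, and only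
  the sum with the cancellation at the other end is under control (\<open>gap\<close> to
  \<open>gap4\<close>).\<close>

lemma elliptic_ping_pong:
  assumes c: "c \<in> carrier G" and e: "e \<in> carrier G" and q: "act c q = q"
    and nc: "\<And>i :: int. i \<noteq> 0 \<Longrightarrow> c [^] i \<otimes> e \<noteq> e \<otimes> c [^] i"
    and hyp: "\<And>i :: int. \<not> elliptic (c [^] i \<otimes> e)"
    and suc: "successively (\<lambda>x y. snd x \<in> {1, - 1} \<and> snd y \<in> {1, - 1} \<and> \<not> (fst y = 0 \<and> snd y = - snd x)) w"
  shows "int (length w) \<le> 2 * d q (foldr (\<lambda>y. act (pw c e y)) w q) + 1"
proof -
  define b where "b = d q (act e q)"
  define O' where "O' k n m = ov q (act (e [^] k) q) (act (c [^] n) (act (e [^] m) q))" for k n m :: int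
  have fq: "act (c [^] n) q = q" for n :: int
    using act_int_pow_fixed c q by auto
  have e1: "e [^] (1::int) = e" "e [^] (- 1::int) = inv e"
    using e int_pow_neg[of e 1] by (simp_all add: int_pow_1)
  have binv: "d q (act (inv e) q) = b"
    using d_act_left[of e q q] e d_commute by (simp add: b_def)
  have len: "d q (act (pw c e y) q) = b" if "snd y \<in> {1, -1}" for y
    using act_d[of "c [^] fst y" q "act (e [^] snd y) q"] c e fq that e1 binv
    by (auto simp: pw_def act_mult b_def)
  have t1: "O' (-1) n 1 < b" for n
  proof -
    have 1: "act (inv (c [^] n \<otimes> e)) q = act (inv e) q"
      using pw_inv_fixed[OF c e q, of "(n, 1)"] e e1 by (simp add: pw_def)
    have "d q (act (c [^] n \<otimes> e) q) = b" using len[of "(n, 1)"] e1 by (simp add: pw_def)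
    then show ?thesis
      using not_elliptic_ov[of "c [^] n \<otimes> e" q] hyp[of n] c e 1 e1
      by (simp add: O'_def act_mult ov_commute)
  qed
  have t2: "O' 1 n (-1) = O' (-1) (- n) 1" for n
  proof -
    have "O' 1 n (-1) = ov (act (c [^] (- n)) q) (act (c [^] (- n)) (act e q)) (act (c [^] (- n)) (act (c [^] n) (act (inv e) q)))"
      using c e1 by (simp add: O'_def act_ov del: act_eq_iff)
    then show ?thesis using fq e1 act_pow_add[OF c, of "- n" n] by (simp add: O'_def ov_commute)
  qed
  have ninv: "c [^] i \<otimes> inv e \<noteq> inv e \<otimes> c [^] i" if "i \<noteq> 0" for i :: int
    using nc[OF that] commute_inv_iff[of e "c [^] i"] c e int_pow_closed[OF c, of i] by metis
  have gap: "O' 1 n 1 + O' (-1) k (-1) < 2 * b" if "n \<noteq> 0" "k \<noteq> 0" for n k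
    using elliptic_gap[OF c e q nc that] by (simp add: O'_def b_def e1)
  have gap1: "O' (-1) j 1 + O' (-1) k (-1) < 2 * b" if "k \<noteq> 0" for j k
    using elliptic_gap'[OF c e q nc _ that] t1[of j] by (simp add: O'_def b_def e1)
  have gap2: "O' 1 j (-1) + O' 1 k 1 < 2 * b" if "k \<noteq> 0" for j k
  proof -
    have "O' 1 j (-1) < b" using t1[of "- j"] t2[of j] by simp
    then show ?thesis
      using elliptic_gap'[OF c inv_closed[OF e] q ninv _ that, of j] e by (simp add: O'_def binv e1 b_def)
  qed
  have gap3: "O' 1 j (-1) + O' (-1) k (-1) < 2 * b" if "k \<noteq> 0" for j k
    using gap1[OF that, of "- j"] t2[of j] by simp
  have gap4: "O' (-1) j 1 + O' 1 k 1 < 2 * b" if "k \<noteq> 0" for j k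
    using gap2[OF that, of "- j"] t2[of "- j"] by simp
  show ?thesis
  proof (rule ping_pong[OF _ _ _ suc])
    show "pw c e y \<in> carrier G" for y using c e by simp
    have *: "ov q (act (inv (pw c e x)) q) (act (pw c e y) q) = O' (- snd x) (fst y) (snd y)"
      for x y
      unfolding pw_inv_fixed[OF c e q] O'_def using c e by (simp add: pw_def act_mult)
    fix x y z :: "int \<times> int"
    assume al: "snd x \<in> {1, - 1} \<and> snd y \<in> {1, - 1} \<and> \<not> (fst y = 0 \<and> snd y = - snd x)"
    have b0: "0 < b" using t1[of 0] ov_nonneg[of q "act (inv e) q" "act e q"] by (simp add: O'_def e1)
    have s: "O' (-1) n 1 < 2 * b" "O' 1 n (-1) < 2 * b" for n using t1[of n] t1[of "- n"] t2[of n] b0 by simp_all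
    have s2: "O' 1 n 1 < 2 * b" "O' (-1) n (-1) < 2 * b" if "n \<noteq> 0" for n
      using gap[OF that that] ov_nonneg unfolding O'_def by (smt (verit))+
    show "ov q (act (inv (pw c e x)) q) (act (pw c e y) q) < 2 * d q (act (pw c e y) q)"
      using al s s2 by (auto simp: * len)
    assume al2: "snd y \<in> {1, - 1} \<and> snd z \<in> {1, - 1} \<and> \<not> (fst z = 0 \<and> snd z = - snd y)"
    have tt: "O' (-1) n 1 + O' (-1) n' 1 < 2 * b" "O' 1 n (-1) + O' 1 n' (-1) < 2 * b"
       for n n' using t1[of n] t1[of n'] t1[of "- n"] t1[of "- n'"] t2[of n] t2[of n'] by simp_all
    show "ov q (act (inv (pw c e x)) q) (act (pw c e y) q) + ov q (act (inv (pw c e y)) q) (act (pw c e z) q)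
      < 2 * d q (act (pw c e y) q)"
      using al al2 tt[of "fst y" "fst z"] gap[of "fst y" "fst z"] gap[of "fst z" "fst y"]
        gap1[of "fst z" "fst y"] gap2[of "fst z" "fst y"] gap3[of "fst y" "fst z"] gap4[of "fst y" "fst z"]
      by (auto simp: * len add.commute)
  qed
qed

end

section \<open>Syllables and families of trees\<close>

context group
begin

lemma int_pow_conj:
  fixes n :: int
  assumes "x \<in> carrier G" "y \<in> carrier G"
  shows "(y \<otimes> x \<otimes> inv y) [^] n = y \<otimes> x [^] n \<otimes> inv y"
proof -
  have *: "(y \<otimes> x \<otimes> inv y) [^] k = y \<otimes> x [^] k \<otimes> inv y" for k :: nat
  proof (induction k)
    case (Suc k)
    have "y \<otimes> x [^] k \<otimes> inv y \<otimes> (y \<otimes> x \<otimes> inv y) = y \<otimes> x [^] k \<otimes> (inv y \<otimes> y) \<otimes> x \<otimes> inv y"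
      using assms by (simp only: m_assoc m_closed inv_closed nat_pow_closed)
    then show ?case using Suc assms by (simp add: m_assoc)
  qed (use assms in simp)
  show ?thesis
  proof (cases n)
    case (nonneg k)
    then show ?thesis using * by (simp add: int_pow_int)
  next
    case (neg k)
    then show ?thesis using *[of "Suc k"] assms
      by (simp only: int_pow_neg_int m_closed inv_closed)
        (simp add: inv_mult_group m_assoc del: nat_pow_Suc)
  qed
qed

definition syl :: "'a \<Rightarrow> 'a \<Rightarrow> bool \<Rightarrow> 'a" where
  "syl c e b = (if b then c else e)"

fun ev :: "'a \<Rightarrow> 'a \<Rightarrow> (bool \<times> int) list \<Rightarrow> 'a" where
  "ev c e [] = \<one>"
| "ev c e (s # ss) = syl c e (fst s) [^] snd s \<otimes> ev c e ss"

end

definition alternating :: "(bool \<times> int) list \<Rightarrow> bool" where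
  "alternating ss \<longleftrightarrow> successively (\<lambda>x y. fst x \<noteq> fst y) ss \<and> (\<forall>s\<in>set ss. snd s \<noteq> 0)"

definition inv_syls :: "(bool \<times> int) list \<Rightarrow> (bool \<times> int) list" where
  "inv_syls ss = rev (map (\<lambda>s. (fst s, - snd s)) ss)"

lemma alternating_inv_syls [simp]: "alternating (inv_syls ss) \<longleftrightarrow> alternating ss"
proof -
  have a: "successively (\<lambda>x y. fst x \<noteq> fst y) (inv_syls ss) \<longleftrightarrow> successively (\<lambda>x y. fst y \<noteq> fst x) ss"
    unfolding inv_syls_def successively_rev successively_map fst_conv ..
  have b: "(\<lambda>x y. fst y \<noteq> fst x) = (\<lambda>x y :: bool \<times> int. fst x \<noteq> fst y)"
    by (intro ext) (metis (full_types))
  note eq = a[unfolded b]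
  show ?thesis unfolding alternating_def eq by (auto simp: inv_syls_def)
qed

lemma alternating_append:
  "alternating (ss @ ts) \<longleftrightarrow> alternating ss \<and> alternating ts \<and>
    (ss = [] \<or> ts = [] \<or> fst (last ss) \<noteq> fst (hd ts))"
  by (auto simp: alternating_def successively_append_iff)

lemma alternating_Cons:
  "alternating (s # ss) \<longleftrightarrow> snd s \<noteq> 0 \<and> alternating ss \<and> (ss = [] \<or> fst s \<noteq> fst (hd ss))"
  by (auto simp: alternating_def successively_Cons)

lemma alternating_Nil [simp]: "alternating []"
  by (simp add: alternating_def)

lemma inv_syls_eq_Nil [simp]: "inv_syls ss = [] \<longleftrightarrow> ss = []"
  by (simp add: inv_syls_def)

lemma hd_last_inv_syls:
  "ss \<noteq> [] \<Longrightarrow> fst (hd (inv_syls ss)) = fst (last ss)"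
  "ss \<noteq> [] \<Longrightarrow> fst (last (inv_syls ss)) = fst (hd ss)"
  by (simp_all add: inv_syls_def hd_rev last_rev last_map hd_map)

context group
begin

lemma syl_closed [simp]: "c \<in> carrier G \<Longrightarrow> e \<in> carrier G \<Longrightarrow> syl c e b \<in> carrier G"
  by (simp add: syl_def)

lemma ev_closed [simp]: "c \<in> carrier G \<Longrightarrow> e \<in> carrier G \<Longrightarrow> ev c e ss \<in> carrier G"
  by (induction ss) auto

lemma ev_append:
  "c \<in> carrier G \<Longrightarrow> e \<in> carrier G \<Longrightarrow> ev c e (ss @ ts) = ev c e ss \<otimes> ev c e ts"
  by (induction ss) (auto simp: m_assoc)

lemma ev_inv_syls:
  assumes "c \<in> carrier G" "e \<in> carrier G"
  shows "ev c e (inv_syls ss) = inv (ev c e ss)"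
  using assms
  by (induction ss) (auto simp: inv_syls_def ev_append inv_mult_group int_pow_neg)

end

text \<open>Cuts an alternating word into blocks \<open>c [^] n \<otimes> e [^] m\<close>; an
  initial power of \<open>e\<close> gets \<open>n = 0\<close>, and a final power of \<open>c\<close>
  is dropped because \<open>c\<close> fixes the base point. The argument \<open>ex\<close> decides
  how a block is spelled in ping-pong letters. The last clause does not occur for alternating
  words.\<close>

fun group_syls :: "(int \<times> int \<Rightarrow> (int \<times> int) list) \<Rightarrow> (bool \<times> int) list \<Rightarrow> (int \<times> int) list" where
  "group_syls ex [] = []"
| "group_syls ex [(True, n)] = []"
| "group_syls ex ((False, m) # ss) = ex (0, m) @ group_syls ex ss"
| "group_syls ex ((True, n) # (False, m) # ss) = ex (n, m) @ group_syls ex ss"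
| "group_syls ex ((True, n) # (True, m) # ss) = []"

lemma syls_induct [case_names Nil True False True_False True_True]:
  assumes "P []" "\<And>n. P [(True, n)]" "\<And>m ss. P ss \<Longrightarrow> P ((False, m) # ss)"
    "\<And>n m ss. P ss \<Longrightarrow> P ((True, n) # (False, m) # ss)" "\<And>n m ss. P ((True, n) # (True, m) # ss)"
  shows "P (ss :: (bool \<times> int) list)"
  by (rule group_syls.induct[of "\<lambda>_. P"]) (use assms in auto)

lemma group_syls_hd:
  assumes "alternating ss" "ss \<noteq> []" "fst (hd ss)" "group_syls ex ss \<noteq> []"
  shows "\<exists>y zs. group_syls ex ss = ex y @ zs \<and> fst y \<noteq> 0 \<and> snd y \<noteq> 0"
  using assms by (induction ss rule: syls_induct) (auto simp: alternating_Cons)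

lemma successively_group_syls:
  assumes "alternating ss" and ne: "\<And>y. ex y \<noteq> []"
    and 1: "\<And>y. snd y \<noteq> 0 \<Longrightarrow> successively al (ex y)"
    and 2: "\<And>x y. snd x \<noteq> 0 \<Longrightarrow> fst y \<noteq> 0 \<Longrightarrow> snd y \<noteq> 0 \<Longrightarrow> al (last (ex x)) (hd (ex y))"
  shows "successively al (group_syls ex ss)"
proof -
  have app: "successively al (ex y @ group_syls ex ss)"
    if prems: "successively al (group_syls ex ss)" "alternating ss" "ss \<noteq> [] \<longrightarrow> fst (hd ss)" "snd y \<noteq> 0" for y ss
  proof (cases "group_syls ex ss = []")
    case True
    then show ?thesis using 1 prems by simp
  next
    case False
    moreover from this have "ss \<noteq> []" by auto
    ultimately obtain x zs where x: "group_syls ex ss = ex x @ zs" "fst x \<noteq> 0" "snd x \<noteq> 0"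
      using group_syls_hd[of ss ex] prems by blast
    then show ?thesis using 1 2 ne prems by (simp add: successively_append_iff)
  qed
  show ?thesis
    using assms(1)
  proof (induction ss rule: syls_induct)
    case (False m ss)
    then show ?case using app[of ss "(0, m)"] by (auto simp: alternating_Cons)
  next
    case (True_False n m ss)
    then show ?case using app[of ss "(n, m)"] by (auto simp: alternating_Cons)
  qed auto
qed

lemma length_group_syls:
  assumes "alternating ss" and ne: "\<And>y. ex y \<noteq> []"
  shows "length ss \<le> 2 * length (group_syls ex ss) + 1"
proof -
  have *: "Suc 0 \<le> length (ex y)" for y using ne[of y] by (cases "ex y") auto
  show ?thesis
    using assms(1)
  proof (induction ss rule: syls_induct)
    case (False m ss)
    then show ?case using *[of "(0, m)"] by (auto simp: alternating_Cons)
  next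
    case (True_False n m ss)
    then show ?case using *[of "(n, m)"] by (auto simp: alternating_Cons)
  qed (auto simp: alternating_Cons)
qed

context comm_tree_action
begin

lemma foldr_group_syls:
  assumes c: "c \<in> carrier G" and e: "e \<in> carrier G" and q: "act c q = q" and "alternating ss"
    and ex: "\<And>y z. snd y \<noteq> 0 \<Longrightarrow> foldr (\<lambda>y. act (pw c e y)) (ex y) z = act (pw c e y) z"
  shows "foldr (\<lambda>y. act (pw c e y)) (group_syls ex ss) q = act (ev c e ss) q"
  using assms(4)
proof (induction ss rule: syls_induct)
  case (True n)
  then show ?case using act_int_pow_fixed[OF c q] c by (simp add: syl_def)
next
  case (False m ss)
  have "act (pw c e (0, m)) z = act (e [^] m) z" for z using e by (simp add: pw_def)
  then show ?case using False ex[of "(0, m)"] c e by (simp add: alternating_Cons syl_def act_mult)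
next
  case (True_False n m ss)
  have "act (pw c e (n, m)) z = act (c [^] n) (act (e [^] m) z)" for z
    using c e by (simp add: pw_def act_mult)
  then show ?case using True_False ex[of "(n, m)"] c e by (simp add: alternating_Cons syl_def act_mult)
qed (auto simp: alternating_Cons)

end

text \<open>All actions share one metric space, since each tree of a vertex will be placed in the
  same large Cayley tree.\<close>

locale forest = group G + tree d
  for G (structure) and d :: "'p \<Rightarrow> 'p \<Rightarrow> int" +
  fixes I :: "'i set" and act :: "'i \<Rightarrow> 'a \<Rightarrow> 'p \<Rightarrow> 'p"
  assumes action: "i \<in> I \<Longrightarrow> comm_tree_action G d (act i)"
    and all_elliptic: "x \<in> carrier G \<Longrightarrow> (\<And>i. i \<in> I \<Longrightarrow> \<exists>p. act i x p = p) \<Longrightarrow> x = \<one>"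
begin

lemma not_elliptic_somewhere:
  assumes "x \<in> carrier G" "x \<noteq> \<one>"
  obtains i a where "i \<in> I" "tree_action.axis_point d (act i) x a" "0 < d a (act i x a)"
proof -
  obtain i where i: "i \<in> I" "\<And>p. act i x p \<noteq> p" using all_elliptic assms by metis
  interpret comm_tree_action G d "act i" using action i(1) .
  have "\<not> elliptic x" using i(2) by (simp add: elliptic_def)
  then obtain a where a: "axis_point x a" using axis_point_exists assms(1) by blast
  have "d a (act i x a) \<noteq> 0" using i(2)[of a] by (metis d_eq_0_iff)
  then have "0 < d a (act i x a)" using d_nonneg[of a "act i x a"] by linarith
  then show thesis using that i(1) a by blast
qed

lemma torsion_free:
  fixes n :: int
  assumes x: "x \<in> carrier G" and n: "x [^] n = \<one>" "n \<noteq> 0"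
  shows "x = \<one>"
proof (rule ccontr)
  assume "x \<noteq> \<one>"
  then obtain i a where i: "i \<in> I" and a: "tree_action.axis_point d (act i) x a" "0 < d a (act i x a)"
    using not_elliptic_somewhere x by blast
  interpret comm_tree_action G d "act i" using action i .
  show False using axis_int[OF x a(1), of 0 n] n a(2) by simp
qed

text \<open>The conjugate \<open>y\<close> of \<open>c\<close> by \<open>x\<close> satisfies
  \<open>y [^] n = c [^] n\<close>, so in a tree where \<open>c\<close> is hyperbolic the axes of
  \<open>c\<close> and \<open>y\<close> run together for arbitrarily long, and \<open>c\<close>
  commutes with \<open>y\<close>. Then \<open>inv c \<otimes> y\<close> is a torsion element, hence
  trivial.\<close>

lemma commute_of_pow_commute:
  fixes n :: int
  assumes c: "c \<in> carrier G" and x: "x \<in> carrier G" and n: "n \<noteq> 0"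
    and com: "c [^] n \<otimes> x = x \<otimes> c [^] n"
  shows "c \<otimes> x = x \<otimes> c"
proof (cases "c = \<one>")
  case False
  then obtain i a where i: "i \<in> I" and a: "tree_action.axis_point d (act i) c a" "0 < d a (act i c a)"
    using not_elliptic_somewhere c by blast
  interpret comm_tree_action G d "act i" using action i .
  define t where "t = d a (act i c a)"
  define y where "y = x \<otimes> c \<otimes> inv x"
  have y: "y \<in> carrier G" using x c by (simp add: y_def)
  have yn: "y [^] n = c [^] n"
    using com c x inv_solve_right[of "c [^] n" "x \<otimes> c [^] n" x] by (simp add: y_def int_pow_conj)
  define b where "b = act i x a"
  have b: "axis_point y b" "d b (act i y b) = t"
    using axis_conj[OF c x a(1)] by (simp_all add: y_def b_def t_def)
  define D where "D = d a b"
  \<comment> \<open>After cutting off \<open>D + 1\<close> at both ends, where the two axes may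
    differ, at least \<open>2 * t\<close> has to remain for
    \<open>axes_overlap_commute\<close>.\<close>
  define K where "K = 2 * D + 2 * t + 3"
  have D: "0 \<le> D" by (simp add: D_def)
  have t: "0 < t" using a(2) by (simp add: t_def)
  let ?a = "act i (c [^] (n * K)) a" and ?b = "act i (y [^] (n * K)) b"
  have yK: "y [^] (n * K) = c [^] (n * K)"
    using yn c y by (simp flip: int_pow_pow)
  have dab: "d ?a ?b = D" using c unfolding yK by (simp add: D_def)
  have "1 \<le> \<bar>n\<bar> * t" using n t by (simp add: int_one_le_iff_zero_less)
  then have "K \<le> K * (\<bar>n\<bar> * t)" using D t by (simp add: K_def)
  moreover have da: "d a ?a = K * (\<bar>n\<bar> * t)"
    using axis_int[OF c a(1), of 0 "n * K"] D t by (simp add: t_def K_def abs_mult)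
  ultimately have L: "K \<le> d a ?a" by simp
  obtain p where p: "p \<in> seg a ?a" "d a p = D + 1"
    using seg_point[of "D + 1" a ?a] L D t K_def by auto
  obtain q where q: "q \<in> seg a ?a" "d a q = d a ?a - D - 1"
    using seg_point[of "d a ?a - D - 1" a ?a] L D t K_def by auto
  have pq: "d p q = d a ?a - 2 * D - 2"
    using seg_dist[OF p(1) q(1)] p(2) q(2) L D t K_def by simp
  have in_b: "z \<in> seg b ?b" if z: "z \<in> seg a ?a" "D + 1 \<le> d a z" "d a z \<le> d a ?a - D - 1" for z
  proof (rule quadrilateral[of a b D ?a ?b])
    show "d z b \<noteq> 0" using triangle[of a z b] z D_def d_commute[of z b] by auto
    show "d z ?b \<noteq> 0" using triangle[of ?a z ?b] z dab d_commute[of z ?a] d_commute[of z ?b] by (auto simp: seg_def)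
  qed (use z D_def dab L D t K_def in \<open>auto simp: seg_def\<close>)
  have pqb: "p \<in> seg b ?b" "q \<in> seg b ?b"
    using in_b[OF p(1)] in_b[OF q(1)] p(2) q(2) L D t K_def by auto
  have "c \<otimes> y = y \<otimes> c"
    using axes_overlap_commute[OF c y a(1) b(1), of p 0 "n * K" 0 "n * K" q] p(1) q(1) pqb b(2) pq L D t
    by (simp add: t_def K_def)
  then have "inv c \<otimes> y = y \<otimes> inv c" using commute_inv_left c y by simp
  then have "(inv c \<otimes> y) [^] n = inv c [^] n \<otimes> y [^] n"
    using int_pow_mult_distrib c y by simp
  also have "\<dots> = \<one>" using yn c by (simp add: int_pow_inv)
  finally have "inv c \<otimes> y = \<one>" using torsion_free n c y by blast
  then have "y = c" using c y inv_solve_left[of \<one> c y] by simp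
  then have "x \<otimes> c = c \<otimes> x" using inv_solve_right[of c "x \<otimes> c" x] c x by (simp add: y_def)
  then show ?thesis by simp
qed (use x in simp)

lemma nielsen_closed_pow:
  fixes n :: int
  assumes PP: "nielsen_closed PP" and gh: "(g, h) \<in> PP"
  shows "(g, g [^] n \<otimes> h) \<in> PP"
proof -
  have *: "(g, g [^] k \<otimes> h) \<in> PP" if gh: "(g, h) \<in> PP" for g and k :: nat
  proof (induction k)
    case 0
    then show ?case using gh nielsen_closedD(2)[OF PP gh] by simp
  next
    case (Suc k)
    have "g \<otimes> (g [^] k \<otimes> h) = g [^] Suc k \<otimes> h"
      using nielsen_closedD(1,2)[OF PP gh] nat_pow_Suc2[of g k] by (simp add: m_assoc del: nat_pow_Suc)
    then show ?case using nielsen_closedD(6)[OF PP Suc] by simp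
  qed
  note c = nielsen_closedD[OF PP gh]
  show ?thesis
  proof (cases n)
    case (nonneg k)
    then show ?thesis using *[OF gh, of k] by (simp add: int_pow_int)
  next
    case (neg k)
    have "(inv g, (inv g) [^] Suc k \<otimes> h) \<in> PP" using *[OF c(4)] .
    then have "(inv (inv g), (inv g) [^] Suc k \<otimes> h) \<in> PP" using nielsen_closedD(4)[OF PP] by blast
    then show ?thesis using neg c(1)
      by (simp only: int_pow_neg_int nat_pow_inv inv_inv)
  qed
qed

end

section \<open>Counting syllables in one tree\<close>

definition syl_letters :: "(bool \<times> int) list \<Rightarrow> (bool \<times> bool) list" where
  "syl_letters ss = concat (map (\<lambda>s. replicate (nat \<bar>snd s\<bar>) (fst s, 0 < snd s)) ss)"

lemma syl_letters_simps [simp]: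
  "syl_letters [] = []"
  "syl_letters (s # ss) = replicate (nat \<bar>snd s\<bar>) (fst s, 0 < snd s) @ syl_letters ss"
  by (simp_all add: syl_letters_def)

lemma successively_replicate: "P x x \<Longrightarrow> successively P (replicate k x)"
proof (induction k)
  case (Suc k)
  then show ?case by (cases k) (auto simp: successively_Cons)
qed simp

lemma successively_syl_letters:
  assumes "alternating ss"
  shows "successively (\<lambda>x y. x \<noteq> (fst y, \<not> snd y)) (syl_letters ss) \<and>
    length ss \<le> length (syl_letters ss) \<and> (ss \<noteq> [] \<longrightarrow> fst (hd (syl_letters ss)) = fst (hd ss))"
  using assms
proof (induction ss)
  case (Cons s ss)
  have s: "snd s \<noteq> 0" and ss: "alternating ss" and hd: "ss \<noteq> [] \<longrightarrow> fst s \<noteq> fst (hd ss)"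
    using Cons.prems by (auto simp: alternating_Cons)
  let ?r = "replicate (nat \<bar>snd s\<bar>) (fst s, 0 < snd s)"
  have r: "?r \<noteq> []" "hd ?r = (fst s, 0 < snd s)" "last ?r = (fst s, 0 < snd s)" "Suc 0 \<le> length ?r"
    using s by (auto simp: Suc_le_eq)
  note IH = Cons.IH[OF ss]
  have "successively (\<lambda>x y. x \<noteq> (fst y, \<not> snd y)) ?r"
    by (rule successively_replicate) simp
  then have "successively (\<lambda>x y. x \<noteq> (fst y, \<not> snd y)) (syl_letters (s # ss))"
    using IH hd r by (cases "ss = []") (auto simp: successively_append_iff)
  moreover have "length (s # ss) \<le> length (syl_letters (s # ss))"
    using IH r(4) by simp
  moreover have "fst (hd (syl_letters (s # ss))) = fst s"
    using r by (simp add: hd_append)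
  ultimately show ?case by simp
qed simp

context tree_action
begin

lemma foldr_replicate_act:
  assumes f: "f l \<in> carrier G"
  shows "foldr (\<lambda>y. act (f y)) (replicate k l) z = act (f l [^] int k) z"
proof (induction k)
  case (Suc k)
  then show ?case using act_pow_add[OF f, of 1 "int k" z] f by (simp add: int_pow_1 add.commute)
qed simp

lemma foldr_syl_letters:
  assumes "g \<in> carrier G" "h \<in> carrier G"
  shows "foldr (\<lambda>y. act (letter g h y)) (syl_letters ss) p = act (ev g h ss) p"
proof (induction ss)
  case (Cons s ss)
  have l: "letter g h y \<in> carrier G" for y using assms by (simp add: letter_def)
  have s: "letter g h (fst s, 0 < snd s) [^] \<bar>snd s\<bar> = syl g h (fst s) [^] snd s"
    using assms by (auto simp: letter_def syl_def abs_if int_pow_inv int_pow_neg not_less)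
  have "foldr (\<lambda>y. act (letter g h y)) (syl_letters (s # ss)) p =
    act (letter g h (fst s, 0 < snd s) [^] \<bar>snd s\<bar>) (act (ev g h ss) p)"
    using Cons foldr_replicate_act[of "letter g h" "(fst s, 0 < snd s)" "nat \<bar>snd s\<bar>"] l by simp
  then show ?case using s assms by (simp add: act_mult)
qed simp

end

context forest
begin

text \<open>The cases are whether a pair can have no, two, or at most one elliptic member. Ping-pong
  bounds the number of blocks by \<open>2 * d + 1\<close>; a block holds at most two syllables and
  one final power of \<open>c\<close> may be lost, which gives
  \<open>2 * (2 * d + 1) + 1\<close>.\<close>

lemma syllable_bound:
  assumes i: "i \<in> I" and PP: "nielsen_closed PP" "PP \<noteq> {}"
    and nc: "\<And>g h. (g, h) \<in> PP \<Longrightarrow> g \<otimes> h \<noteq> h \<otimes> g"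
  obtains c e p where "(c, e) \<in> PP"
    "\<And>ss. alternating ss \<Longrightarrow> int (length ss) \<le> 4 * d p (act i (ev c e ss) p) + 3"
proof -
  interpret comm_tree_action G d "act i" using action i .
  show thesis
  proof (cases "\<exists>c e. (c, e) \<in> PP \<and> elliptic c")
    case False
    then have hyp: "\<And>g h. (g, h) \<in> PP \<Longrightarrow> \<not> elliptic g" by blast
    show thesis
    proof (rule nielsen_minimal[OF PP hyp])
      fix g h p assume gh: "(g, h) \<in> PP"
      assume N: "\<And>x y. x \<noteq> (fst y, \<not> snd y) \<Longrightarrow>
      ov p (act i (inv (letter g h x)) p) (act i (letter g h y) p) < 2 * d p (act i (letter g h y) p)"
      "\<And>x y z. x \<noteq> (fst y, \<not> snd y) \<Longrightarrow> y \<noteq> (fst z, \<not> snd z) \<Longrightarrow>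
      ov p (act i (inv (letter g h x)) p) (act i (letter g h y) p) +
      ov p (act i (inv (letter g h y)) p) (act i (letter g h z) p) < 2 * d p (act i (letter g h y) p)"
      note G = nielsen_closedD(1,2)[OF PP(1) gh]
      have l: "letter g h y \<in> carrier G" for y using G by (simp add: letter_def)
      show thesis
      proof (rule that[OF gh, of p])
        fix ss assume "alternating ss"
        note s = successively_syl_letters[OF this]
        have "int (length (syl_letters ss)) \<le> 2 * d p (foldr (\<lambda>y. act i (letter g h y)) (syl_letters ss) p) + 1"
          by (rule ping_pong[where al = "\<lambda>x y. x \<noteq> (fst y, \<not> snd y)"]) (use l N s in auto)
        then show "int (length ss) \<le> 4 * d p (act i (ev g h ss) p) + 3"
          using s d_nonneg[of p "act i (ev g h ss) p"] by (simp add: foldr_syl_letters[OF G])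
      qed
    qed
  next
    case True
    have nc1: "c [^] k \<otimes> e \<noteq> e \<otimes> c [^] k" if "(c, e) \<in> PP" "k \<noteq> 0" for c e and k :: int
      using commute_of_pow_commute[of c e k] nc[OF that(1)] nielsen_closedD(1,2)[OF PP(1) that(1)] that(2) by blast
    show thesis
    proof (cases "\<exists>c e. (c, e) \<in> PP \<and> elliptic c \<and> elliptic e")
      case True
      then obtain c e q r where ce: "(c, e) \<in> PP" and q: "act i c q = q" and r: "act i e r = r"
        by (auto simp: elliptic_def)
      note G = nielsen_closedD(1,2)[OF PP(1) ce]
      have nc2: "c [^] k \<otimes> e [^] j \<noteq> e [^] j \<otimes> c [^] k" if "k \<noteq> 0" "j \<noteq> 0" for k j :: int
        using commute_of_pow_commute[of e "c [^] k" j] nc1[OF ce that(1)] G that(2) by (metis int_pow_closed)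
      show thesis
      proof (rule that[OF ce, of q])
        fix ss assume alt: "alternating ss"
        let ?w = "group_syls (\<lambda>y. [y]) ss"
        have "int (length ?w) \<le> 2 * d q (foldr (\<lambda>y. act i (pw c e y)) ?w q) + 1"
          by (rule elliptic_pair_ping_pong[OF G q r nc2])
            (use alt in \<open>auto intro: successively_group_syls\<close>)
        moreover have "foldr (\<lambda>y. act i (pw c e y)) ?w q = act i (ev c e ss) q"
          by (rule foldr_group_syls[OF G q alt]) simp
        ultimately show "int (length ss) \<le> 4 * d q (act i (ev c e ss) q) + 3"
          using length_group_syls[OF alt, of "\<lambda>y. [y]"] by simp
      qed
    next
      case False
      obtain c e q where ce: "(c, e) \<in> PP" and q: "act i c q = q"
        using \<open>\<exists>c e. (c, e) \<in> PP \<and> elliptic c\<close> by (auto simp: elliptic_def)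
      note G = nielsen_closedD(1,2)[OF PP(1) ce]
      \<comment> \<open>Otherwise \<open>c\<close> and \<open>c [^] k \<otimes> e\<close> would be a
        pair with two elliptic members.\<close>
      have hyp: "\<not> elliptic (c [^] k \<otimes> e)" for k :: int
        using False nielsen_closed_pow[OF PP(1) ce, of k] q by (auto simp: elliptic_def)
      \<comment> \<open>The power of \<open>e\<close> is cut into unit letters, the first of which
        carries the power of \<open>c\<close>.\<close>
      define ex where "ex y = (fst y, sgn (snd y)) # replicate (nat \<bar>snd y\<bar> - 1) (0, sgn (snd y))" for y :: "int \<times> int"
      show thesis
      proof (rule that[OF ce, of q])
        fix ss assume alt: "alternating ss"
        let ?w = "group_syls ex ss"
        let ?al = "\<lambda>x y :: int \<times> int. snd x \<in> {1, - 1} \<and> snd y \<in> {1, - 1} \<and> \<not> (fst y = 0 \<and> snd y = - snd x)"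
        have sg: "sgn m = 1 \<or> sgn m = - 1" if "m \<noteq> 0" for m :: int using that by (auto simp: sgn_if)
        have suc: "successively ?al ?w"
        proof (rule successively_group_syls[OF alt])
          fix y :: "int \<times> int" assume y: "snd y \<noteq> 0"
          have "successively ?al (replicate k (0, sgn (snd y)))" for k
            by (rule successively_replicate) (use sg[OF y] in auto)
          then show "successively ?al (ex y)"
            using sg[OF y] by (auto simp: ex_def successively_Cons hd_replicate)
        next
          fix x y :: "int \<times> int" assume "snd x \<noteq> 0" "fst y \<noteq> 0" "snd y \<noteq> 0"
          then show "?al (last (ex x)) (hd (ex y))"
            using sg[of "snd x"] sg[of "snd y"] by (auto simp: ex_def)
        qed (simp add: ex_def)
        have "int (length ?w) \<le> 2 * d q (foldr (\<lambda>y. act i (pw c e y)) ?w q) + 1"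
          by (rule elliptic_ping_pong[OF G q nc1[OF ce] hyp suc])
        moreover have "foldr (\<lambda>y. act i (pw c e y)) ?w q = act i (ev c e ss) q"
        proof (rule foldr_group_syls[OF G q alt])
          fix y :: "int \<times> int" and z assume y: "snd y \<noteq> 0"
          have "foldr (\<lambda>y. act i (pw c e y)) (ex y) z =
            act i (pw c e (fst y, sgn (snd y))) (act i ((e [^] sgn (snd y)) [^] int (nat \<bar>snd y\<bar> - 1)) z)"
            using foldr_replicate_act[of "pw c e" "(0, sgn (snd y))"] G
            by (simp add: ex_def pw_def)
          also have "\<dots> = act i (c [^] fst y) (act i (e [^] (sgn (snd y) + sgn (snd y) * int (nat \<bar>snd y\<bar> - 1))) z)"
            using G by (simp add: pw_def act_mult int_pow_pow int_pow_mult)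
          also have "sgn (snd y) + sgn (snd y) * int (nat \<bar>snd y\<bar> - 1) = snd y"
            using y by (auto simp: sgn_if of_nat_diff nat_diff_distrib)
          also have "act i (c [^] fst y) (act i (e [^] snd y) z) = act i (pw c e y) z"
            using G by (simp add: pw_def act_mult)
          finally show "foldr (\<lambda>y. act i (pw c e y)) (ex y) z = act i (pw c e y) z" .
        qed
        ultimately show "int (length ss) \<le> 4 * d q (act i (ev c e ss) q) + 3"
          using length_group_syls[OF alt, of ex] by (simp add: ex_def)
      qed
    qed
  qed
qed

text \<open>Powers of such a word are still alternating. If its value were trivial, the fourth power
  would have displacement zero but at least four syllables, against the bound of three.\<close>

lemma cyclic_alternating_nontrivial:
  assumes i: "i \<in> I" and G: "c \<in> carrier G" "e \<in> carrier G"
    and bd: "\<And>ss. alternating ss \<Longrightarrow> int (length ss) \<le> 4 * d p (act i (ev c e ss) p) + 3"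
    and W: "alternating W" "W \<noteq> []" "fst (last W) \<noteq> fst (hd W)"
  shows "ev c e W \<noteq> \<one>"
proof
  assume 1: "ev c e W = \<one>"
  interpret comm_tree_action G d "act i" using action i .
  define w where "w k = concat (replicate k W)" for k
  have "alternating (w k) \<and> (k \<noteq> 0 \<longrightarrow> w k \<noteq> [] \<and> hd (w k) = hd W) \<and> ev c e (w k) = \<one> \<and> length (w k) = k * length W" for k
  proof (induction k)
    case (Suc k)
    have w: "w (Suc k) = W @ w k" by (simp add: w_def)
    show ?case unfolding w using Suc W G 1
      by (cases "k = 0") (auto simp: alternating_append ev_append w_def)
  qed (simp add: w_def)
  from this[of 4] bd[of "w 4"] have "int (4 * length W) \<le> 3" by simp
  then show False using W(2) by (cases W) auto
qed

text \<open>The commutator of the two elements is spelled by the cyclically alternating word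
  \<open>?W\<close>.\<close>

lemma alternating_not_commute:
  assumes i: "i \<in> I" and G: "c \<in> carrier G" "e \<in> carrier G"
    and bd: "\<And>ss. alternating ss \<Longrightarrow> int (length ss) \<le> 4 * d p (act i (ev c e ss) p) + 3"
    and alt: "alternating ((b, 1) # z @ [(b', 1)])"
  shows "syl c e b \<otimes> (ev c e z \<otimes> syl c e b' \<otimes> inv (ev c e z)) \<noteq>
    (ev c e z \<otimes> syl c e b' \<otimes> inv (ev c e z)) \<otimes> syl c e b"
proof
  let ?z = "inv_syls z"
  let ?W = "(b, 1) # z @ (b', 1) # ?z @ (b, - 1) # z @ (b', - 1) # ?z"
  let ?x = "syl c e b" and ?y = "ev c e z \<otimes> syl c e b' \<otimes> inv (ev c e z)"
  assume com: "?x \<otimes> ?y = ?y \<otimes> ?x"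
  have xy: "?x \<in> carrier G" "?y \<in> carrier G" using G by simp_all
  have "alternating ?W \<and> fst (last ?W) \<noteq> fst (hd ?W)"
  proof (cases "z = []")
    case True
    then show ?thesis using alt by (simp add: alternating_Cons inv_syls_def)
  next
    case False
    then show ?thesis using alt hd_last_inv_syls[of z]
      by (auto simp: alternating_Cons alternating_append)
  qed
  then have "ev c e ?W \<noteq> \<one>" using cyclic_alternating_nontrivial[OF i G bd] by blast
  moreover have "ev c e ?W = ?x \<otimes> ?y \<otimes> inv ?x \<otimes> inv ?y"
    using G by (simp add: ev_append ev_inv_syls int_pow_1 int_pow_neg inv_mult_group m_assoc)
  moreover have "?x \<otimes> ?y \<otimes> inv ?x \<otimes> inv ?y = \<one>"
    unfolding com using xy by (simp add: m_assoc)
  ultimately show False by simp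
qed

end

section \<open>Backtracking of polygonal lines\<close>

context tree
begin

fun polylen :: "'p list \<Rightarrow> int" where
  "polylen (x # y # us) = d x y + polylen (y # us)"
| "polylen us = 0"

fun sides :: "'p list \<Rightarrow> ('p \<times> 'p) list" where
  "sides (x # y # us) = (x, y) # sides (y # us)"
| "sides us = []"

definition thin :: "int \<Rightarrow> 'p \<times> 'p \<Rightarrow> 'p \<times> 'p \<Rightarrow> bool" where
  "thin B s t \<longleftrightarrow> (\<forall>p\<in>seg (fst s) (snd s) \<inter> seg (fst t) (snd t).
     \<forall>q\<in>seg (fst s) (snd s) \<inter> seg (fst t) (snd t). d p q \<le> B)"

definition subside :: "'p \<times> 'p \<Rightarrow> 'p \<times> 'p \<Rightarrow> bool" where
  "subside s t \<longleftrightarrow> seg (fst s) (snd s) \<subseteq> seg (fst t) (snd t)"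

lemma thin_subside: "thin B s t \<Longrightarrow> subside s' s \<Longrightarrow> subside t' t \<Longrightarrow> thin B s' t'"
  unfolding thin_def subside_def by blast

lemma subside_trans: "subside s t \<Longrightarrow> subside t u \<Longrightarrow> subside s u"
  unfolding subside_def by blast

lemma subside_refl [simp]: "subside s s"
  by (simp add: subside_def)

lemma polylen_ge: "d x (last (x # us)) \<le> polylen (x # us)"
proof (induction us arbitrary: x)
  case (Cons y us)
  show ?case using Cons[of y] triangle[of x "last (y # us)" y] by simp
qed simp

text \<open>Sides that are swallowed by the backtracking are dropped, each at a cost of at most \<open>2 * B\<close>;
  the term \<open>length us - length vs\<close> keeps the account.\<close>
lemma push_side:
  assumes "polylen (x # us) = d x (last (x # us))"
    and "\<forall>s\<in>set (sides (x # us)). thin B (p, x) s"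
    and "0 \<le> B"
  shows "\<exists>vs. polylen (p # vs) = d p (last (p # vs)) \<and> last (p # vs) = last (x # us) \<and>
    (\<forall>s\<in>set (sides (p # vs)). subside s (p, x) \<or> (\<exists>t\<in>set (sides (x # us)). subside s t)) \<and>
    d p x + d x (last (x # us)) \<le> d p (last (x # us)) + 2 * B * (int (length us) + 2 - int (length vs))"
  using assms(1,2)
proof (induction us arbitrary: x)
  case Nil
  then show ?case using assms(3) by (intro exI[of _ "[x]"]) simp
next
  case (Cons u us)
  let ?l = "last (u # us)"
  have "d x ?l \<le> d x u + d u ?l" by (rule triangle)
  then have geo: "polylen (u # us) = d u ?l" "u \<in> seg x ?l"
    using Cons.prems(1) polylen_ge[of u us] by (simp_all add: seg_def)
  obtain m where m: "m \<in> seg x p" "m \<in> seg x u" "m \<in> seg p u" using median by metis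
  have "x \<in> seg p x \<inter> seg x u" "m \<in> seg p x \<inter> seg x u" using m seg_commute by auto
  then have B: "d x m \<le> B" using Cons.prems(2) by (simp add: thin_def)
  have pm: "d p x = d p m + d x m" "d p u = d p m + d m u" "d x u = d x m + d m u"
    using m d_commute[of x p] d_commute[of m p] by (simp_all add: seg_def)
  show ?case
  proof (cases "m = u")
    case True
    have sub: "subside (p, u) (p, x)"
      using m True seg_commute[of x p] seg_sub[of p p x u] by (simp add: subside_def)
    have "\<forall>s\<in>set (sides (u # us)). thin B (p, u) s"
      using thin_subside[OF _ sub subside_refl] Cons.prems(2) by simp
    from Cons.IH[OF geo(1) this] obtain vs where vs:
      "polylen (p # vs) = d p (last (p # vs))" "last (p # vs) = ?l"
      "\<forall>s\<in>set (sides (p # vs)). subside s (p, u) \<or> (\<exists>t\<in>set (sides (u # us)). subside s t)"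
      "d p u + d u ?l \<le> d p ?l + 2 * B * (int (length us) + 2 - int (length vs))"
      by (elim exE conjE) (rule that)
    have "d p x + d x ?l \<le> d p ?l + 2 * B * (int (length (u # us)) + 2 - int (length vs))"
    proof -
      have "2 * B * (int (length (u # us)) + 2 - int (length vs)) =
        2 * B * (int (length us) + 2 - int (length vs)) + 2 * B"
        by (simp add: algebra_simps)
      moreover have "d p x = d p u + d x u" "d x u \<le> B" using pm(1) B True by simp_all
      moreover have "d x ?l = d x u + d u ?l" using geo(2) by (simp add: seg_def)
      ultimately show ?thesis using vs(4) by linarith
    qed
    moreover have "\<forall>s\<in>set (sides (p # vs)). subside s (p, x) \<or> (\<exists>t\<in>set (sides (x # u # us)). subside s t)"
      using vs(3) subside_trans[OF _ sub] by fastforce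
    ultimately show ?thesis using vs(1,2) by (intro exI[of _ vs]) simp
  next
    case False
    have "u \<in> seg m ?l"
      using seg_trans(2)[of u x ?l m] m(2) geo(2) by simp
    then have "u \<in> seg p ?l" using seg_concat[of m u p ?l] m(3) False by simp
    then have l: "d p ?l = d p m + d m u + d u ?l" using pm by (simp add: seg_def)
    have len: "polylen (p # m # u # us) = d p ?l" using l geo(1) by simp
    have s1: "subside (p, m) (p, x)"
      using m(1) seg_commute[of x p] seg_sub[of p p x m] by (simp add: subside_def)
    have s2: "subside (m, u) (x, u)"
      using m(2) seg_sub[of m x u u] by (simp add: subside_def)
    have "d p x + d x ?l \<le> d p ?l + 2 * B"
      using pm l B geo(2) by (simp add: seg_def)
    then show ?thesis using len s1 s2
      by (intro exI[of _ "m # u # us"]) (auto intro: subside_refl)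
  qed
qed

text \<open>Sides are added at the front, and the line is replaced each time by a geodesic chain
  \<open>vs\<close> made of pieces of the old sides. Sides that were far apart can become neighbours
  in it, so thinness is required of all pairs of sides. The number of pieces serves as a potential
  in the induction: the side bought by \<open>push_side\<close> may swallow many pieces, but each
  piece is swallowed only once.\<close>

lemma polylen_bound:
  assumes "0 \<le> B" "sorted_wrt (thin B) (sides (x # us))"
  shows "polylen (x # us) \<le> d x (last (x # us)) + 4 * B * int (length us)"
proof -
  have "\<exists>vs. polylen (x # vs) = d x (last (x # vs)) \<and> last (x # vs) = last (x # us) \<and>
    (\<forall>s\<in>set (sides (x # vs)). \<exists>t\<in>set (sides (x # us)). subside s t) \<and>
    polylen (x # us) \<le> d x (last (x # us)) + 2 * B * (2 * int (length us) - int (length vs))"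
    using assms(2)
  proof (induction us arbitrary: x)
    case Nil
    show ?case by (intro exI[of _ "[]"]) simp
  next
    case (Cons y us)
    let ?l = "last (y # us)"
    have "sorted_wrt (thin B) (sides (y # us))" using Cons.prems by simp
    from Cons.IH[OF this] obtain vs where vs: "polylen (y # vs) = d y (last (y # vs))" "last (y # vs) = ?l"
      "\<forall>s\<in>set (sides (y # vs)). \<exists>t\<in>set (sides (y # us)). subside s t"
      "polylen (y # us) \<le> d y ?l + 2 * B * (2 * int (length us) - int (length vs))"
      by (elim exE conjE) (rule that)
    have "\<forall>s\<in>set (sides (y # vs)). thin B (x, y) s"
    proof
      fix s assume s: "s \<in> set (sides (y # vs))"
      obtain t where t: "t \<in> set (sides (y # us))" "subside s t" using vs(3) s by blast
      then have "thin B (x, y) t" using Cons.prems by simp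
      then show "thin B (x, y) s" using thin_subside[OF _ subside_refl t(2)] by blast
    qed
    from push_side[OF vs(1) this assms(1)] obtain ws where ws:
      "polylen (x # ws) = d x (last (x # ws))" "last (x # ws) = ?l"
      "\<forall>s\<in>set (sides (x # ws)). subside s (x, y) \<or> (\<exists>t\<in>set (sides (y # vs)). subside s t)"
      "d x y + d y ?l \<le> d x ?l + 2 * B * (int (length vs) + 2 - int (length ws))"
      unfolding vs(2) by (elim exE conjE) (rule that)
    have "\<forall>s\<in>set (sides (x # ws)). \<exists>t\<in>set (sides (x # y # us)). subside s t"
      using ws(3) vs(3) subside_trans by (metis list.set_intros sides.simps(1))
    moreover have "polylen (x # y # us) \<le> d x ?l + 2 * B * (2 * int (length (y # us)) - int (length ws))"
      using ws(4) vs(4) by (simp add: algebra_simps)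
    ultimately show ?case using ws(1,2) by (intro exI[of _ ws]) simp
  qed
  then obtain vs :: "'p list" where "polylen (x # us) \<le> d x (last (x # us)) + 2 * B * (2 * int (length us) - int (length vs))"
    by blast
  moreover have "0 \<le> 2 * B * int (length vs)" using assms(1) by simp
  ultimately show ?thesis by (simp add: algebra_simps)
qed

end

section \<open>Displacement of syllable words\<close>

context tree
begin

lemma thin_short: "d (fst s) (snd s) \<le> B \<Longrightarrow> thin B s t"
proof -
  have *: "d p q \<le> d x y" if "p \<in> seg x y" "q \<in> seg x y" for p q x y
    using seg_dist[OF that] that d_nonneg[of x p] d_nonneg[of x q] d_nonneg[of p y] d_nonneg[of q y]
    unfolding seg_def mem_Collect_eq by linarith
  assume "d (fst s) (snd s) \<le> B"
  then show ?thesis using * unfolding thin_def by (meson IntD1 order_trans)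
qed

lemma thin_commute: "thin B s t \<longleftrightarrow> thin B t s"
  unfolding thin_def by (simp add: Int_commute)

end

context tree_action
begin

section \<open>The polygonal line of a syllable word\<close>

lemma axis_point_exists': "x \<in> carrier G \<Longrightarrow> \<exists>a. axis_point x a"
  using axis_point_exists[of x] by (metis axis_point_def elliptic_def d_self mult_zero_right)

lemma polylen_map: "g \<in> carrier G \<Longrightarrow> polylen (map (act g) us) = polylen us"
  by (induction us rule: polylen.induct) auto

lemma sides_map: "sides (map (act g) us) = map (\<lambda>(x, y). (act g x, act g y)) (sides us)"
  by (induction us rule: sides.induct) auto

lemma thin_map:
  assumes "g \<in> carrier G"
  shows "thin B (act g (fst s), act g (snd s)) (act g (fst t), act g (snd t)) \<longleftrightarrow> thin B s t"
proof -
  have "seg (act g (fst s)) (act g (snd s)) \<inter> seg (act g (fst t)) (act g (snd t)) =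
    act g ` (seg (fst s) (snd s) \<inter> seg (fst t) (snd t))"
    unfolding act_seg_image[OF assms] using assms by (auto simp: image_iff)
  then show ?thesis using assms by (simp add: thin_def)
qed

text \<open>For every syllable the line goes from the base point to the axis, along the axis, and
  back to the translated base point. Only the middle one of these three sides can be long.\<close>

fun path :: "'a \<Rightarrow> 'a \<Rightarrow> (bool \<Rightarrow> 'p) \<Rightarrow> 'p \<Rightarrow> (bool \<times> int) list \<Rightarrow> 'p list" where
  "path c e a z [] = [z]"
| "path c e a z (s # ss) = z # a (fst s) # act (syl c e (fst s) [^] snd s) (a (fst s)) #
     map (act (syl c e (fst s) [^] snd s)) (path c e a z ss)"

lemma path_Cons: "\<exists>us. path c e a z ss = z # us"
  by (cases ss) auto

lemma length_path: "length (path c e a z ss) = 3 * length ss + 1"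
  by (induction ss) auto

lemma last_path:
  assumes "c \<in> carrier G" "e \<in> carrier G"
  shows "last (path c e a z ss) = act (ev c e ss) z"
proof (induction ss)
  case (Cons s ss)
  have "path c e a z ss \<noteq> []" using path_Cons[of c e a z ss] by auto
  then show ?case using Cons assms by (simp add: last_map act_mult)
qed simp

lemma sides_path_Cons:
  "sides (path c e a z (s # ss)) = (z, a (fst s)) #
    (a (fst s), act (syl c e (fst s) [^] snd s) (a (fst s))) #
    (act (syl c e (fst s) [^] snd s) (a (fst s)), act (syl c e (fst s) [^] snd s) z) #
    map (\<lambda>(x, y). (act (syl c e (fst s) [^] snd s) x, act (syl c e (fst s) [^] snd s) y)) (sides (path c e a z ss))"
proof -
  obtain us where "path c e a z ss = z # us" using path_Cons by blast
  then show ?thesis by (simp flip: sides_map)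
qed

lemma sides_path:
  assumes G: "c \<in> carrier G" "e \<in> carrier G" and D: "\<And>b. d z (a b) \<le> D"
    and s: "s \<in> set (sides (path c e a z ss))"
  shows "d (fst s) (snd s) \<le> D \<or>
    (\<exists>us b n vs. ss = us @ (b, n) # vs \<and> s = (act (ev c e us) (a b), act (ev c e us) (act (syl c e b [^] n) (a b))))"
  using s
proof (induction ss arbitrary: s)
  case (Cons t ss)
  let ?x = "syl c e (fst t) [^] snd t"
  have x: "?x \<in> carrier G" using G by simp
  consider "s = (z, a (fst t))" | "s = (a (fst t), act ?x (a (fst t)))" | "s = (act ?x (a (fst t)), act ?x z)"
    | r where "r \<in> set (sides (path c e a z ss))" "s = (act ?x (fst r), act ?x (snd r))"
    using Cons.prems unfolding sides_path_Cons by fastforce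
  then show ?case
  proof cases
    case 1
    then show ?thesis using D by simp
  next
    case 2
    have "t # ss = [] @ (fst t, snd t) # ss" by simp
    moreover have "s = (act (ev c e []) (a (fst t)), act (ev c e []) (act ?x (a (fst t))))" using 2 by simp
    ultimately show ?thesis by blast
  next
    case 3
    then show ?thesis using D x by (simp add: d_commute)
  next
    case 4
    from Cons.IH[OF 4(1)] show ?thesis
    proof
      assume "d (fst r) (snd r) \<le> D"
      then show ?thesis using 4 x by simp
    next
      assume "\<exists>us b n vs. ss = us @ (b, n) # vs \<and> r = (act (ev c e us) (a b), act (ev c e us) (act (syl c e b [^] n) (a b)))"
      then obtain us b n vs where u: "ss = us @ (b, n) # vs"
        "r = (act (ev c e us) (a b), act (ev c e us) (act (syl c e b [^] n) (a b)))" by blast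
      have "t # ss = (t # us) @ (b, n) # vs" using u by simp
      moreover have "s = (act (ev c e (t # us)) (a b), act (ev c e (t # us)) (act (syl c e b [^] n) (a b)))"
        using 4 u G by (simp add: act_mult)
      ultimately show ?thesis by blast
    qed
  qed
qed simp

end

context forest
begin

text \<open>The tree \<open>i\<close> is used only through \<open>alternating_not_commute\<close>;
  the exponents are measured in the tree \<open>j\<close>, where the generator selected by
  \<open>b0\<close> is hyperbolic and its syllables contribute sides of length at least their
  exponents.\<close>

lemma syllable_length_bound:
  assumes i: "i \<in> I" and G: "c \<in> carrier G" "e \<in> carrier G"
    and bd: "\<And>ss. alternating ss \<Longrightarrow> int (length ss) \<le> 4 * d p (act i (ev c e ss) p) + 3"
    and j: "j \<in> I" and b0: "\<And>q. act j (syl c e b0) q \<noteq> q"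
  obtains C where "0 \<le> C" "\<And>ss. alternating ss \<Longrightarrow>
    (\<Sum>s\<leftarrow>ss. if fst s = b0 then \<bar>snd s\<bar> else 0) \<le> d z (act j (ev c e ss) z) + C * int (length ss)"
proof -
  interpret comm_tree_action G d "act j" using action j .
  have sy: "syl c e b \<in> carrier G" for b using G by simp
  \<comment> \<open>A generator that is elliptic in this tree gets a fixed point, and its axis sides
    degenerate to points.\<close>
  obtain a where a: "\<And>b. axis_point (syl c e b) (a b)"
    using axis_point_exists'[OF sy] by metis
  define t where "t b = d (a b) (act j (syl c e b) (a b))" for b
  have t: "0 \<le> t b" for b by (simp add: t_def)
  have t0: "1 \<le> t b0" using b0[of "a b0"] t[of b0] unfolding t_def
    by (metis d_eq_0_iff int_one_le_iff_zero_less order_less_le)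
  define D where "D = d z (a True) + d z (a False)"
  have D: "d z (a b) \<le> D" for b by (cases b) (simp_all add: D_def)
  \<comment> \<open>Large enough to make the connecting sides thin by their length and to apply
    \<open>axes_overlap_commute\<close> to any two axis sides; the factor two covers two sides of
    the same generator.\<close>
  define B where "B = D + 2 * (t True + t False)"
  have B: "D \<le> B" "t b + t b' \<le> B" "0 \<le> B" for b b'
    using t[of True] t[of False] by (cases b; cases b'; simp add: B_def D_def)+
  have thin: "sorted_wrt (thin B) (sides (path c e a z ss))" if "alternating ss" for ss
    using that
  proof (induction ss)
    case (Cons s ss)
    obtain b n where s: "s = (b, n)" by (cases s)
    let ?x = "syl c e b" and ?xn = "syl c e b [^] n"
    have x: "?x \<in> carrier G" "?xn \<in> carrier G" using sy by simp_all
    have short1: "thin B (z, a b) r" for r by (rule thin_short) (use D[of b] B in simp)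
    have short2: "thin B (act j ?xn (a b), act j ?xn z) r" for r
      by (rule thin_short) (use D[of b] B x in \<open>simp add: d_commute\<close>)
    have ax: "thin B (a b, act j ?xn (a b)) (act j ?xn (fst r), act j ?xn (snd r))"
      if r: "r \<in> set (sides (path c e a z ss))" for r
    proof -
      have "(\<exists>us b n vs. ss = us @ (b, n) # vs \<and> r = (act j (ev c e us) (a b), act j (ev c e us) (act j (syl c e b [^] n) (a b))))"
        if "\<not> d (fst r) (snd r) \<le> D" using sides_path[OF G D r] that by blast
      then consider "d (fst r) (snd r) \<le> D" | us b' m vs where "ss = us @ (b', m) # vs"
        "r = (act j (ev c e us) (a b'), act j (ev c e us) (act j (syl c e b' [^] m) (a b')))"
        by blast
      then show ?thesis
      proof cases
        case 1
        then have "thin B (act j ?xn (fst r), act j ?xn (snd r)) (a b, act j ?xn (a b))"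
          by (intro thin_short) (use B x in simp)
        then show ?thesis using thin_commute by blast
      next
        case 2
        let ?g = "ev c e us" and ?y = "syl c e b'"
        define h where "h = ?xn \<otimes> ?g"
        have g: "?g \<in> carrier G" "h \<in> carrier G" "?y \<in> carrier G" using G x by (simp_all add: h_def)
        define y where "y = h \<otimes> ?y \<otimes> inv h"
        have y: "y \<in> carrier G" using g by (simp add: y_def)
        note ay = axis_conj[OF g(3,2) a, folded y_def t_def]
        have r2: "act j ?xn (fst r) = act j h (a b')" "act j ?xn (snd r) = act j (y [^] m) (act j h (a b'))"
        proof -
          show "act j ?xn (fst r) = act j h (a b')" using 2 x g by (simp add: h_def act_mult)
          have "y [^] m = h \<otimes> ?y [^] m \<otimes> inv h" using int_pow_conj g by (simp add: y_def)
          then have "act j (y [^] m) (act j h (a b')) = act j h (act j (?y [^] m) (a b'))"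
            using g by (simp add: act_mult)
          then show "act j ?xn (snd r) = act j (y [^] m) (act j h (a b'))"
            using 2 x g by (simp add: h_def act_mult)
        qed
        show ?thesis
        proof (rule ccontr)
          assume "\<not> ?thesis"
          then obtain p q where
            p: "p \<in> seg (a b) (act j ?xn (a b))" "p \<in> seg (act j h (a b')) (act j (y [^] m) (act j h (a b')))" and
            q: "q \<in> seg (a b) (act j ?xn (a b))" "q \<in> seg (act j h (a b')) (act j (y [^] m) (act j h (a b')))"
            and pq: "\<not> d p q \<le> B"
            unfolding thin_def r2 fst_conv snd_conv by blast
          have "?x \<otimes> y = y \<otimes> ?x"
          proof (rule axes_overlap_commute[OF x(1) y a ay(1), of p 0 n 0 m q])
            show "d (a b) (act j ?x (a b)) + d (act j h (a b')) (act j y (act j h (a b'))) \<le> d p q"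
              using pq B(2)[of b b'] ay(2) by (simp add: t_def)
          qed (use p q in simp_all)
          then have com: "?x \<otimes> (h \<otimes> ?y \<otimes> inv h) = (h \<otimes> ?y \<otimes> inv h) \<otimes> ?x" by (simp add: y_def)
          let ?w = "?g \<otimes> ?y \<otimes> inv ?g"
          have w: "?w \<in> carrier G" using g by simp
          have hw: "h \<otimes> ?y \<otimes> inv h = ?xn \<otimes> ?w \<otimes> inv ?xn"
            using g x by (simp add: h_def inv_mult_group m_assoc)
          \<comment> \<open>The leading power commutes with \<open>?x\<close> and is conjugated
            away, which leaves the conjugate by \<open>?g\<close> treated in
            \<open>alternating_not_commute\<close>.\<close>
          have xx: "?x \<otimes> ?xn = ?xn \<otimes> ?x"
            using int_pow_mult[OF x(1), of 1 n] int_pow_mult[OF x(1), of n 1] x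
            by (simp add: int_pow_1 add.commute)
          have "?xn \<otimes> (?x \<otimes> ?w) \<otimes> inv ?xn = ?x \<otimes> (?xn \<otimes> ?w \<otimes> inv ?xn)"
            using x w xx by (simp flip: m_assoc)
          also have "\<dots> = ?xn \<otimes> ?w \<otimes> inv ?xn \<otimes> ?x" using com hw by simp
          also have "\<dots> = ?xn \<otimes> (?w \<otimes> ?x) \<otimes> inv ?xn"
            using x w commute_inv_left[of ?xn ?x] xx by (simp add: m_assoc)
          finally have "?x \<otimes> ?w = ?w \<otimes> ?x" using x w by simp
          moreover have "alternating ((b, 1) # us @ [(b', 1)])"
            using Cons.prems 2(1) s by (auto simp: alternating_Cons alternating_append hd_append)
          from alternating_not_commute[OF i G bd this] have "?x \<otimes> ?w \<noteq> ?w \<otimes> ?x" .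
          ultimately show False by simp
        qed
      qed
    qed
    have "sorted_wrt (thin B) (map (\<lambda>(x, y). (act j ?xn x, act j ?xn y)) (sides (path c e a z ss)))"
      unfolding sorted_wrt_map using Cons x
      by (auto simp: alternating_Cons thin_map case_prod_unfold)
    moreover have "\<forall>r\<in>set (map (\<lambda>(x, y). (act j ?xn x, act j ?xn y)) (sides (path c e a z ss))).
      thin B (a b, act j ?xn (a b)) r" using ax by force
    moreover have "thin B (a b, act j ?xn (a b)) (act j ?xn (a b), act j ?xn z)"
      using short2 thin_commute by blast
    ultimately show ?case
      unfolding sides_path_Cons s fst_conv snd_conv using short1 short2 by simp
  qed simp
  have len: "(\<Sum>s\<leftarrow>ss. if fst s = b0 then \<bar>snd s\<bar> else 0) \<le> polylen (path c e a z ss)" for ss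
  proof (induction ss)
    case (Cons s ss)
    let ?x = "syl c e (fst s)" and ?xn = "syl c e (fst s) [^] snd s"
    have x: "?xn \<in> carrier G" using sy by simp
    obtain us where us: "path c e a z ss = z # us" using path_Cons by blast
    have m: "d (a (fst s)) (act j ?xn (a (fst s))) = \<bar>snd s\<bar> * t (fst s)"
      using axis_int[OF sy a, of "fst s" 0 "snd s"] by (simp add: t_def)
    have "polylen (path c e a z (s # ss)) = d z (a (fst s)) + \<bar>snd s\<bar> * t (fst s) + d (a (fst s)) z + polylen (path c e a z ss)"
      using polylen_map[OF x, of "path c e a z ss"] x m us by simp
    moreover have "(if fst s = b0 then \<bar>snd s\<bar> else 0) \<le> \<bar>snd s\<bar> * t (fst s)"
      using t0 t[of "fst s"] mult_left_mono[of 1 "t b0" "\<bar>snd s\<bar>"] by auto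
    ultimately show ?case using Cons d_nonneg[of z "a (fst s)"] d_nonneg[of "a (fst s)" z]
      by (simp only: list.map sum_list.Cons)
  qed simp
  show thesis
  \<comment> \<open>Three sides per syllable, each losing at most \<open>4 * B\<close> to
    backtracking.\<close>
  proof (rule that[of "12 * B"])
    show "0 \<le> 12 * B" using B by simp
    fix ss assume alt: "alternating ss"
    obtain us where us: "path c e a z ss = z # us" using path_Cons by blast
    have "int (length us) = 3 * int (length ss)" using length_path[of c e a z ss] us by simp
    then have "polylen (path c e a z ss) \<le> d z (act j (ev c e ss) z) + 12 * B * int (length ss)"
      using polylen_bound[OF B(3), of z us] thin[OF alt] last_path[OF G, of a z ss] us by simp
    then show "(\<Sum>s\<leftarrow>ss. if fst s = b0 then \<bar>snd s\<bar> else 0) \<le> d z (act j (ev c e ss) z) + 12 * B * int (length ss)"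
      using len[of ss] by simp
  qed
qed

text \<open>The syllable count and the exponents of the two generators may be read off in three
  different trees; the sum over \<open>I\<close> dominates all of them.\<close>

theorem undistorted_pair:
  assumes "finite I" and PP: "nielsen_closed PP" "PP \<noteq> {}"
    and nc: "\<And>g h. (g, h) \<in> PP \<Longrightarrow> g \<otimes> h \<noteq> h \<otimes> g"
  obtains c e C where "(c, e) \<in> PP" "0 \<le> C" "\<And>ss. alternating ss \<Longrightarrow>
    (\<Sum>s\<leftarrow>ss. \<bar>snd s\<bar>) \<le> C * ((\<Sum>i\<in>I. d z (act i (ev c e ss) z)) + 1)"
proof -
  obtain g h where gh: "(g, h) \<in> PP" using PP(2) by auto
  then have "g \<noteq> \<one>" using nc[OF gh] nielsen_closedD(2)[OF PP(1) gh] by auto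
  then obtain i where i: "i \<in> I"
    using not_elliptic_somewhere nielsen_closedD(1)[OF PP(1) gh] by blast
  show thesis
  proof (rule syllable_bound[OF i PP nc])
    fix c e p assume ce: "(c, e) \<in> PP"
      and bd: "\<And>ss. alternating ss \<Longrightarrow> int (length ss) \<le> 4 * d p (act i (ev c e ss) p) + 3"
    note G = nielsen_closedD(1,2)[OF PP(1) ce]
    define P where "P b j C \<longleftrightarrow> j \<in> I \<and> 0 \<le> C \<and> (\<forall>ss. alternating ss \<longrightarrow>
      (\<Sum>s\<leftarrow>ss. if fst s = b then \<bar>snd s\<bar> else 0) \<le> d z (act j (ev c e ss) z) + C * int (length ss))"
      for b j C
    have ex: "\<exists>j C. P b j C" for b
    proof -
      have "syl c e b \<noteq> \<one>" using nc[OF ce] G by (auto simp: syl_def)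
      then obtain j a where j: "j \<in> I" "tree_action.axis_point d (act j) (syl c e b) a" "0 < d a (act j (syl c e b) a)"
        using not_elliptic_somewhere[of "syl c e b"] G by auto
      interpret comm_tree_action G d "act j" using action j(1) .
      \<comment> \<open>With a fixed point \<open>q\<close>, powers of the element would move
        \<open>a\<close> by at most \<open>2 * d q a\<close>, which contradicts the positive
        translation length.\<close>
      have nf: "act j (syl c e b) q \<noteq> q" for q
      proof
        assume q: "act j (syl c e b) q = q"
        have *: "d q (act j (syl c e b [^] n) a) = d q a" for n :: int
          using act_int_pow_fixed[of "syl c e b" q n] q G act_d[of "syl c e b [^] n" q a] by simp
        define n where "n = 2 * d q a + 1"
        have "n * d a (act j (syl c e b) a) = d a (act j (syl c e b [^] n) a)"
          using axis_int[OF _ j(2), of 0 n] G by (simp add: n_def)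
        also have "\<dots> \<le> 2 * d q a"
          using triangle[of a "act j (syl c e b [^] n) a" q] *[of n] d_commute[of a q] by simp
        also have "\<dots> < n" by (simp add: n_def)
        finally have "n * d a (act j (syl c e b) a) < n * 1" by simp
        moreover have "0 \<le> n" by (simp add: n_def)
        ultimately show False using mult_left_mono[of 1 "d a (act j (syl c e b) a)" n] j(3) by simp
      qed
      show ?thesis
      proof (rule syllable_length_bound[OF i G bd j(1) nf, where z = z])
        fix C assume "0 \<le> C" "\<And>ss. alternating ss \<Longrightarrow>
          (\<Sum>s\<leftarrow>ss. if fst s = b then \<bar>snd s\<bar> else 0) \<le> d z (act j (ev c e ss) z) + C * int (length ss)"
        then show ?thesis using j(1) unfolding P_def by (intro exI[of _ j] exI[of _ C] conjI allI impI)
      qed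
    qed
    obtain J C where JC: "\<And>b. P b (J b) (C b)" using ex by metis
    have J: "J b \<in> I" and C: "0 \<le> C b" for b using JC[of b] by (simp_all add: P_def)
    have le: "(\<Sum>s\<leftarrow>ss. if fst s = b then \<bar>snd s\<bar> else 0) \<le> d z (act (J b) (ev c e ss) z) + C b * int (length ss)"
      if "alternating ss" for b ss using JC[of b] that by (simp add: P_def)
    define K where "K = C True + C False"
    \<comment> \<open>The term \<open>8 * d z p\<close> comes from moving the base point from
      \<open>p\<close> to \<open>z\<close> in the syllable bound.\<close>
    define E where "E = 2 + K * (8 * d z p + 4)"
    have K: "0 \<le> K" using C[of True] C[of False] by (simp add: K_def)
    have E: "0 \<le> E" "0 \<le> d z p" using K by (simp_all add: E_def)
    show thesis
    proof (rule that[OF ce])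
      show "0 \<le> E" using E by simp
      fix ss assume alt: "alternating ss"
      let ?x = "ev c e ss"
      define S where "S = (\<Sum>i\<in>I. d z (act i ?x z))"
      have S: "d z (act k ?x z) \<le> S" if "k \<in> I" for k
        unfolding S_def using that assms(1) by (intro member_le_sum) simp_all
      have S0: "0 \<le> S" using d_nonneg[of z "act i ?x z"] S[OF i] by linarith
      have x: "?x \<in> carrier G" using G by simp
      interpret comm_tree_action G d "act i" using action i(1) .
      have "d p (act i ?x p) \<le> d z (act i ?x z) + 2 * d z p"
        using triangle[of p "act i ?x p" z] triangle[of z "act i ?x p" "act i ?x z"] x d_commute[of p z] by simp
      then have len: "int (length ss) \<le> 4 * S + 8 * d z p + 3" using bd[OF alt] S[OF i] by simp
      have "(\<Sum>s\<leftarrow>ss. \<bar>snd s\<bar>) = (\<Sum>s\<leftarrow>ss. if fst s = True then \<bar>snd s\<bar> else 0) + (\<Sum>s\<leftarrow>ss. if fst s = False then \<bar>snd s\<bar> else 0)"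
        by (induction ss) auto
      also have "\<dots> \<le> 2 * S + K * int (length ss)"
        using le[OF alt, of True] le[OF alt, of False] S[OF J[of True]] S[OF J[of False]]
        by (simp add: K_def algebra_simps)
      also have "\<dots> \<le> 2 * S + K * (4 * S + 8 * d z p + 3)"
        using mult_left_mono[OF len K] by simp
      also have "\<dots> \<le> E * (S + 1)"
      proof -
        have "0 \<le> K * (d z p * S)" using S0 K E(2) by (intro mult_nonneg_nonneg) auto
        moreover have "E * (S + 1) = 2 * S + K * (4 * S + 8 * d z p + 3) + 8 * (K * (d z p * S)) + K + 2"
          unfolding E_def by (simp only: algebra_simps)
        ultimately show ?thesis using K by linarith
      qed
      finally show "(\<Sum>s\<leftarrow>ss. \<bar>snd s\<bar>) \<le> E * ((\<Sum>i\<in>I. d z (act i (ev c e ss) z)) + 1)" by (simp add: S_def)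
    qed
  qed
qed

end

section \<open>The tree of reduced words\<close>

fun lcp :: "'x list \<Rightarrow> 'x list \<Rightarrow> nat" where
  "lcp (x # xs) (y # ys) = (if x = y then Suc (lcp xs ys) else 0)"
| "lcp xs ys = 0"

lemma lcp_commute: "lcp xs ys = lcp ys xs"
  by (induction xs ys rule: lcp.induct) auto

lemma lcp_le: "lcp xs ys \<le> length xs" "lcp xs ys \<le> length ys"
  by (induction xs ys rule: lcp.induct) auto

lemma lcp_self [simp]: "lcp xs xs = length xs"
  by (induction xs) auto

lemma lcp_min: "min (lcp xs ys) (lcp ys zs) \<le> lcp xs zs"
proof (induction xs zs arbitrary: ys rule: lcp.induct)
  case (1 x xs z zs)
  then show ?case by (cases ys) auto
next
  case ("2_2" v)
  then show ?case by (cases ys) auto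
qed auto

lemma lcp_take: "lcp (take k xs) ys = min k (lcp xs ys)"
proof (induction xs ys arbitrary: k rule: lcp.induct)
  case (1 x xs y ys)
  then show ?case by (cases k) auto
qed auto

lemma lcp_eq_length: "lcp xs ys = length xs \<Longrightarrow> lcp xs ys = length ys \<Longrightarrow> xs = ys"
  by (induction xs ys rule: lcp.induct) (auto split: if_splits)

lemma lcp_map: "inj f \<Longrightarrow> lcp (map f xs) (map f ys) = lcp xs ys"
  by (induction xs ys rule: lcp.induct) (auto dest: injD)

definition reduced :: "('x \<times> bool) list \<Rightarrow> bool" where
  "reduced w \<longleftrightarrow> successively (\<lambda>s t. t \<noteq> (fst s, \<not> snd s)) w"

typedef 'x rword = "{w :: ('x \<times> bool) list. reduced w}"
  by (rule exI[of _ "[]"]) (simp add: reduced_def)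

lemma reduced_rep [simp]: "reduced (Rep_rword p)"
  using Rep_rword by auto

lemma rep_abs [simp]: "reduced w \<Longrightarrow> Rep_rword (Abs_rword w) = w"
  by (simp add: Abs_rword_inverse)

text \<open>The distance in the prefix tree of all words. Prefixes of reduced words are reduced, so
  geodesics between reduced words stay among them, and the result is the Cayley tree of a free
  group.\<close>

definition list_dist :: "'x list \<Rightarrow> 'x list \<Rightarrow> int" where
  "list_dist v w = int (length v) + int (length w) - 2 * int (lcp v w)"

definition rdist :: "'x rword \<Rightarrow> 'x rword \<Rightarrow> int" where
  "rdist p q = list_dist (Rep_rword p) (Rep_rword q)"

lemma reduced_take: "reduced w \<Longrightarrow> reduced (take k w)"
  using successively_append_iff[of _ "take k w" "drop k w"] by (simp add: reduced_def)

interpretation rword: tree "rdist :: 'x rword \<Rightarrow> 'x rword \<Rightarrow> int"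
proof
  fix x y z w :: "'x rword" and i :: int
  let ?x = "Rep_rword x" and ?y = "Rep_rword y" and ?z = "Rep_rword z" and ?w = "Rep_rword w"
  show "rdist x y = 0 \<longleftrightarrow> x = y"
  proof
    assume 0: "rdist x y = 0"
    have "lcp ?x ?y = length ?x" "lcp ?x ?y = length ?y"
      using 0 lcp_le[of ?x ?y] by (simp_all add: rdist_def list_dist_def)
    then have "?x = ?y" by (rule lcp_eq_length)
    then show "x = y" by (simp add: Rep_rword_inject)
  qed (simp add: rdist_def list_dist_def)
  show "rdist x y = rdist y x"
    by (simp add: rdist_def list_dist_def lcp_commute)
  have "min (lcp ?x ?z + lcp ?y ?w) (lcp ?x ?w + lcp ?y ?z) \<le> lcp ?x ?y + lcp ?z ?w"
    using lcp_min[of ?x ?z ?y] lcp_min[of ?x ?w ?y] lcp_min[of ?z ?x ?w] lcp_min[of ?z ?y ?w]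
    unfolding lcp_commute[of ?z ?x] lcp_commute[of ?z ?y] lcp_commute[of ?w ?x] lcp_commute[of ?w ?y]
    by linarith
  then show "rdist x y + rdist z w \<le> max (rdist x z + rdist y w) (rdist x w + rdist y z)"
    unfolding rdist_def list_dist_def by linarith
  show "even (rdist x y + rdist y z + rdist z x)"
    by (simp add: rdist_def list_dist_def)
  show "\<exists>z. rdist x z = i \<and> rdist z y = rdist x y - i" if i: "0 \<le> i" "i \<le> rdist x y"
  proof -
    define l where "l = lcp ?x ?y"
    have l: "l \<le> length ?x" "l \<le> length ?y" using lcp_le[of ?x ?y] by (simp_all add: l_def)
    show ?thesis
    \<comment> \<open>The geodesic descends from \<open>x\<close> to the common prefix and then
      ascends to \<open>y\<close>.\<close>
    proof (cases "i \<le> int (length ?x) - int l")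
      case True
      define k where "k = length ?x - nat i"
      have k: "l \<le> k" "k \<le> length ?x" "int k = int (length ?x) - i" using True i(1) l by (auto simp: k_def)
      have "lcp (take k ?x) ?x = k" "lcp (take k ?x) ?y = l" using k by (simp_all add: lcp_take l_def)
      then show ?thesis using k l_def
        by (intro exI[of _ "Abs_rword (take k ?x)"])
          (simp add: rdist_def list_dist_def reduced_take lcp_commute[of ?x])
    next
      case False
      define k where "k = nat (i - int (length ?x) + 2 * int l)"
      have k: "l \<le> k" "k \<le> length ?y" "int k = i - int (length ?x) + 2 * int l"
        using False i l by (auto simp: k_def rdist_def list_dist_def l_def)
      have "lcp (take k ?y) ?y = k" "lcp (take k ?y) ?x = l" using k by (simp_all add: lcp_take l_def lcp_commute[of ?y ?x])
      then show ?thesis using k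
        by (intro exI[of _ "Abs_rword (take k ?y)"])
          (simp add: rdist_def list_dist_def reduced_take lcp_commute[of ?x] l_def)
    qed
  qed
qed

section \<open>Left multiplication and relabelling of the basis\<close>

definition lmul :: "'x \<times> bool \<Rightarrow> ('x \<times> bool) list \<Rightarrow> ('x \<times> bool) list" where
  "lmul l w = (if w \<noteq> [] \<and> hd w = (fst l, \<not> snd l) then tl w else l # w)"

lemma reduced_Cons: "reduced (l # w) \<longleftrightarrow> reduced w \<and> (w = [] \<or> hd w \<noteq> (fst l, \<not> snd l))"
  by (auto simp: reduced_def successively_Cons)

lemma reduced_lmul: "reduced w \<Longrightarrow> reduced (lmul l w)"
  by (cases w) (auto simp: lmul_def reduced_Cons)

lemma lmul_cancel: "reduced w \<Longrightarrow> lmul (x, \<not> b) (lmul (x, b) w) = w"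
  by (cases w) (auto simp: lmul_def reduced_Cons)

lemma list_dist_lmul:
  assumes "reduced v" "reduced w"
  shows "list_dist (lmul l v) (lmul l w) = list_dist v w"
proof -
  have 0: "lcp v' (l # w') = 0" "lcp (l # w') v' = 0" if "reduced ((fst l, \<not> snd l) # v')" for v' w'
    using that by (cases v'; auto simp: reduced_Cons)+
  show ?thesis
    using assms 0[of "tl v" w] 0[of "tl w" v]
    by (cases v; cases w) (auto simp: lmul_def list_dist_def)
qed

definition rmul :: "'x \<times> bool \<Rightarrow> 'x rword \<Rightarrow> 'x rword" where
  "rmul l p = Abs_rword (lmul l (Rep_rword p))"

definition rmap :: "('x \<Rightarrow> 'x) \<Rightarrow> 'x rword \<Rightarrow> 'x rword" where
  "rmap f p = Abs_rword (map (\<lambda>l. (f (fst l), snd l)) (Rep_rword p))"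

lemma Rep_rmul [simp]: "Rep_rword (rmul l p) = lmul l (Rep_rword p)"
  by (simp add: rmul_def reduced_lmul)

lemma reduced_map: "inj f \<Longrightarrow> reduced w \<Longrightarrow> reduced (map (\<lambda>l. (f (fst l), snd l)) w)"
  unfolding reduced_def successively_map
  by (erule successively_mono) (auto dest: injD simp: prod_eq_iff)

lemma Rep_rmap [simp]: "inj f \<Longrightarrow> Rep_rword (rmap f p) = map (\<lambda>l. (f (fst l), snd l)) (Rep_rword p)"
  by (simp add: rmap_def reduced_map)

lemma rmul_cancel: "rmul (x, \<not> b) (rmul (x, b) p) = p"
  by (rule iffD1[OF Rep_rword_inject]) (simp add: lmul_cancel)

lemma rmap_rmap: "inj f \<Longrightarrow> inj g \<Longrightarrow> rmap f (rmap g p) = rmap (f \<circ> g) p"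
  by (rule iffD1[OF Rep_rword_inject]) (simp add: inj_compose)

lemma rmap_id [simp]: "rmap (\<lambda>x. x) p = p"
  by (rule iffD1[OF Rep_rword_inject]) simp

lemma rmap_rmul:
  assumes "inj f"
  shows "rmap f (rmul l p) = rmul (f (fst l), snd l) (rmap f p)"
proof (rule iffD1[OF Rep_rword_inject])
  have "map (\<lambda>l. (f (fst l), snd l)) (lmul l w) = lmul (f (fst l), snd l) (map (\<lambda>l. (f (fst l), snd l)) w)" for w
    using assms by (cases w) (auto simp: lmul_def prod_eq_iff inj_eq)
  then show "Rep_rword (rmap f (rmul l p)) = Rep_rword (rmul (f (fst l), snd l) (rmap f p))"
    using assms by simp
qed

lemma rdist_rmul [simp]: "rdist (rmul l p) (rmul l q) = rdist p q"
  by (simp add: rdist_def list_dist_lmul)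

lemma rdist_rmap [simp]: "inj f \<Longrightarrow> rdist (rmap f p) (rmap f q) = rdist p q"
proof -
  assume f: "inj f"
  then have "inj (\<lambda>l :: 'a \<times> bool. (f (fst l), snd l))" by (auto simp: inj_def prod_eq_iff)
  with f show ?thesis by (simp add: rdist_def list_dist_def lcp_map)
qed

text \<open>The exponent sum excludes inversions: it has the parity of the word length, and each
  group element will change it by an amount independent of the point.\<close>

definition sign_sum :: "'x rword \<Rightarrow> int" where
  "sign_sum p = (\<Sum>l\<leftarrow>Rep_rword p. if snd l then 1 else - 1)"

lemma sign_sum_rmul: "sign_sum (rmul l p) = sign_sum p + (if snd l then 1 else - 1)"
  by (cases "Rep_rword p") (auto simp: sign_sum_def lmul_def)

lemma sign_sum_rmap [simp]: "inj f \<Longrightarrow> sign_sum (rmap f p) = sign_sum p"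
  by (simp add: sign_sum_def o_def)

lemma even_rdist_iff: "even (rdist p q) \<longleftrightarrow> even (sign_sum p - sign_sum q)"
proof -
  have *: "even (int (length w) - (\<Sum>l\<leftarrow>w. if snd l then 1 else - 1 :: int))" for w :: "('b \<times> bool) list"
    by (induction w) auto
  show ?thesis using *[of "Rep_rword p"] *[of "Rep_rword q"]
    by (auto simp: rdist_def list_dist_def sign_sum_def)
qed

definition rnil :: "'x rword" where
  "rnil = Abs_rword []"

lemma Rep_rnil [simp]: "Rep_rword rnil = []"
  by (simp add: rnil_def reduced_def)

lemma rmap_rnil [simp]: "rmap f rnil = rnil"
  by (simp add: rmap_def) (simp add: rnil_def)

section \<open>Maps out of presented groups\<close>

lemma words_append [simp]: "v @ w \<in> words V \<longleftrightarrow> v \<in> words V \<and> w \<in> words V"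
  by (auto simp: words_def)

lemma words_Nil [simp]: "[] \<in> words V"
  by (simp add: words_def)

lemma words_Cons [simp]: "l # w \<in> words V \<longleftrightarrow> fst l \<in> V \<and> w \<in> words V"
  by (cases l) (auto simp: words_def)

lemma words_filter [simp]: "w \<in> words V \<Longrightarrow> filter P w \<in> words V"
  by (induction w) auto

lemma word_cong_foldr:
  assumes "(v, w) \<in> word_cong V R"
    and cancel: "\<And>x b p. x \<in> V \<Longrightarrow> f (x, b) (f (x, \<not> b) p) = p"
    and rel: "\<And>l r p. (l, r) \<in> R \<Longrightarrow> l \<in> words V \<Longrightarrow> r \<in> words V \<Longrightarrow> foldr f l p = foldr f r p"
  shows "foldr f v p = foldr f w p"
  using assms(1) by (induction arbitrary: p rule: word_cong.induct) (auto simp: cancel rel)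

context
  fixes V :: "'a set" and R :: "('a word \<times> 'a word) set"
begin

interpretation group "presented_group V R"
  by (rule group_presented_group)

lemma word_class_closed [simp]: "w \<in> words V \<Longrightarrow> word_class V R w \<in> carrier (presented_group V R)"
  by (simp add: carrier_presented_group)

lemma inv_word_class:
  assumes "w \<in> words V"
  shows "inv\<^bsub>presented_group V R\<^esub> word_class V R w = word_class V R (word_inv w)"
proof (rule inv_equality)
  show "word_class V R (word_inv w) \<otimes>\<^bsub>presented_group V R\<^esub> word_class V R w = \<one>\<^bsub>presented_group V R\<^esub>"
    using assms word_inv_words[OF assms] word_inv_cancel[OF assms, of R]
    by (simp add: mult_presented_group one_presented_group word_class_eq_iff)
qed (use assms word_inv_words[OF assms] in simp_all)

lemma generate_presented_group:
  "generate (presented_group V R) ((\<lambda>x. word_class V R [(x, True)]) ` V) = carrier (presented_group V R)"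
proof
  let ?S = "(\<lambda>x. word_class V R [(x, True)]) ` V"
  show "generate (presented_group V R) ?S \<subseteq> carrier (presented_group V R)"
    by (rule generate_incl) auto
  have "word_class V R w \<in> generate (presented_group V R) ?S" if "w \<in> words V" for w
    using that
  proof (induction w)
    case Nil
    then show ?case using generate.one[of "presented_group V R"] by (simp add: one_presented_group)
  next
    case (Cons l w)
    obtain x b where l: "l = (x, b)" by (cases l)
    have x: "x \<in> V" "[(x, b)] \<in> words V" "w \<in> words V" using Cons.prems by (simp_all add: l)
    have "word_class V R [(x, b)] \<in> generate (presented_group V R) ?S"
    proof (cases b)
      case True
      then show ?thesis using x by (auto intro: generate.incl)
    next
      case False
      have "inv\<^bsub>presented_group V R\<^esub> word_class V R [(x, True)] = word_class V R [(x, False)]"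
        using inv_word_class[of "[(x, True)]"] x by (simp add: word_inv_def)
      moreover have "inv\<^bsub>presented_group V R\<^esub> word_class V R [(x, True)] \<in> generate (presented_group V R) ?S"
        using x by (intro generate.inv) auto
      ultimately show ?thesis using False by simp
    qed
    from generate.eng[OF this Cons.IH[OF x(3)]] show ?case
      using mult_presented_group[OF x(2,3), of R] by (simp add: l)
  qed
  then show "carrier (presented_group V R) \<subseteq> generate (presented_group V R) ?S"
    by (auto simp: carrier_presented_group)
qed

end

section \<open>Right-angled Artin groups acting on trees\<close>

locale raag_group =
  fixes \<Gamma> :: "'a pair_pre_digraph"
begin

abbreviation "V \<equiv> pverts \<Gamma>"

definition R :: "('a word \<times> 'a word) set" where
  "R = {([(x, True), (y, True)], [(y, True), (x, True)]) | x y. (x, y) \<in> parcs \<Gamma>}"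

abbreviation "A \<equiv> raag \<Gamma>"
abbreviation "cls \<equiv> word_class V R"

sublocale group A
  by (rule group_raag)

lemma raag_eq: "A = presented_group V R"
  by (simp add: raag_def R_def)

lemma cls_closed [simp]: "w \<in> words V \<Longrightarrow> cls w \<in> carrier A"
  by (simp add: raag_eq)

lemma cls_cases:
  assumes "X \<in> carrier A"
  obtains w where "w \<in> words V" "X = cls w"
  using assms by (auto simp: raag_eq carrier_presented_group)

lemma cls_mult: "v \<in> words V \<Longrightarrow> w \<in> words V \<Longrightarrow> cls v \<otimes>\<^bsub>A\<^esub> cls w = cls (v @ w)"
  by (simp add: raag_eq mult_presented_group)

lemma cls_Nil [simp]: "cls [] = \<one>\<^bsub>A\<^esub>"
  by (simp add: raag_eq one_presented_group)

lemma cls_eq_iff: "v \<in> words V \<Longrightarrow> w \<in> words V \<Longrightarrow> cls v = cls w \<longleftrightarrow> (v, w) \<in> word_cong V R"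
  by (rule word_class_eq_iff)

section \<open>Retractions onto sets of vertices\<close>

definition rep :: "'a word set \<Rightarrow> 'a word" where
  "rep X = (SOME w. w \<in> words V \<and> cls w = X)"

lemma rep: "w \<in> words V \<Longrightarrow> rep (cls w) \<in> words V \<and> (rep (cls w), w) \<in> word_cong V R"
  using someI[of "\<lambda>v. v \<in> words V \<and> cls v = cls w" w] cls_eq_iff[of "rep (cls w)" w]
  by (simp add: rep_def)

definition rho :: "'a set \<Rightarrow> 'a word set \<Rightarrow> 'a word set" where
  "rho W X = cls (filter (\<lambda>l. fst l \<in> W) (rep X))"

text \<open>Deleting letters leaves a commutation relation intact or turns it into an equality of
  identical words.\<close>

lemma word_cong_filter:
  assumes "(v, w) \<in> word_cong V R"
  shows "(filter (\<lambda>l. fst l \<in> W) v, filter (\<lambda>l. fst l \<in> W) w) \<in> word_cong V R"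
  using assms
proof (induction rule: word_cong.induct)
  case (refl w)
  then show ?case by (intro word_cong.refl) simp
next
  case (sym v w)
  show ?case by (rule word_cong.sym[OF sym(2)])
next
  case (trans u v w)
  show ?case by (rule word_cong.trans[OF trans(3,4)])
next
  case (app u v u' v')
  then show ?case by (simp add: word_cong.app)
next
  case (cancel x b)
  then show ?case by (auto intro: word_cong.intros)
next
  case (rel l r)
  then obtain x y where "l = [(x, True), (y, True)]" "r = [(y, True), (x, True)]" "(x, y) \<in> parcs \<Gamma>" by (auto simp: R_def)
  with rel show ?case by (auto intro: word_cong.intros)
qed

lemma rho_cls: "w \<in> words V \<Longrightarrow> rho W (cls w) = cls (filter (\<lambda>l. fst l \<in> W) w)"
  using word_cong_filter[of "rep (cls w)" w W] rep[of w] by (simp add: rho_def cls_eq_iff)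

lemma rho_hom: "rho W \<in> hom A A"
proof (rule homI)
  fix X assume "X \<in> carrier A"
  then show "rho W X \<in> carrier A" by (elim cls_cases) (simp add: rho_cls)
next
  fix X Y assume "X \<in> carrier A" "Y \<in> carrier A"
  then show "rho W (X \<otimes>\<^bsub>A\<^esub> Y) = rho W X \<otimes>\<^bsub>A\<^esub> rho W Y"
    by (elim cls_cases) (simp add: rho_cls cls_mult)
qed

lemma rho_closed [simp]: "X \<in> carrier A \<Longrightarrow> rho W X \<in> carrier A"
  using rho_hom by (auto simp: hom_def)

lemma rho_mult: "X \<in> carrier A \<Longrightarrow> Y \<in> carrier A \<Longrightarrow> rho W (X \<otimes>\<^bsub>A\<^esub> Y) = rho W X \<otimes>\<^bsub>A\<^esub> rho W Y"
  using rho_hom by (simp add: hom_def)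

lemma rho_inv: "X \<in> carrier A \<Longrightarrow> rho W (inv\<^bsub>A\<^esub> X) = inv\<^bsub>A\<^esub> rho W X"
  using group_hom.hom_inv[of A A "rho W" X] rho_hom is_group by (simp add: group_hom_def group_hom_axioms_def)

lemma rho_rho:
  assumes "X \<in> carrier A"
  shows "rho W (rho W' X) = rho (W \<inter> W') X"
proof -
  obtain w where "w \<in> words V" "X = cls w" using assms by (rule cls_cases)
  moreover have "filter (\<lambda>l. fst l \<in> W) (filter (\<lambda>l. fst l \<in> W') w) = filter (\<lambda>l. fst l \<in> W \<inter> W') w"
    by (auto intro: filter_cong)
  ultimately show ?thesis by (simp add: rho_cls)
qed

lemma rho_all: "V \<subseteq> W \<Longrightarrow> X \<in> carrier A \<Longrightarrow> rho W X = X"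
proof (elim cls_cases)
  fix w assume "V \<subseteq> W" "w \<in> words V" "X = cls w"
  moreover from this have "filter (\<lambda>l. fst l \<in> W) w = w" by (auto simp: words_def intro!: filter_True)
  ultimately show ?thesis by (simp add: rho_cls)
qed

lemma rho_none:
  assumes "X \<in> carrier A" "W \<inter> V = {}"
  shows "rho W X = \<one>\<^bsub>A\<^esub>"
proof -
  obtain w where w: "w \<in> words V" "X = cls w" using assms(1) by (rule cls_cases)
  moreover have "filter (\<lambda>l. fst l \<in> W) w = []"
    using w(1) assms(2) by (auto simp: words_def filter_empty_conv)
  ultimately show ?thesis by (simp add: rho_cls)
qed

text \<open>The identity outside the carrier makes this a permutation of the whole type.\<close>
definition conj_by :: "'a word set \<Rightarrow> 'a word set \<Rightarrow> 'a word set" where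
  "conj_by g x = (if x \<in> carrier A then g \<otimes>\<^bsub>A\<^esub> x \<otimes>\<^bsub>A\<^esub> inv\<^bsub>A\<^esub> g else x)"

lemma conj_by_mult: "g \<in> carrier A \<Longrightarrow> h \<in> carrier A \<Longrightarrow> conj_by g \<circ> conj_by h = conj_by (g \<otimes>\<^bsub>A\<^esub> h)"
  by (rule ext) (simp add: conj_by_def inv_mult_group m_assoc)

lemma conj_by_one [simp]: "conj_by \<one>\<^bsub>A\<^esub> = (\<lambda>x. x)"
  by (rule ext) (simp add: conj_by_def)

lemma inj_conj_by [simp]:
  assumes "g \<in> carrier A"
  shows "inj (conj_by g)"
proof -
  have "conj_by (inv\<^bsub>A\<^esub> g) \<circ> conj_by g = (\<lambda>x. x)" using assms by (simp add: conj_by_mult)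
  then show ?thesis by (metis (no_types, lifting) comp_apply injI)
qed

text \<open>The Bass-Serre tree of the splitting as an HNN extension with stable letter \<open>v\<close>, seen as the Cayley
  tree of the free group on the conjugates of \<open>v\<close>: the other vertices permute this basis by
  conjugation. Only the subtree spanned by the conjugates of \<open>v\<close> matters, but all group elements are
  allowed as letters, which spares the description of the centralizer of \<open>v\<close>.\<close>
definition act_letter :: "'a \<Rightarrow> 'a \<times> bool \<Rightarrow> 'a word set rword \<Rightarrow> 'a word set rword" where
  "act_letter v l = (if fst l = v then rmul (cls [(v, True)], snd l) else rmap (conj_by (cls [l])))"

definition vact :: "'a \<Rightarrow> 'a word set \<Rightarrow> 'a word set rword \<Rightarrow> 'a word set rword" where
  "vact v X = foldr (act_letter v) (rep X)"

lemma cls_letter_cancel: "x \<in> V \<Longrightarrow> cls [(x, b)] \<otimes>\<^bsub>A\<^esub> cls [(x, \<not> b)] = \<one>\<^bsub>A\<^esub>"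
  using cls_eq_iff[of "[(x, b), (x, \<not> b)]" "[]"] word_cong.cancel[of x V b R] by (simp add: cls_mult)

lemma cls_letter_inv: "x \<in> V \<Longrightarrow> inv\<^bsub>A\<^esub> cls [(x, b)] = cls [(x, \<not> b)]"
  using cls_letter_cancel[of x "\<not> b"] by (simp add: inv_equality)

lemma cls_arc_commute:
  "(x, y) \<in> parcs \<Gamma> \<Longrightarrow> x \<in> V \<Longrightarrow> y \<in> V \<Longrightarrow>
    cls [(x, True)] \<otimes>\<^bsub>A\<^esub> cls [(y, True)] = cls [(y, True)] \<otimes>\<^bsub>A\<^esub> cls [(x, True)]"
proof -
  assume e: "(x, y) \<in> parcs \<Gamma>" "x \<in> V" "y \<in> V"
  then have "([(x, True), (y, True)], [(y, True), (x, True)]) \<in> R" by (auto simp: R_def)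
  from word_cong.rel[OF this, of V] e show ?thesis by (simp add: cls_mult cls_eq_iff)
qed

lemma act_letter_cancel: "x \<in> V \<Longrightarrow> act_letter v (x, b) (act_letter v (x, \<not> b) p) = p"
  using rmul_cancel[of "cls [(v, True)]" "\<not> b" p]
  by (auto simp: act_letter_def rmap_rmap conj_by_mult cls_letter_cancel)

text \<open>Two vertices other than \<open>v\<close> act by commuting conjugations. If one of them
  is \<open>v\<close>, conjugation by the other fixes the basis element of \<open>v\<close>.\<close>

lemma act_letter_commute:
  assumes e: "(x, y) \<in> parcs \<Gamma>" "x \<in> V" "y \<in> V"
  shows "act_letter v (x, True) (act_letter v (y, True) p) = act_letter v (y, True) (act_letter v (x, True) p)"
proof -
  have conj: "conj_by (cls [(x, True)]) (cls [(y, True)]) = cls [(y, True)]"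
    "conj_by (cls [(y, True)]) (cls [(x, True)]) = cls [(x, True)]"
    using cls_arc_commute[OF e] e inv_solve_right[of "cls [(x, True)]" "cls [(x, True)] \<otimes>\<^bsub>A\<^esub> cls [(y, True)]" "cls [(y, True)]"]
      inv_solve_right[of "cls [(y, True)]" "cls [(x, True)] \<otimes>\<^bsub>A\<^esub> cls [(y, True)]" "cls [(x, True)]"]
    by (simp_all add: conj_by_def)
  show ?thesis
    using e conj cls_arc_commute[OF e]
    by (auto simp: act_letter_def rmap_rmap conj_by_mult rmap_rmul)
qed

lemma vact_cls:
  assumes w: "w \<in> words V"
  shows "vact v (cls w) p = foldr (act_letter v) w p"
  unfolding vact_def
  by (rule word_cong_foldr[OF conjunct2[OF rep[OF w]]]) (auto simp: act_letter_cancel R_def intro: act_letter_commute)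

lemma vact_mult: "X \<in> carrier A \<Longrightarrow> Y \<in> carrier A \<Longrightarrow> vact v (X \<otimes>\<^bsub>A\<^esub> Y) p = vact v X (vact v Y p)"
  by (elim cls_cases) (simp add: cls_mult vact_cls)

lemma vact_one [simp]: "vact v \<one>\<^bsub>A\<^esub> p = p"
  using vact_cls[of "[]" v p] by simp

lemma rdist_vact: "X \<in> carrier A \<Longrightarrow> rdist (vact v X p) (vact v X q) = rdist p q"
proof (elim cls_cases)
  fix w assume "w \<in> words V" "X = cls w"
  moreover from this(1) have "rdist (foldr (act_letter v) w p) (foldr (act_letter v) w q) = rdist p q"
    by (induction w) (auto simp: act_letter_def)
  ultimately show ?thesis by (simp add: vact_cls)
qed

lemma sign_sum_vact: "X \<in> carrier A \<Longrightarrow> \<exists>k. \<forall>p. sign_sum (vact v X p) = sign_sum p + k"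
proof (elim cls_cases)
  fix w assume "w \<in> words V" "X = cls w"
  moreover from this(1) have "\<exists>k. \<forall>p. sign_sum (foldr (act_letter v) w p) = sign_sum p + k"
  proof (induction w)
    case (Cons l w)
    then obtain k where k: "\<forall>p. sign_sum (foldr (act_letter v) w p) = sign_sum p + k" by auto
    have l: "cls [l] \<in> carrier A" using Cons.prems by simp
    have "sign_sum (act_letter v l q) = sign_sum q + (if fst l = v then if snd l then 1 else - 1 else 0)" for q
      using l by (simp add: act_letter_def sign_sum_rmul)
    then show ?case using k by (simp add: add.assoc)
  qed (rule exI[of _ 0], simp)
  ultimately show ?thesis by (simp add: vact_cls)
qed

lemma vact_no_inversion:
  assumes "X \<in> carrier A" "vact v X (vact v X p) = p"
  shows "even (rdist p (vact v X p))"
proof -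
  obtain k where k: "\<And>p. sign_sum (vact v X p) = sign_sum p + k" using sign_sum_vact assms(1) by blast
  have "sign_sum p = sign_sum p + k + k" using k[of p] k[of "vact v X p"] assms(2) by simp
  then show ?thesis using k[of p] by (simp add: even_rdist_iff)
qed

text \<open>Letters outside the carrier are unchanged by \<open>conj_by\<close>; their default value
  \<open>\<one>\<close> is fixed by conjugation, so evaluation remains equivariant.\<close>

definition letter_val :: "'a word set \<times> bool \<Rightarrow> 'a word set" where
  "letter_val l = (if fst l \<in> carrier A then if snd l then fst l else inv\<^bsub>A\<^esub> fst l else \<one>\<^bsub>A\<^esub>)"

definition val :: "'a word set rword \<Rightarrow> 'a word set" where
  "val p = foldr (\<lambda>l y. letter_val l \<otimes>\<^bsub>A\<^esub> y) (Rep_rword p) \<one>\<^bsub>A\<^esub>"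

lemma letter_val_closed [simp]: "letter_val l \<in> carrier A"
  by (simp add: letter_val_def)

lemma foldr_letter_val_closed [simp]: "foldr (\<lambda>l y. letter_val l \<otimes>\<^bsub>A\<^esub> y) w \<one>\<^bsub>A\<^esub> \<in> carrier A"
  by (induction w) auto

lemma val_closed [simp]: "val p \<in> carrier A"
  by (simp add: val_def)

lemma val_rmul: "val (rmul l p) = letter_val l \<otimes>\<^bsub>A\<^esub> val p"
proof (cases "Rep_rword p")
  case (Cons m w)
  have "letter_val l \<otimes>\<^bsub>A\<^esub> (letter_val (fst l, \<not> snd l) \<otimes>\<^bsub>A\<^esub> y) = y" if "y \<in> carrier A" for y
    using that by (auto simp: letter_val_def simp flip: m_assoc)
  then show ?thesis using Cons by (simp add: val_def lmul_def)
qed (simp add: val_def lmul_def)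

lemma val_rmap_conj:
  assumes g: "g \<in> carrier A"
  shows "val (rmap (conj_by g) p) = g \<otimes>\<^bsub>A\<^esub> val p \<otimes>\<^bsub>A\<^esub> inv\<^bsub>A\<^esub> g"
proof -
  have l: "letter_val (conj_by g x, b) = g \<otimes>\<^bsub>A\<^esub> letter_val (x, b) \<otimes>\<^bsub>A\<^esub> inv\<^bsub>A\<^esub> g" for x b
    using g by (simp add: letter_val_def conj_by_def inv_mult_group m_assoc)
  have "foldr (\<lambda>l y. letter_val l \<otimes>\<^bsub>A\<^esub> y) (map (\<lambda>l. (conj_by g (fst l), snd l)) w) \<one>\<^bsub>A\<^esub> =
    g \<otimes>\<^bsub>A\<^esub> foldr (\<lambda>l y. letter_val l \<otimes>\<^bsub>A\<^esub> y) w \<one>\<^bsub>A\<^esub> \<otimes>\<^bsub>A\<^esub> inv\<^bsub>A\<^esub> g" for w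
  proof (induction w)
    case (Cons l w)
    let ?y = "foldr (\<lambda>l y. letter_val l \<otimes>\<^bsub>A\<^esub> y) w \<one>\<^bsub>A\<^esub>"
    have y: "?y \<in> carrier A" by simp
    have "inv\<^bsub>A\<^esub> g \<otimes>\<^bsub>A\<^esub> (g \<otimes>\<^bsub>A\<^esub> z) = z" if "z \<in> carrier A" for z
      using g that by (simp flip: m_assoc)
    then show ?case using Cons g y l[of "fst l" "snd l"] by (simp add: m_assoc)
  qed (use g in simp)
  then show ?thesis using g by (simp add: val_def)
qed

text \<open>Evaluation in the group is equivariant for a twisted action. Hence an element fixing a point is
  conjugate to its image under the retraction that kills \<open>v\<close>.\<close>
lemma val_vact:
  assumes "X \<in> carrier A"
  shows "val (vact v X p) = X \<otimes>\<^bsub>A\<^esub> val p \<otimes>\<^bsub>A\<^esub> inv\<^bsub>A\<^esub> rho (- {v}) X"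
proof -
  obtain w where w: "w \<in> words V" "X = cls w" using assms by (rule cls_cases)
  have "val (foldr (act_letter v) w p) = cls w \<otimes>\<^bsub>A\<^esub> val p \<otimes>\<^bsub>A\<^esub> inv\<^bsub>A\<^esub> cls (filter (\<lambda>l. fst l \<in> - {v}) w)"
    using w(1)
  proof (induction w)
    case (Cons l w)
    then have l: "[l] \<in> words V" "w \<in> words V" by simp_all
    let ?f = "cls (filter (\<lambda>l. fst l \<in> - {v}) w)"
    have c: "cls [l] \<in> carrier A" "cls w \<in> carrier A" "?f \<in> carrier A" using l by simp_all
    have lw: "cls (l # w) = cls [l] \<otimes>\<^bsub>A\<^esub> cls w" using l by (simp add: cls_mult)
    show ?case
    proof (cases "fst l = v")
      case True
      then have "letter_val (cls [(v, True)], snd l) = cls [l]"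
        using l cls_letter_inv[of v True] by (cases l) (auto simp: letter_val_def)
      then show ?thesis using Cons.IH[OF l(2)] True c by (simp add: act_letter_def val_rmul lw m_assoc)
    next
      case False
      have "cls (l # filter (\<lambda>l. fst l \<in> - {v}) w) = cls [l] \<otimes>\<^bsub>A\<^esub> ?f" using l by (simp add: cls_mult)
      then show ?thesis using Cons.IH[OF l(2)] False c
        by (simp add: act_letter_def val_rmap_conj lw m_assoc inv_mult_group)
    qed
  qed simp
  then show ?thesis using w by (simp add: vact_cls rho_cls)
qed

lemma vact_fixed_conj:
  assumes X: "X \<in> carrier A" and "vact v X p = p"
  shows "X = val p \<otimes>\<^bsub>A\<^esub> rho (- {v}) X \<otimes>\<^bsub>A\<^esub> inv\<^bsub>A\<^esub> val p"
proof -
  have "val p = X \<otimes>\<^bsub>A\<^esub> val p \<otimes>\<^bsub>A\<^esub> inv\<^bsub>A\<^esub> rho (- {v}) X" using val_vact[OF X, of v p] assms(2) by simp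
  then have "val p \<otimes>\<^bsub>A\<^esub> rho (- {v}) X = X \<otimes>\<^bsub>A\<^esub> val p" using X by (metis inv_solve_right m_closed rho_closed val_closed)
  then show ?thesis using X by (metis inv_solve_right m_closed rho_closed val_closed)
qed

text \<open>No letter \<open>v\<close> occurs in the retract, and relabelling fixes the empty word.
  So the tree of a vertex outside \<open>W\<close> imposes no condition on that retract.\<close>

lemma vact_rnil:
  assumes "X \<in> carrier A" "v \<notin> W"
  shows "vact v (rho W X) rnil = rnil"
proof -
  obtain w where w: "w \<in> words V" "X = cls w" using assms by (elim cls_cases)
  have "foldr (act_letter v) (filter (\<lambda>l. fst l \<in> W) w) rnil = rnil"
    using assms(2) by (induction w) (auto simp: act_letter_def)
  then show ?thesis using w by (simp add: rho_cls vact_cls)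
qed

text \<open>Vertices are killed one by one. Applying \<open>rho (- {v})\<close> to the conjugacy
  already obtained for \<open>S\<close>, and using that \<open>X\<close> is conjugate to
  \<open>rho (- {v}) X\<close>, gives the conjugacy for \<open>insert v S\<close>.\<close>

lemma eq_one_of_all_elliptic:
  assumes "finite V" and X: "X \<in> carrier A" and ell: "\<And>v. v \<in> V \<Longrightarrow> \<exists>p. vact v X p = p"
  shows "X = \<one>\<^bsub>A\<^esub>"
proof -
  have "\<exists>g\<in>carrier A. X = g \<otimes>\<^bsub>A\<^esub> rho (- S) X \<otimes>\<^bsub>A\<^esub> inv\<^bsub>A\<^esub> g" if "finite S" "S \<subseteq> V" for S
    using that
  proof (induction S)
    case empty
    show ?case by (rule bexI[of _ "\<one>\<^bsub>A\<^esub>"]) (use X in \<open>simp_all add: rho_all\<close>)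
  next
    case (insert v S)
    then obtain g where g: "g \<in> carrier A" "X = g \<otimes>\<^bsub>A\<^esub> rho (- S) X \<otimes>\<^bsub>A\<^esub> inv\<^bsub>A\<^esub> g" by auto
    obtain p where p: "vact v X p = p" using ell insert.prems by auto
    let ?h = "val p"
    have X1: "X = ?h \<otimes>\<^bsub>A\<^esub> rho (- {v}) X \<otimes>\<^bsub>A\<^esub> inv\<^bsub>A\<^esub> ?h" using vact_fixed_conj[OF X p] .
    have "- {v} \<inter> - S = - insert v S" by auto
    then have "rho (- {v}) (rho (- S) X) = rho (- insert v S) X" using rho_rho[OF X] by simp
    then have X2: "rho (- {v}) X = rho (- {v}) g \<otimes>\<^bsub>A\<^esub> rho (- insert v S) X \<otimes>\<^bsub>A\<^esub> inv\<^bsub>A\<^esub> rho (- {v}) g"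
      using arg_cong[OF g(2), of "rho (- {v})"] g(1) X by (simp add: rho_mult rho_inv)
    let ?k = "?h \<otimes>\<^bsub>A\<^esub> rho (- {v}) g"
    have "X = ?h \<otimes>\<^bsub>A\<^esub> (rho (- {v}) g \<otimes>\<^bsub>A\<^esub> rho (- insert v S) X \<otimes>\<^bsub>A\<^esub> inv\<^bsub>A\<^esub> rho (- {v}) g) \<otimes>\<^bsub>A\<^esub> inv\<^bsub>A\<^esub> ?h"
      using X1 unfolding X2 .
    also have "\<dots> = ?k \<otimes>\<^bsub>A\<^esub> rho (- insert v S) X \<otimes>\<^bsub>A\<^esub> inv\<^bsub>A\<^esub> ?k"
      using X g(1) by (simp add: m_assoc inv_mult_group)
    finally show ?case using g(1) by (intro bexI[of _ ?k]) simp_all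
  qed
  from this[OF assms(1) subset_refl] obtain g where "g \<in> carrier A" "X = g \<otimes>\<^bsub>A\<^esub> rho (- V) X \<otimes>\<^bsub>A\<^esub> inv\<^bsub>A\<^esub> g" by blast
  then show ?thesis using rho_none[OF X, of "- V"] by simp
qed

end

section \<open>Undistorted two-generator subgroups\<close>

fun cons_syl :: "bool \<times> int \<Rightarrow> (bool \<times> int) list \<Rightarrow> (bool \<times> int) list" where
  "cons_syl s [] = (if snd s = 0 then [] else [s])"
| "cons_syl s (t # ss) = (if snd s = 0 then t # ss else if fst s \<noteq> fst t then s # t # ss
     else if snd s + snd t = 0 then ss else (fst s, snd s + snd t) # ss)"

lemma alternating_cons_syl: "alternating ss \<Longrightarrow> alternating (cons_syl s ss)"
  by (cases ss) (auto simp: alternating_Cons)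

context group
begin

lemma ev_cons_syl:
  assumes "c \<in> carrier G" "e \<in> carrier G"
  shows "ev c e (cons_syl s ss) = ev c e (s # ss)"
proof (cases ss)
  case (Cons t ts)
  have "syl c e (fst s) [^] snd s \<otimes> (syl c e (fst s) [^] snd t \<otimes> ev c e ts) =
    syl c e (fst s) [^] (snd s + snd t) \<otimes> ev c e ts"
    using assms by (simp add: int_pow_mult m_assoc)
  then show ?thesis using assms Cons by auto
qed (use assms in simp)

lemma ex_alternating:
  assumes G: "c \<in> carrier G" "e \<in> carrier G" and x: "x \<in> generate G {c, e}"
  obtains ss where "alternating ss" "ev c e ss = x"
proof -
  have 1: "\<exists>ss. ev c e ss = x"
    using x
  proof (induction rule: generate.induct)
    case one
    show ?case by (rule exI[of _ "[]"]) simp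
  next
    case (incl h)
    then show ?case using G
      by (intro exI[of _ "[(h = c, 1)]"]) (auto simp: syl_def int_pow_1)
  next
    case (inv h)
    then show ?case using G
      by (intro exI[of _ "[(h = c, - 1)]"]) (auto simp: syl_def int_pow_neg int_pow_1)
  next
    case (eng h1 h2)
    then show ?case using ev_append[OF G] by metis
  qed
  have 2: "\<exists>ts. alternating ts \<and> ev c e ts = ev c e ss" for ss
  proof (induction ss)
    case (Cons s ss)
    then obtain ts where "alternating ts" "ev c e ts = ev c e ss" by auto
    then show ?case using ev_cons_syl[OF G, of s ts]
      by (intro exI[of _ "cons_syl s ts"]) (simp add: alternating_cons_syl)
  qed (rule exI[of _ "[]"], simp)
  show thesis using 1 2 that by metis
qed

lemma generate_eq_carrier:
  assumes "generate G S = carrier G" "S \<subseteq> generate G S'" "S' \<subseteq> carrier G"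
  shows "generate G S' = carrier G"
  using generate_subgroup_incl[OF assms(2) generate_is_subgroup[OF assms(3)]] generate_incl[OF assms(3)] assms(1) by auto

text \<open>Used for two functions: the word length of images under \<open>\<phi>\<close>, which
  gives the upper bound of the embedding, and \<open>tree_length\<close>, which bounds word length
  in the Artin group from below.\<close>

lemma subadditive_le_word_length:
  fixes g :: "'a \<Rightarrow> int"
  assumes S: "finite_generating_set G S" and x: "x \<in> carrier G"
    and pos: "\<And>x. 0 \<le> g x" and one: "g \<one> = 0"
    and mult: "\<And>x y. x \<in> carrier G \<Longrightarrow> y \<in> carrier G \<Longrightarrow> g (x \<otimes> y) \<le> g x + g y"
    and inv: "\<And>x. x \<in> carrier G \<Longrightarrow> g (inv x) \<le> g x"
  shows "g x \<le> sum g S * int (word_length G S x)"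
proof -
  have SG: "S \<subseteq> carrier G" "finite S" using S by (simp_all add: finite_generating_set_def)
  obtain ss where ss: "ss \<in> sym_words S" "list_prod ss = x" "length ss = word_length G S x"
    using word_length_attained[OF S x] .
  have gs: "g s \<le> sum g S" if "s \<in> S" for s
    using that SG(2) pos by (intro member_le_sum) simp_all
  have "g (list_prod ss) \<le> sum g S * int (length ss)"
    using ss(1)
  proof (induction ss)
    case (Cons s ss)
    then have s: "s \<in> S \<union> (\<lambda>s. inv s) ` S" and ss: "ss \<in> sym_words S" by (auto simp: sym_words_def)
    have "s \<in> carrier G" using s SG by auto
    moreover have "g s \<le> sum g S"
    proof (cases "s \<in> S")
      case False
      then obtain t where t: "t \<in> S" "s = inv t" using s by auto
      then have "g s \<le> g t" using inv[of t] SG(1) by auto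
      then show ?thesis using gs[OF t(1)] by simp
    qed (rule gs)
    moreover have "list_prod ss \<in> carrier G" using list_prod_closed sym_words_carrier[OF SG(1) ss] by blast
    ultimately show ?case using Cons.IH[OF ss] mult[of s "list_prod ss"] by (simp add: algebra_simps)
  qed (simp add: one)
  then show ?thesis using ss by simp
qed

lemma word_length_one: "word_length G S \<one> = 0"
  using word_length_le[of "[]" S] by (simp add: sym_words_def)

lemma word_length_int_pow_le:
  fixes n :: int
  assumes S: "finite_generating_set G S" and x: "x \<in> carrier G"
  shows "int (word_length G S (x [^] n)) \<le> \<bar>n\<bar> * int (word_length G S x)"
proof -
  have *: "word_length G S (x [^] k) \<le> k * word_length G S x" for k :: nat
  proof (induction k)
    case (Suc k)
    then show ?case using word_length_mult_le[OF S, of "x [^] k" x] x by simp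
  qed (simp add: word_length_one)
  show ?thesis
  proof (cases n)
    case (nonneg k)
    then show ?thesis using *[of k] by (simp add: int_pow_int flip: of_nat_mult)
  next
    case (neg k)
    have "word_length G S (x [^] n) \<le> word_length G S (x [^] Suc k)"
      unfolding neg int_pow_neg_int[OF x] using word_length_inv_le[OF S, of "x [^] Suc k"] x by simp
    also have "\<dots> \<le> Suc k * word_length G S x" by (rule *)
    finally have "int (word_length G S (x [^] n)) \<le> int (Suc k) * int (word_length G S x)"
      by (simp only: of_nat_le_iff flip: of_nat_mult)
    then show ?thesis using neg by (simp add: add.commute)
  qed
qed

lemma word_length_ev_le:
  assumes S: "finite_generating_set G S" and G: "c \<in> carrier G" "e \<in> carrier G"
  shows "int (word_length G S (ev c e ss)) \<le> (int (word_length G S c) + int (word_length G S e)) * (\<Sum>s\<leftarrow>ss. \<bar>snd s\<bar>)"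
proof (induction ss)
  case (Cons s ss)
  let ?M = "int (word_length G S c) + int (word_length G S e)"
  let ?x = "syl c e (fst s)"
  have "int (word_length G S (?x [^] snd s)) \<le> \<bar>snd s\<bar> * int (word_length G S ?x)"
    by (rule word_length_int_pow_le[OF S]) (use G in simp)
  also have "\<dots> \<le> \<bar>snd s\<bar> * ?M" by (intro mult_left_mono) (auto simp: syl_def)
  finally show ?case
    using Cons word_length_mult_le[OF S, of "?x [^] snd s" "ev c e ss"] G by (simp add: algebra_simps)
qed (simp add: word_length_one)

end

lemma (in group_hom) commute_generate:
  assumes S: "S \<subseteq> carrier G"
    and com: "\<And>s t. s \<in> S \<Longrightarrow> t \<in> S \<Longrightarrow> h s \<otimes>\<^bsub>H\<^esub> h t = h t \<otimes>\<^bsub>H\<^esub> h s"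
    and x: "x \<in> generate G S" and y: "y \<in> generate G S"
  shows "h x \<otimes>\<^bsub>H\<^esub> h y = h y \<otimes>\<^bsub>H\<^esub> h x"
proof -
  have gen: "z \<in> carrier G" if "z \<in> generate G S" for z using G.generate_incl[OF S] that by blast
  have *: "h x \<otimes>\<^bsub>H\<^esub> z = z \<otimes>\<^bsub>H\<^esub> h x"
    if z: "z \<in> carrier H" "\<And>s. s \<in> S \<Longrightarrow> h s \<otimes>\<^bsub>H\<^esub> z = z \<otimes>\<^bsub>H\<^esub> h s" and x: "x \<in> generate G S" for x z
    using x
  proof (induction rule: generate.induct)
    case (inv s)
    then have "s \<in> carrier G" using S by auto
    then show ?case using H.commute_inv_left[of "h s" z] z inv by simp
  next
    case (eng x1 x2)
    have c: "x1 \<in> carrier G" "x2 \<in> carrier G" using eng gen by auto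
    have "h (x1 \<otimes> x2) \<otimes>\<^bsub>H\<^esub> z = h x1 \<otimes>\<^bsub>H\<^esub> (h x2 \<otimes>\<^bsub>H\<^esub> z)" using c z(1) by (simp add: H.m_assoc)
    also have "\<dots> = h x1 \<otimes>\<^bsub>H\<^esub> (z \<otimes>\<^bsub>H\<^esub> h x2)" using eng by simp
    also have "\<dots> = (h x1 \<otimes>\<^bsub>H\<^esub> z) \<otimes>\<^bsub>H\<^esub> h x2" using c z(1) by (simp only: H.m_assoc hom_closed)
    also have "\<dots> = (z \<otimes>\<^bsub>H\<^esub> h x1) \<otimes>\<^bsub>H\<^esub> h x2" using eng by simp
    also have "\<dots> = z \<otimes>\<^bsub>H\<^esub> h (x1 \<otimes> x2)" using c z(1) by (simp add: H.m_assoc)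
    finally show ?case .
  qed (use z in auto)
  have "h s \<otimes>\<^bsub>H\<^esub> h y = h y \<otimes>\<^bsub>H\<^esub> h s" if "s \<in> S" for s
    using *[OF _ _ y, of "h s"] com S that by (metis hom_closed subsetD)
  then show ?thesis using *[OF _ _ x, of "h y"] gen[OF y] by simp
qed

section \<open>Total displacement in the trees\<close>

context raag_group
begin

definition tree_length :: "'a set \<Rightarrow> 'a word set \<Rightarrow> int" where
  "tree_length W X = (\<Sum>v\<in>W. rdist rnil (vact v (rho W X) rnil))"

lemma tree_length_nonneg: "0 \<le> tree_length W X"
  unfolding tree_length_def by (intro sum_nonneg) simp

lemma tree_length_one: "tree_length W \<one>\<^bsub>A\<^esub> = 0"
  using rho_cls[of "[]" W] by (simp add: tree_length_def)

lemma tree_length_mult: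
  assumes "X \<in> carrier A" "Y \<in> carrier A"
  shows "tree_length W (X \<otimes>\<^bsub>A\<^esub> Y) \<le> tree_length W X + tree_length W Y"
proof -
  have "rdist rnil (vact v (rho W (X \<otimes>\<^bsub>A\<^esub> Y)) rnil) \<le> rdist rnil (vact v (rho W X) rnil) + rdist rnil (vact v (rho W Y) rnil)" for v
    using rword.triangle[of rnil "vact v (rho W X) (vact v (rho W Y) rnil)" "vact v (rho W X) rnil"] assms
    by (simp add: rho_mult vact_mult rdist_vact)
  then show ?thesis unfolding tree_length_def sum.distrib[symmetric] by (intro sum_mono)
qed

lemma tree_length_inv:
  assumes "X \<in> carrier A"
  shows "tree_length W (inv\<^bsub>A\<^esub> X) \<le> tree_length W X"
proof -
  have "rdist rnil (vact v (inv\<^bsub>A\<^esub> rho W X) rnil) = rdist rnil (vact v (rho W X) rnil)" for v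
    using rdist_vact[of "rho W X" v rnil "vact v (inv\<^bsub>A\<^esub> rho W X) rnil"] assms
      rword.d_commute[of "vact v (rho W X) rnil" rnil]
    by (simp flip: vact_mult)
  then show ?thesis using assms by (simp add: tree_length_def rho_inv)
qed

lemma two_generator_lower_bound:
  assumes fin: "finite V" and F: "group F" and phi: "\<phi> \<in> hom F A"
    and ab: "a \<in> carrier F" "b \<in> carrier F" "generate F {a, b} = carrier F"
    and nc: "\<phi> a \<otimes>\<^bsub>A\<^esub> \<phi> b \<noteq> \<phi> b \<otimes>\<^bsub>A\<^esub> \<phi> a"
  obtains c e W C where "c \<in> carrier F" "e \<in> carrier F" "generate F {c, e} = carrier F" "0 \<le> C"
    "\<forall>ss. alternating ss \<longrightarrow> (\<Sum>s\<leftarrow>ss. \<bar>snd s\<bar>) \<le> C * (tree_length W (\<phi> (group.ev F c e ss)) + 1)"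
proof -
  interpret F: group F by (rule F)
  have phic [simp]: "\<phi> x \<in> carrier A" if "x \<in> carrier F" for x using phi that by (auto simp: hom_def)
  define com where "com W \<longleftrightarrow> rho W (\<phi> a) \<otimes>\<^bsub>A\<^esub> rho W (\<phi> b) = rho W (\<phi> b) \<otimes>\<^bsub>A\<^esub> rho W (\<phi> a)" for W
  \<comment> \<open>All vertices together form a set for which the images do not commute, so there
    is one of least cardinality. Only deletions of single vertices from it are considered.\<close>
  have "\<not> com V" using nc ab by (simp add: com_def rho_all)
  then obtain W where W: "W \<subseteq> V" "\<not> com W" and min: "\<And>W'. W' \<subseteq> V \<Longrightarrow> \<not> com W' \<Longrightarrow> card W \<le> card W'"
    using ex_has_least_nat[of "\<lambda>W. W \<subseteq> V \<and> \<not> com W" V card] by auto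
  have finW: "finite W" using W(1) fin finite_subset by blast
  define \<psi> where "\<psi> = rho W \<circ> \<phi>"
  have psi: "\<psi> \<in> hom F A" unfolding \<psi>_def by (rule Group.hom_compose[OF phi rho_hom])
  interpret psi: group_hom F A \<psi> by unfold_locales (rule psi)
  define H where "H = \<psi> ` carrier F"
  have H: "subgroup H A" unfolding H_def by (rule psi.img_is_subgroup)
  define G where "G = A\<lparr>carrier := H\<rparr>"
  have G: "carrier G = H" "monoid.mult G = monoid.mult A" "monoid.one G = monoid.one A" by (simp_all add: G_def)
  have HA: "H \<subseteq> carrier A" using subgroup.subset[OF H] .
  have grpG: "group G" unfolding G_def by (rule subgroup.subgroup_is_group[OF H is_group])
  have invG: "inv\<^bsub>G\<^esub> x = inv\<^bsub>A\<^esub> x" if "x \<in> H" for x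
    unfolding G_def using m_inv_consistent[OF H that] .
  have abelian: "rho (- {v}) (x \<otimes>\<^bsub>A\<^esub> y) = rho (- {v}) (y \<otimes>\<^bsub>A\<^esub> x)" if v: "v \<in> W" and xy: "x \<in> H" "y \<in> H" for v x y
  proof -
    have "com (W - {v})"
      using min[of "W - {v}"] W(1) v finW card_Diff1_less[OF finW v] by auto
    interpret th: group_hom F A "rho (W - {v}) \<circ> \<phi>"
      by unfold_locales (rule Group.hom_compose[OF phi rho_hom])
    obtain x' y' where x': "x' \<in> carrier F" "x = rho W (\<phi> x')" and y': "y' \<in> carrier F" "y = rho W (\<phi> y')"
      using xy by (auto simp: H_def \<psi>_def)
    have "(rho (W - {v}) \<circ> \<phi>) x' \<otimes>\<^bsub>A\<^esub> (rho (W - {v}) \<circ> \<phi>) y' =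
      (rho (W - {v}) \<circ> \<phi>) y' \<otimes>\<^bsub>A\<^esub> (rho (W - {v}) \<circ> \<phi>) x'"
      by (rule th.commute_generate[of "{a, b}"]) (use \<open>com (W - {v})\<close> ab x' y' in \<open>auto simp: com_def\<close>)
    moreover have "- {v} \<inter> W = W - {v}" by auto
    \<comment> \<open>On elements of \<open>H\<close>, killing \<open>v\<close> is the same as
      retracting onto \<open>W - {v}\<close>, where the image is abelian because its two generators
      commute.\<close>
    ultimately show ?thesis using x' y' by (simp add: rho_mult rho_rho)
  qed
  have tree_act: "comm_tree_action G rdist (vact v)" if v: "v \<in> W" for v
  proof -
    interpret G: group G by (rule grpG)
    show ?thesis
    proof
      fix x y p q
      assume x: "x \<in> carrier G"
      then have xA: "x \<in> carrier A" using HA G by auto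
      show "rdist (vact v x p) (vact v x q) = rdist p q" by (rule rdist_vact[OF xA])
      show "even (rdist p (vact v x p))" if "vact v x (vact v x p) = p"
        by (rule vact_no_inversion[OF xA that])
      assume y: "y \<in> carrier G"
      then have yA: "y \<in> carrier A" using HA G by auto
      show "vact v (x \<otimes>\<^bsub>G\<^esub> y) p = vact v x (vact v y p)" using xA yA by (simp add: G vact_mult)
      assume "vact v (x \<otimes>\<^bsub>G\<^esub> y) p = vact v (y \<otimes>\<^bsub>G\<^esub> x) p"
      \<comment> \<open>By \<open>val_vact\<close> both sides are a product followed by
        \<open>val p\<close> and the inverse of a retract; the retracts agree by
        \<open>abelian\<close>, so these factors cancel.\<close>
      then have "val (vact v (x \<otimes>\<^bsub>A\<^esub> y) p) = val (vact v (y \<otimes>\<^bsub>A\<^esub> x) p)" by (simp add: G)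
      then show "x \<otimes>\<^bsub>G\<^esub> y = y \<otimes>\<^bsub>G\<^esub> x"
        using abelian[OF v, of x y] x y xA yA by (simp add: G val_vact)
    next
      show "vact v \<one>\<^bsub>G\<^esub> p = p" for p by (simp add: G)
    qed
  qed
  have ell: "x = \<one>\<^bsub>G\<^esub>" if x: "x \<in> carrier G" and fx: "\<And>v. v \<in> W \<Longrightarrow> \<exists>p. vact v x p = p" for x
  proof -
    obtain x' where x': "x' \<in> carrier F" "x = rho W (\<phi> x')" using x by (auto simp: G H_def \<psi>_def)
    have "x = \<one>\<^bsub>A\<^esub>"
    proof (rule eq_one_of_all_elliptic[OF fin])
      show "x \<in> carrier A" using x HA G by auto
      show "\<exists>p. vact v x p = p" if "v \<in> V" for v
        using fx[of v] vact_rnil[of "\<phi> x'" v W] x' by (cases "v \<in> W") auto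
    qed
    then show ?thesis by (simp add: G)
  qed
  interpret G: forest G rdist W vact
  proof (intro forest.intro forest_axioms.intro grpG)
    show "tree (rdist :: 'a word set rword \<Rightarrow> _)" by (rule rword.tree_axioms)
  qed (use tree_act ell in auto)
  interpret psiG: group_hom F G \<psi>
    by unfold_locales (use psi in \<open>auto simp: hom_def G H_def\<close>)
  \<comment> \<open>With all generating pairs allowed, closure under the moves is immediate, and a
    pair with commuting images would make the whole image abelian.\<close>
  define PP where "PP = {(\<psi> c, \<psi> e) | c e. c \<in> carrier F \<and> e \<in> carrier F \<and> generate F {c, e} = carrier F}"
  have PP: "G.nielsen_closed PP"
    unfolding G.nielsen_closed_def
  proof (intro allI impI)
    fix g h assume "(g, h) \<in> PP"
    then obtain c e where ce: "c \<in> carrier F" "e \<in> carrier F" "generate F {c, e} = carrier F" "g = \<psi> c" "h = \<psi> e"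
      by (auto simp: PP_def)
    have "generate F {e, c} = carrier F" using ce(3) by (simp add: insert_commute)
    moreover have "generate F {inv\<^bsub>F\<^esub> c, e} = carrier F"
    proof (rule F.generate_eq_carrier[OF ce(3)])
      have "inv\<^bsub>F\<^esub> (inv\<^bsub>F\<^esub> c) \<in> generate F {inv\<^bsub>F\<^esub> c, e}" by (rule generate.inv) simp
      then show "{c, e} \<subseteq> generate F {inv\<^bsub>F\<^esub> c, e}" using ce by (auto intro: generate.incl)
    qed (use ce in simp)
    moreover have "generate F {c, c \<otimes>\<^bsub>F\<^esub> e} = carrier F"
    proof (rule F.generate_eq_carrier[OF ce(3)])
      have "inv\<^bsub>F\<^esub> c \<otimes>\<^bsub>F\<^esub> (c \<otimes>\<^bsub>F\<^esub> e) \<in> generate F {c, c \<otimes>\<^bsub>F\<^esub> e}"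
        by (intro generate.eng generate.inv generate.incl) simp_all
      moreover have "inv\<^bsub>F\<^esub> c \<otimes>\<^bsub>F\<^esub> (c \<otimes>\<^bsub>F\<^esub> e) = e" using ce by (simp flip: F.m_assoc)
      ultimately show "{c, e} \<subseteq> generate F {c, c \<otimes>\<^bsub>F\<^esub> e}" using ce by (auto intro: generate.incl)
    qed (use ce in simp)
    moreover have PPI: "(\<psi> c', \<psi> e') \<in> PP" if "c' \<in> carrier F" "e' \<in> carrier F" "generate F {c', e'} = carrier F" for c' e'
      using that by (auto simp: PP_def)
    ultimately have "(\<psi> e, \<psi> c) \<in> PP" "(\<psi> (inv\<^bsub>F\<^esub> c), \<psi> e) \<in> PP" "(\<psi> c, \<psi> (c \<otimes>\<^bsub>F\<^esub> e)) \<in> PP"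
      using ce PPI[of e c] PPI[of "inv\<^bsub>F\<^esub> c" e] PPI[of c "c \<otimes>\<^bsub>F\<^esub> e"]
      by (simp_all del: psi.hom_inv psi.hom_mult psiG.hom_inv psiG.hom_mult)
    then show "g \<in> carrier G \<and> h \<in> carrier G \<and> (h, g) \<in> PP \<and> (inv\<^bsub>G\<^esub> g, h) \<in> PP \<and> (g, g \<otimes>\<^bsub>G\<^esub> h) \<in> PP"
      using ce by (simp del: psi.hom_inv psi.hom_mult)
  qed
  have "(\<psi> a, \<psi> b) \<in> PP" using ab by (auto simp: PP_def)
  then have ne: "PP \<noteq> {}" by auto
  have ncPP: "g \<otimes>\<^bsub>G\<^esub> h \<noteq> h \<otimes>\<^bsub>G\<^esub> g" if "(g, h) \<in> PP" for g h
  proof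
    assume gh: "g \<otimes>\<^bsub>G\<^esub> h = h \<otimes>\<^bsub>G\<^esub> g"
    obtain c e where ce: "c \<in> carrier F" "e \<in> carrier F" "generate F {c, e} = carrier F" "g = \<psi> c" "h = \<psi> e"
      using \<open>(g, h) \<in> PP\<close> by (auto simp: PP_def)
    have "\<psi> a \<otimes>\<^bsub>A\<^esub> \<psi> b = \<psi> b \<otimes>\<^bsub>A\<^esub> \<psi> a"
      by (rule psi.commute_generate[of "{c, e}"]) (use ce gh ab in \<open>auto simp: G\<close>)
    then show False using W(2) by (simp add: com_def \<psi>_def)
  qed
  show thesis
  proof (rule G.undistorted_pair[OF finW PP ne ncPP, where z = rnil])
    fix c' e' C assume ce': "(c', e') \<in> PP" and C: "0 \<le> C"
      and bd: "\<And>ss. alternating ss \<Longrightarrow> (\<Sum>s\<leftarrow>ss. \<bar>snd s\<bar>) \<le> C * ((\<Sum>i\<in>W. rdist rnil (vact i (G.ev c' e' ss) rnil)) + 1)"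
    obtain c e where ce: "c \<in> carrier F" "e \<in> carrier F" "generate F {c, e} = carrier F" "c' = \<psi> c" "e' = \<psi> e"
      using ce' by (auto simp: PP_def)
    have ev: "G.ev c' e' ss = \<psi> (F.ev c e ss)" for ss
    proof (induction ss)
      case (Cons s ss)
      have "\<psi> (F.syl c e (fst s) [^]\<^bsub>F\<^esub> snd s) = G.syl c' e' (fst s) [^]\<^bsub>G\<^esub> snd s"
        using ce psiG.hom_int_pow[of "F.syl c e (fst s)" "snd s"] by (simp add: F.syl_def G.syl_def)
      then show ?case using Cons ce by (simp del: psi.hom_mult)
    qed (simp add: G)
    show thesis
    proof (rule that[OF ce(1-3) C, of W])
      show "\<forall>ss. alternating ss \<longrightarrow> (\<Sum>s\<leftarrow>ss. \<bar>snd s\<bar>) \<le> C * (tree_length W (\<phi> (F.ev c e ss)) + 1)"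
        using bd by (simp add: ev tree_length_def \<psi>_def)
    qed
  qed
qed

end

theorem theorem1p4:
  fixes \<Gamma> :: "'a pair_pre_digraph"
    and u v :: 'b
    and \<phi> :: "'b word set \<Rightarrow> 'a word set"
    and S :: "'b word set set"
    and T :: "'a word set set"
  assumes "pair_graph \<Gamma>"
    and "u \<noteq> v"
    and "\<phi> \<in> hom (free_group {u, v}) (raag \<Gamma>)"
    and "\<phi> (free_gen {u, v} u) \<otimes>\<^bsub>raag \<Gamma>\<^esub> \<phi> (free_gen {u, v} v)
      \<noteq> \<phi> (free_gen {u, v} v) \<otimes>\<^bsub>raag \<Gamma>\<^esub> \<phi> (free_gen {u, v} u)"
    and "finite_generating_set (free_group {u, v}) S"
    and "finite_generating_set (raag \<Gamma>) T"
  shows "quasi_isometric_embedding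
      (carrier (free_group {u, v})) (word_metric (free_group {u, v}) S)
      (carrier (raag \<Gamma>)) (word_metric (raag \<Gamma>) T) \<phi>"
proof -
  interpret raag_group \<Gamma> .
  let ?F = "free_group {u, v}"
  interpret F: group ?F by (rule group_free_group)
  interpret phi: group_hom ?F A \<phi> by unfold_locales (rule assms(3))
  interpret graph: pair_graph \<Gamma> by (rule assms(1))
  have fin: "finite V" by (rule graph.pair_finite_verts)
  let ?u = "free_gen {u, v} u" and ?v = "free_gen {u, v} v"
  have gen: "?u \<in> carrier ?F" "?v \<in> carrier ?F" "generate ?F {?u, ?v} = carrier ?F"
    using generate_presented_group[of "{u, v}" "{}"]
    by (simp_all add: free_group_def free_gen_def)
  obtain c e W C where ce: "c \<in> carrier ?F" "e \<in> carrier ?F" "generate ?F {c, e} = carrier ?F"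
    and C: "0 \<le> C" and low: "\<forall>ss. alternating ss \<longrightarrow>
      (\<Sum>s\<leftarrow>ss. \<bar>snd s\<bar>) \<le> C * (tree_length W (\<phi> (F.ev c e ss)) + 1)"
    by (rule two_generator_lower_bound[OF fin group_free_group assms(3) gen assms(4)]) (rule that)
  define lS where "lS x = int (word_length ?F S x)" for x
  define lT where "lT x = int (word_length A T x)" for x
  define M where "M = lS c + lS e"
  define K where "K = sum (tree_length W) T"
  define K' where "K' = (\<Sum>s\<in>S. lT (\<phi> s))"
  have nn: "0 \<le> lS x" "0 \<le> lT y" for x y by (simp_all add: lS_def lT_def)
  have pos: "0 \<le> M" "0 \<le> K" "0 \<le> K'"
    unfolding M_def K_def K'_def using nn tree_length_nonneg by (auto intro: sum_nonneg add_nonneg_nonneg)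
  have up: "lT (\<phi> x) \<le> K' * lS x" if x: "x \<in> carrier ?F" for x
    unfolding K'_def lS_def
  proof (rule F.subadditive_le_word_length[OF assms(5) x])
    show "lT (\<phi> \<one>\<^bsub>?F\<^esub>) = 0" by (simp add: lT_def word_length_one)
    show "lT (\<phi> (x \<otimes>\<^bsub>?F\<^esub> y)) \<le> lT (\<phi> x) + lT (\<phi> y)" if "x \<in> carrier ?F" "y \<in> carrier ?F" for x y
      using word_length_mult_le[OF assms(6), of "\<phi> x" "\<phi> y"] that by (simp add: lT_def)
    show "lT (\<phi> (inv\<^bsub>?F\<^esub> x)) \<le> lT (\<phi> x)" if "x \<in> carrier ?F" for x
      using word_length_inv_le[OF assms(6), of "\<phi> x"] that by (simp add: lT_def)
  qed (simp add: nn)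
  have tl: "tree_length W X \<le> K * lT X" if X: "X \<in> carrier A" for X
    unfolding K_def lT_def
    by (rule subadditive_le_word_length[OF assms(6) X])
      (simp_all add: tree_length_nonneg tree_length_one tree_length_mult tree_length_inv)
  \<comment> \<open>Word length in the free group is compared with the exponents of \<open>c\<close>
    and \<open>e\<close>, these with the total displacement, and that with word length in the Artin
    group.\<close>
  have lower: "lS x \<le> M * C * K * lT (\<phi> x) + M * C" if x: "x \<in> carrier ?F" for x
  proof -
    obtain ss where ss: "alternating ss" "F.ev c e ss = x"
      using F.ex_alternating[OF ce(1,2)] x ce(3) by metis
    have "lS x \<le> M * (\<Sum>s\<leftarrow>ss. \<bar>snd s\<bar>)"
      using F.word_length_ev_le[OF assms(5) ce(1,2), of ss] ss(2) by (simp add: lS_def M_def)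
    also have "\<dots> \<le> M * (C * (K * lT (\<phi> x) + 1))"
    proof (intro mult_left_mono pos)
      have "C * (tree_length W (\<phi> x) + 1) \<le> C * (K * lT (\<phi> x) + 1)"
        using tl[of "\<phi> x"] x C by (intro mult_left_mono) simp_all
      then show "(\<Sum>s\<leftarrow>ss. \<bar>snd s\<bar>) \<le> C * (K * lT (\<phi> x) + 1)"
        using low ss by auto
    qed
    finally show ?thesis by (simp add: algebra_simps)
  qed
  define L where "L = M * C * K + K' + 1"
  have MC: "0 \<le> M * C" "0 \<le> M * C * K" using pos C by simp_all
  have L: "1 \<le> L" "M * C * K \<le> L" "K' \<le> L" using MC pos by (simp_all add: L_def)
  show ?thesis
    unfolding quasi_isometric_embedding_def
  proof (rule conjI, force, rule exI[of _ "real_of_int L"], rule exI[of _ "real_of_int (M * C)"], intro conjI ballI)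
    show "1 \<le> real_of_int L" "0 \<le> real_of_int (M * C)" using L(1) MC(1) by linarith+
    fix p q assume pq: "p \<in> carrier ?F" "q \<in> carrier ?F"
    define x where "x = inv\<^bsub>?F\<^esub> p \<otimes>\<^bsub>?F\<^esub> q"
    have x: "x \<in> carrier ?F" using pq by (simp add: x_def)
    have mS: "word_metric ?F S p q = real_of_int (lS x)" by (simp add: word_metric_def lS_def x_def)
    have mT: "word_metric A T (\<phi> p) (\<phi> q) = real_of_int (lT (\<phi> x))"
      using pq by (simp add: word_metric_def lT_def x_def)
    \<comment> \<open>The additive constant is enlarged by the factor \<open>L\<close>, so that
      division by \<open>L\<close> returns \<open>M * C\<close>.\<close>
    have "M * C * K * lT (\<phi> x) + M * C \<le> L * lT (\<phi> x) + L * (M * C)"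
      using L MC nn by (intro add_mono mult_right_mono) (auto intro: mult_right_mono[of 1 L, simplified])
    then have "lS x \<le> L * (lT (\<phi> x) + M * C)" using lower[OF x] by (simp add: algebra_simps)
    then have "real_of_int (lS x) \<le> real_of_int L * (real_of_int (lT (\<phi> x)) + real_of_int (M * C))"
      by (metis of_int_add of_int_le_iff of_int_mult)
    then have "real_of_int (lS x) / real_of_int L \<le> real_of_int (lT (\<phi> x)) + real_of_int (M * C)"
      using L(1) by (simp add: divide_le_eq mult.commute)
    then show "1 / real_of_int L * word_metric ?F S p q - real_of_int (M * C) \<le> word_metric A T (\<phi> p) (\<phi> q)"
      unfolding mS mT by simp
    have "lT (\<phi> x) \<le> L * lS x + M * C"
      using up[OF x] mult_right_mono[OF L(3) nn(1)[of x]] MC(1) by linarith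
    then show "word_metric A T (\<phi> p) (\<phi> q) \<le> real_of_int L * word_metric ?F S p q + real_of_int (M * C)"
      unfolding mS mT by (metis of_int_add of_int_le_iff of_int_mult)
  qed
qed

end
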